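(* Let $I\subsetneq J\subset S=K[x_1,\ldots,x_n]$ be two squarefree monomial ideals ($I=0$ and $J=S$ are allowed). Then $$\operatorname{hdepth}(J/I)=\max\{q\in\{0,1,\ldots,n\}\;:\;\beta_k^q(J/I)\geq 0\text{ for all }0\leq k\leq q\}.$$
   Context: $K$ is a field and $S=K[x_1,\ldots,x_n]$ carries the standard grading. For a finitely generated graded $S$-module $M$ with Hilbert series $H_M(t)$, the Hilbert depth $\operatorname{hdepth}(M)$ is the maximal depth of a finitely generated graded $S$-module $N$ with $H_N(t)=H_M(t)$; equivalently (a theorem of Uliczka), $\operatorname{hdepth}(M)=\max\{r\ge 0:(1-t)^rH_M(t)\text{ has only non-negative coefficients}\}$. For $0\le j\le n$, $\alpha_j(J/I)$ denotes the number of squarefree monomials $u\in S$ of degree $j$ with $u\in J\setminus I$. For $0\le k\le q\le n$, $$\beta_k^q(J/I)=\sum_{j=0}^k(-1)^{k-j}\binom{q-j}{k-j}\alpha_j(J/I).$$ *)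

theory Defs
  imports
    "Jordan_Normal_Form.VS_Connect"
    "HOL-Algebra.QuotRing"
    "HOL-Library.Cardinality"
    "HOL-Library.Poly_Mapping"
    "HOL-Computational_Algebra.Formal_Laurent_Series"
begin

hide_const (open) Multiset.mult Polynomial.smult

text \<open>
  The polynomial ring in the variables \<open>x\<^sub>i\<close>, \<open>i :: 'n\<close>, over the field \<open>'k\<close>: an exponent vector
  is a map \<open>'n \<Rightarrow>\<^sub>0 nat\<close>, and the number of variables is \<open>CARD('n)\<close>. As a ring record it is
  \<^term>\<open>class_ring\<close>.
\<close>

type_synonym ('n, 'k) mpoly = "('n \<Rightarrow>\<^sub>0 nat) \<Rightarrow>\<^sub>0 'k"

definition const :: "'k::field \<Rightarrow> ('n::finite, 'k) mpoly" where
  "const c = Poly_Mapping.single 0 c"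

definition var :: "'n::finite \<Rightarrow> ('n, 'k::field) mpoly" where
  "var i = Poly_Mapping.single (Poly_Mapping.single i 1) 1"

definition monom_degree :: "('n::finite \<Rightarrow>\<^sub>0 nat) \<Rightarrow> nat" where
  "monom_degree e = (\<Sum>i\<in>UNIV. Poly_Mapping.lookup e i)"

definition homogeneous_part :: "int \<Rightarrow> ('n::finite, 'k::field) mpoly set" where
  "homogeneous_part d = {f. \<forall>e\<in>Poly_Mapping.keys f. int (monom_degree e) = d}"

definition irrelevant_ideal :: "('n::finite, 'k::field) mpoly set" where
  "irrelevant_ideal = genideal class_ring (range var)"


text \<open>Graded modules over the polynomial ring; \<open>G i\<close> is the component of degree \<open>i\<close>.\<close>

locale graded_module =
  Module.module "class_ring :: ('n::finite, 'k::field) mpoly ring" M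
  for M :: "(('n::finite, 'k::field) mpoly, 'm) module" and G :: "int \<Rightarrow> 'm set" +
  assumes component_subgroup: "additive_subgroup (G i) M"
    and smult_component:
      "\<lbrakk>f \<in> homogeneous_part d; x \<in> G i\<rbrakk> \<Longrightarrow> f \<odot>\<^bsub>M\<^esub> x \<in> G (d + i)"
    and direct_sum_decomposition:
      "x \<in> carrier M \<Longrightarrow>
        \<exists>!c. (\<forall>i. c i \<in> G i) \<and> finite {i. c i \<noteq> \<zero>\<^bsub>M\<^esub>} \<and> x = finsum M c {i. c i \<noteq> \<zero>\<^bsub>M\<^esub>}"

definition finitely_generated :: "(('n::finite, 'k::field) mpoly, 'm) module \<Rightarrow> bool" where
  "finitely_generated M \<longleftrightarrow>
     (\<exists>A. finite A \<and> A \<subseteq> carrier M \<and> LinearCombinations.module.span class_ring M A = carrier M)"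

definition component_space ::
    "(('n::finite, 'k::field) mpoly, 'm) module \<Rightarrow> (int \<Rightarrow> 'm set) \<Rightarrow> int \<Rightarrow> ('k, 'm) module" where
  "component_space M G i =
     \<lparr>carrier = G i, mult = mult M, one = one M, zero = zero M, add = add M,
      smult = (\<lambda>c x. const c \<odot>\<^bsub>M\<^esub> x)\<rparr>"

text \<open>
  For a finitely generated graded module all components are finite-dimensional and those of
  sufficiently negative degree vanish, so that the dimension and the Laurent series are meaningful.
\<close>

definition hilbert_series ::
    "(('n::finite, 'k::field) mpoly, 'm) module \<Rightarrow> (int \<Rightarrow> 'm set) \<Rightarrow> int fls" where
  "hilbert_series M G =
     Abs_fls (\<lambda>i. int (vectorspace.dim (class_ring :: 'k ring) (component_space M G i)))"


text \<open>The submodule \<open>(f\<^sub>1, \<dots>, f\<^sub>r) M\<close>.\<close>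

definition ideal_times :: "('n::finite, 'k::field) mpoly list \<Rightarrow> (('n, 'k) mpoly, 'm) module \<Rightarrow> 'm set"
  where
  "ideal_times fs M = LinearCombinations.module.span class_ring M {f \<odot>\<^bsub>M\<^esub> x | f x. f \<in> set fs \<and> x \<in> carrier M}"

text \<open>The first condition says that \<open>f\<^sub>i\<close> is a nonzerodivisor on \<open>M / (f\<^sub>1, \<dots>, f\<^sub>i\<^sub>-\<^sub>1) M\<close>.\<close>

definition regular_sequence ::
    "(('n::finite, 'k::field) mpoly, 'm) module \<Rightarrow> ('n, 'k) mpoly list \<Rightarrow> bool" where
  "regular_sequence M fs \<longleftrightarrow>
     (\<forall>i<length fs. \<forall>x\<in>carrier M.
        (fs ! i) \<odot>\<^bsub>M\<^esub> x \<in> ideal_times (take i fs) M \<longrightarrow> x \<in> ideal_times (take i fs) M) \<and>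
     ideal_times fs M \<noteq> carrier M"

text \<open>Used for nonzero finitely generated graded modules, where the maximum exists.\<close>

definition depth :: "(('n::finite, 'k::field) mpoly, 'm) module \<Rightarrow> nat" where
  "depth M = Max {length fs | fs. set fs \<subseteq> irrelevant_ideal \<and> regular_sequence M fs}"

text \<open>
  The competing modules \<open>N\<close> have elements of type \<open>(nat \<Rightarrow> ('n, 'k) mpoly) set\<close>. This is no
  restriction: a finitely generated module over the polynomial ring \<open>S\<close> is isomorphic to some
  \<open>S\<^sup>m / U\<close>, whose elements are cosets, that is, subsets of \<open>S\<^sup>m \<subseteq> (nat \<Rightarrow> S)\<close>. The addition and the
  scalar multiplication of \<open>N\<close> are arbitrary.
\<close>

definition hdepth :: "(('n::finite, 'k::field) mpoly, 'm) module \<Rightarrow> (int \<Rightarrow> 'm set) \<Rightarrow> nat" where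
  "hdepth M G =
     Max {depth N | (N :: (('n, 'k) mpoly, (nat \<Rightarrow> ('n, 'k) mpoly) set) module) H.
            graded_module N H \<and> finitely_generated N \<and> hilbert_series N H = hilbert_series M G}"


text \<open>
  The quotient \<open>M / U\<close> by a submodule, in the style of \<^const>\<open>FactRing\<close>. The ring
  multiplication and unit are fields inherited by module records and play no role.
\<close>

definition quotient_module :: "('a, 'm) module \<Rightarrow> 'm set \<Rightarrow> ('a, 'm set) module" where
  "quotient_module M U =
     \<lparr>carrier = a_rcosets\<^bsub>M\<^esub> U, mult = undefined, one = undefined, zero = U,
      add = set_add M, smult = (\<lambda>f X. \<Union>x\<in>X. U +>\<^bsub>M\<^esub> (f \<odot>\<^bsub>M\<^esub> x))\<rparr>"

definition ideal_as_module ::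
    "('n::finite, 'k::field) mpoly set \<Rightarrow> (('n, 'k) mpoly, ('n, 'k) mpoly) module" where
  "ideal_as_module J =
     \<lparr>carrier = J, mult = (*), one = 1, zero = 0, add = (+), smult = (*)\<rparr>"

definition ideal_quotient ::
    "('n::finite, 'k::field) mpoly set \<Rightarrow> ('n, 'k) mpoly set
      \<Rightarrow> (('n, 'k) mpoly, ('n, 'k) mpoly set) module" where
  "ideal_quotient J I = quotient_module (ideal_as_module J) I"

definition ideal_quotient_grading ::
    "('n::finite, 'k::field) mpoly set \<Rightarrow> ('n, 'k) mpoly set \<Rightarrow> int \<Rightarrow> ('n, 'k) mpoly set set" where
  "ideal_quotient_grading J I i =
     {I +>\<^bsub>ideal_as_module J\<^esub> f | f. f \<in> J \<inter> homogeneous_part i}"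


definition squarefree_monomials :: "('n::finite, 'k::field) mpoly set" where
  "squarefree_monomials = {Poly_Mapping.single e 1 | e. \<forall>i. Poly_Mapping.lookup e i \<le> 1}"

definition squarefree_monomial_ideal :: "('n::finite, 'k::field) mpoly set \<Rightarrow> bool" where
  "squarefree_monomial_ideal I \<longleftrightarrow> (\<exists>A \<subseteq> squarefree_monomials. I = genideal class_ring A)"

definition alpha :: "('n::finite, 'k::field) mpoly set \<Rightarrow> ('n, 'k) mpoly set \<Rightarrow> nat \<Rightarrow> nat" where
  "alpha J I j = card {u \<in> squarefree_monomials \<inter> homogeneous_part (int j). u \<in> J - I}"

definition beta :: "('n::finite, 'k::field) mpoly set \<Rightarrow> ('n, 'k) mpoly set \<Rightarrow> nat \<Rightarrow> nat \<Rightarrow> int" where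
  "beta J I q k =
     (\<Sum>j=0..k. (-1) ^ (k - j) * int ((q - j) choose (k - j)) * int (alpha J I j))"

end

(* The squarefree monomials decompose the Hilbert series of J/I as
   H(t) = sum_j alpha_j t^j / (1-t)^j, and for k <= q the coefficient of t^k in (1-t)^q H(t) is
   beta_k^q.

   If these numbers are nonnegative, then H(t) = sum_{k<=q} beta_k^q t^k / (1-t)^q +
   sum_{j>q} alpha_j t^j / (1-t)^j is visibly the Hilbert series of a direct sum of shifted
   polynomial rings in at least q variables each, so it is attained by a module of depth at
   least q.

   Conversely, let N be a module with Hilbert series H and a regular sequence of length r in the
   irrelevant ideal, not necessarily homogeneous. Then the cohomology of the Koszul complex of
   the variables with coefficients in N vanishes below degree r. This survives the extension of
   the field K to the uncountable field K((u)), over which each of r successive generic linear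
   forms is a nonzerodivisor and lowers the bound on the vanishing range by one. Hence
   (1-t)^r H(t) is the Hilbert series of the quotient, so its coefficients are nonnegative;
   those up to t^r are the beta_k^r, and r is at most the pole order of H at t = 1. *)
theory Submission
  imports
    Defs
    "HOL-Library.Countable_Set"
    "HOL-Library.Function_Algebras"
begin

text \<open>Depth is defined through arbitrary elements of the irrelevant ideal, so the quotients by
  a regular sequence carry no grading and no Hilbert series. Koszul cohomology is the way back: its
  vanishing is inferred from the ungraded quotients but is a statement about the graded module
  itself, and there homogeneous elements can replace the given sequence. Two obstacles shape the
  rest. Over a finite field no linear form need be a nonzerodivisor; and a generic form fails for
  finitely many parameters in each degree, but there are infinitely many degrees, so only an
  uncountable field is sure to provide one parameter for all of them. This takes the place of
  associated primes and Noetherian arguments: once bases are chosen, a module is a family of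
  matrices, and extending the field means reading the same matrices over Laurent series. In the
  Koszul arguments quotients are pairs of sets \<open>U\<close> inside \<open>V\<close>, and only
  \<open>U\<close> grows. On the combinatorial side a squarefree monomial ideal becomes a property
  of supports, and its Hilbert series a count of exponents by support.\<close>

abbreviation keys :: "('a \<Rightarrow>\<^sub>0 'b::zero) \<Rightarrow> 'a set" where "keys \<equiv> Poly_Mapping.keys"
abbreviation lookup :: "('a \<Rightarrow>\<^sub>0 'b::zero) \<Rightarrow> 'a \<Rightarrow> 'b" where "lookup \<equiv> Poly_Mapping.lookup"
abbreviation single :: "'a \<Rightarrow> 'b::zero \<Rightarrow> 'a \<Rightarrow>\<^sub>0 'b" where "single \<equiv> Poly_Mapping.single"

abbreviation hilbert_function ::
    "(('n::finite, 'k::field) mpoly, 'm) module \<Rightarrow> (int \<Rightarrow> 'm set) \<Rightarrow> int \<Rightarrow> nat" where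
  "hilbert_function M G i \<equiv> vectorspace.dim (class_ring :: 'k ring) (component_space M G i)"


section \<open>The Koszul complex\<close>

definition additive_subgrp :: "'v::ab_group_add set \<Rightarrow> bool" where
  "additive_subgrp V \<longleftrightarrow> 0 \<in> V \<and> (\<forall>u\<in>V. \<forall>v\<in>V. u - v \<in> V)"

lemma additive_subgrpD:
  assumes "additive_subgrp V"
  shows "0 \<in> V" "u \<in> V \<Longrightarrow> v \<in> V \<Longrightarrow> u - v \<in> V" "u \<in> V \<Longrightarrow> - u \<in> V"
    "u \<in> V \<Longrightarrow> v \<in> V \<Longrightarrow> u + v \<in> V"
proof -
  show zero: "0 \<in> V" and diff: "u \<in> V \<Longrightarrow> v \<in> V \<Longrightarrow> u - v \<in> V" for u v
    using assms by (auto simp: additive_subgrp_def)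
  show uminus: "u \<in> V \<Longrightarrow> - u \<in> V" for u
    using diff[OF zero, of u] by simp
  show "u \<in> V \<Longrightarrow> v \<in> V \<Longrightarrow> u + v \<in> V"
    using diff[of u "- v"] uminus[of v] by simp
qed

lemma additive_subgrp_sum:
  assumes "additive_subgrp V" "\<And>a. a \<in> A \<Longrightarrow> f a \<in> V"
  shows "sum f A \<in> V"
  using assms(2)
  by (induction A rule: infinite_finite_induct) (auto intro: additive_subgrpD[OF assms(1)])

text \<open>Stands for the scalar (-1)^m; the values of cochains form a bare abelian group, on which
  no ring of scalars acts.\<close>

definition sgn_pow :: "nat \<Rightarrow> 'v::ab_group_add \<Rightarrow> 'v" where
  "sgn_pow m v = (if even m then v else - v)"

lemma sgn_pow_simps [simp]:
  "sgn_pow m 0 = 0" "sgn_pow m (sgn_pow m v) = v" "sgn_pow m (- v) = - sgn_pow m v"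
  "sgn_pow (Suc m) v = - sgn_pow m v"
  by (auto simp: sgn_pow_def)

lemma sgn_pow_add: "sgn_pow m (u + v) = sgn_pow m u + sgn_pow m v"
  by (auto simp: sgn_pow_def)

lemma sgn_pow_commute: "sgn_pow m (sgn_pow n v) = sgn_pow n (sgn_pow m v)"
  by (auto simp: sgn_pow_def)

lemma sgn_pow_sum: "sgn_pow m (sum f A) = (\<Sum>a\<in>A. sgn_pow m (f a))"
  by (auto simp: sgn_pow_def sum_negf)

lemma sgn_pow_in: "additive_subgrp V \<Longrightarrow> v \<in> V \<Longrightarrow> sgn_pow m v \<in> V"
  by (auto simp: sgn_pow_def additive_subgrpD)

text \<open>Off-diagonal terms cancel in pairs. The vanishing of the diagonal is a separate
  hypothesis because \<open>a i i = - a i i\<close> says nothing in characteristic two.\<close>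

lemma sum_alternating_zero:
  fixes a :: "'i \<Rightarrow> 'i \<Rightarrow> 'v::ab_group_add"
  assumes "finite A" "\<And>i. i \<in> A \<Longrightarrow> a i i = 0" "\<And>i j. i \<in> A \<Longrightarrow> j \<in> A \<Longrightarrow> i \<noteq> j \<Longrightarrow> a i j = - a j i"
  shows "(\<Sum>i\<in>A. \<Sum>j\<in>A. a i j) = 0"
  using assms
proof (induction A)
  case (insert x A)
  have "(\<Sum>i\<in>insert x A. \<Sum>j\<in>insert x A. a i j)
      = (\<Sum>j\<in>A. a x j) + (\<Sum>i\<in>A. a i x) + (\<Sum>i\<in>A. \<Sum>j\<in>A. a i j)"
    using insert.hyps insert.prems(1)[of x] by (simp add: sum.distrib)
  also have "(\<Sum>i\<in>A. a i x) = - (\<Sum>j\<in>A. a x j)"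
    unfolding sum_negf[symmetric] using insert.hyps insert.prems(2) by (intro sum.cong) auto
  also have "(\<Sum>i\<in>A. \<Sum>j\<in>A. a i j) = 0"
    by (rule insert.IH) (use insert.prems in blast)+
  finally show ?case by simp
qed (rule sum.empty)

text \<open>The variables act on the whole type \<open>'v\<close>, and modules enter later as
  subsets stable under them. The numbering \<nu> fixes an order of the variables, which determines
  the signs below, and later supplies the exponents of the generic linear form.\<close>

locale koszul =
  fixes X :: "'n::finite \<Rightarrow> 'v::ab_group_add \<Rightarrow> 'v" and \<nu> :: "'n \<Rightarrow> nat"
  assumes X_add: "X j (u + v) = X j u + X j v"
    and X_commute: "X j (X k v) = X k (X j v)"
    and inj_\<nu>: "inj \<nu>"
begin

lemma X_zero [simp]: "X j 0 = 0"
  using X_add[of j 0 0] by simp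

lemma X_minus [simp]: "X j (- u) = - X j u"
  using X_add[of j u "- u"] by (simp add: eq_neg_iff_add_eq_0 add.commute)

lemma X_diff: "X j (u - v) = X j u - X j v"
  using X_add[of j u "- v"] by simp

lemma X_sum: "X j (sum f A) = (\<Sum>a\<in>A. X j (f a))"
  by (induction A rule: infinite_finite_induct) (auto simp: X_add)

lemma X_sgn_pow: "X j (sgn_pow m v) = sgn_pow m (X j v)"
  by (auto simp: sgn_pow_def)

definition before :: "'n \<Rightarrow> 'n set \<Rightarrow> nat" where
  "before j T = card {i \<in> T. \<nu> i < \<nu> j}"

text \<open>A cochain \<open>c\<close> stands for the sum of the \<open>c T\<close> times
  \<open>e_T\<close> over all sets \<open>T\<close> of variables. In this reading
  \<open>wedge j\<close> is left multiplication by \<open>e_j\<close> in the exterior algebra,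
  \<open>contract j\<close> the interior product with the dual vector, and \<open>d\<close>
  multiplication by the sum of the \<open>x_j e_j\<close>.\<close>

definition wedge :: "'n \<Rightarrow> ('n set \<Rightarrow> 'v) \<Rightarrow> 'n set \<Rightarrow> 'v" where
  "wedge j c T = (if j \<in> T then sgn_pow (before j T) (c (T - {j})) else 0)"

definition contract :: "'n \<Rightarrow> ('n set \<Rightarrow> 'v) \<Rightarrow> 'n set \<Rightarrow> 'v" where
  "contract j c T = (if j \<in> T then 0 else sgn_pow (before j T) (c (insert j T)))"

definition d :: "('n set \<Rightarrow> 'v) \<Rightarrow> 'n set \<Rightarrow> 'v" where
  "d c T = (\<Sum>j\<in>UNIV. X j (wedge j c T))"

lemma \<nu>_cases: "j \<noteq> k \<Longrightarrow> \<nu> j < \<nu> k \<or> \<nu> k < \<nu> j"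
  using inj_\<nu> by (metis injD nat_neq_iff)

lemma before_remove_self: "before j (T - {j}) = before j T"
  unfolding before_def by (rule arg_cong[where f = card]) auto

lemma before_insert_self: "before j (insert j T) = before j T"
  unfolding before_def by (rule arg_cong[where f = card]) auto

lemma before_insert:
  assumes "k \<notin> T"
  shows "before j (insert k T) = (if \<nu> k < \<nu> j then Suc (before j T) else before j T)"
proof -
  have "{i \<in> insert k T. \<nu> i < \<nu> j} = (if \<nu> k < \<nu> j then insert k {i \<in> T. \<nu> i < \<nu> j} else {i \<in> T. \<nu> i < \<nu> j})"
    by auto
  then show ?thesis
    using assms by (simp add: before_def)
qed

lemma before_remove:
  assumes "k \<in> T"
  shows "before j T = (if \<nu> k < \<nu> j then Suc (before j (T - {k})) else before j (T - {k}))"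
  using before_insert[of k "T - {k}" j] assms by (simp add: insert_absorb)

lemma wedge_self: "wedge j (wedge j c) T = 0"
  by (simp add: wedge_def)

lemma wedge_anticommute:
  assumes "j \<noteq> k"
  shows "wedge j (wedge k c) T = - wedge k (wedge j c) T"
proof (cases "j \<in> T \<and> k \<in> T")
  case True
  have eq: "T - {j} - {k} = T - {k} - {j}" by auto
  show ?thesis
    using True assms \<nu>_cases[OF assms] before_remove[of k T j] before_remove[of j T k]
    by (auto simp: wedge_def eq sgn_pow_commute)
qed (use assms in \<open>auto simp: wedge_def\<close>)

text \<open>The canonical anticommutation relation of the exterior algebra. For
  \<open>j \<noteq> k\<close>, removing \<open>j\<close> and inserting \<open>k\<close> in the two
  possible orders changes exactly one of the two position counts, which gives opposite
  signs.\<close>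

lemma contract_wedge:
  "contract k (wedge j c) T + wedge j (contract k c) T = (if j = k then c T else 0)"
proof (cases "j = k")
  case True
  then show ?thesis
    by (cases "j \<in> T")
      (auto simp: wedge_def contract_def before_insert_self before_remove_self insert_absorb)
next
  case False
  show ?thesis
  proof (cases "j \<in> T \<and> k \<notin> T")
    case True
    have eq: "insert k T - {j} = insert k (T - {j})" using False by auto
    show ?thesis
      using True False \<nu>_cases[OF False] before_remove[of j T k] before_insert[of k T j]
      by (auto simp: wedge_def contract_def eq sgn_pow_commute)
  qed (use False in \<open>auto simp: wedge_def contract_def\<close>)
qed

lemma wedge_sum_X: "wedge j (\<lambda>T. \<Sum>k\<in>A. X k (f k T)) T = (\<Sum>k\<in>A. X k (wedge j (f k) T))"
  by (simp add: wedge_def sgn_pow_sum X_sgn_pow)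

lemma contract_sum_X: "contract j (\<lambda>T. \<Sum>k\<in>A. X k (f k T)) T = (\<Sum>k\<in>A. X k (contract j (f k) T))"
  by (simp add: contract_def sgn_pow_sum X_sgn_pow)

lemma wedge_add: "wedge j (\<lambda>T. a T + b T) T = wedge j a T + wedge j b T"
  by (simp add: wedge_def sgn_pow_add)

lemma d_add: "d (\<lambda>T. a T + b T) T = d a T + d b T"
  by (simp add: d_def wedge_add X_add sum.distrib)

lemma d_minus: "d (\<lambda>T. - a T) T = - d a T"
  by (auto simp: d_def wedge_def sum_negf[symmetric] intro!: sum.cong)

lemma d_diff: "d (\<lambda>T. a T - b T) T = d a T - d b T"
  using d_add[of a "\<lambda>T. - b T" T] by (simp add: d_minus)

text \<open>Commuting variables meet anticommuting exterior factors, so the double sum is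
  alternating.\<close>

lemma d_d: "d (d c) T = 0"
proof -
  have "d (d c) T = (\<Sum>j\<in>UNIV. \<Sum>k\<in>UNIV. X j (X k (wedge j (wedge k c) T)))"
    unfolding d_def by (simp add: wedge_sum_X X_sum)
  also have "\<dots> = 0"
    by (rule sum_alternating_zero) (auto simp: wedge_self X_commute intro: arg_cong simp flip: X_minus wedge_anticommute)
  finally show ?thesis .
qed

text \<open>The homotopy formula: contraction with \<open>k\<close> makes multiplication by
  \<open>x_k\<close> null-homotopic, by \<open>contract_wedge\<close> applied to each summand of
  \<open>d\<close>.\<close>

lemma contract_d: "contract k (d c) T + d (contract k c) T = X k (c T)"
proof -
  have "contract k (d c) T + d (contract k c) T
      = (\<Sum>j\<in>UNIV. X j (contract k (wedge j c) T + wedge j (contract k c) T))"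
    unfolding d_def contract_sum_X by (simp add: X_add sum.distrib)
  also have "\<dots> = (\<Sum>j\<in>UNIV. if j = k then X j (c T) else 0)"
    by (rule sum.cong) (simp_all add: contract_wedge)
  finally show ?thesis by simp
qed

section \<open>Exactness and nonzerodivisors\<close>

lemma d_in:
  assumes "additive_subgrp W" "\<And>j S. Suc (card S) = card T \<Longrightarrow> X j (c S) \<in> W"
  shows "d c T \<in> W"
  unfolding d_def
proof (rule additive_subgrp_sum[OF assms(1)])
  fix j
  have "j \<in> T \<Longrightarrow> Suc (card (T - {j})) = card T"
    by (rule card_Suc_Diff1) simp
  then show "X j (wedge j c T) \<in> W"
    using assms by (auto simp: wedge_def X_sgn_pow sgn_pow_in additive_subgrpD)
qed

text \<open>Exactness at cochain degree \<open>p\<close> of the Koszul complex of \<open>V / U\<close>, for cochains with values of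
  degree \<open>i\<close>. Cochains are functions on all sets of variables, of which only those of size \<open>p\<close>
  matter. Ungraded modules are treated as constant families.\<close>
definition exact_at :: "nat \<Rightarrow> (int \<Rightarrow> 'v set) \<Rightarrow> (int \<Rightarrow> 'v set) \<Rightarrow> int \<Rightarrow> bool" where
  "exact_at p V U i \<longleftrightarrow>
     (\<forall>c. (\<forall>T. c T \<in> V i) \<and> (\<forall>T. card T = Suc p \<longrightarrow> d c T \<in> U (i + 1)) \<longrightarrow>
       (\<exists>b. (\<forall>T. b T \<in> V (i - 1)) \<and> (\<forall>T. card T = p \<longrightarrow> c T - d b T \<in> U i)))"

lemma exact_atD:
  assumes "exact_at p V U i" "\<And>T. c T \<in> V i" "\<And>T. card T = Suc p \<Longrightarrow> d c T \<in> U (i + 1)"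
  obtains b where "\<And>T. b T \<in> V (i - 1)" "\<And>T. card T = p \<Longrightarrow> c T - d b T \<in> U i"
  using assms unfolding exact_at_def by meson

text \<open>If \<open>F\<close> is multiplication by an element \<open>\<Sum>\<^sub>j g\<^sub>j x\<^sub>j\<close>, then contracting a cochain with the \<open>g\<^sub>j\<close>
  is a homotopy from \<open>F\<close> to zero. So \<open>F c\<close> is a coboundary \<open>d b\<close> modulo \<open>U\<close>, where \<open>b\<close> is a cocycle
  modulo \<open>U + F V\<close>.\<close>
lemma exact_at_lift:
  fixes F :: "'v \<Rightarrow> 'v" and G :: "'n \<Rightarrow> 'v \<Rightarrow> 'v"
  assumes V: "additive_subgrp V" and U: "additive_subgrp U" "U \<subseteq> V"
    and XV: "\<And>j v. v \<in> V \<Longrightarrow> X j v \<in> V" and XU: "\<And>j v. v \<in> U \<Longrightarrow> X j v \<in> U"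
    and GV: "\<And>j v. v \<in> V \<Longrightarrow> G j v \<in> V" and GU: "\<And>j v. v \<in> U \<Longrightarrow> G j v \<in> U"
    and G_add: "\<And>j u v. u \<in> V \<Longrightarrow> v \<in> V \<Longrightarrow> G j (u + v) = G j u + G j v"
    and G_X: "\<And>j k v. v \<in> V \<Longrightarrow> G j (X k v) = X k (G j v)"
    and F: "\<And>v. v \<in> V \<Longrightarrow> F v = (\<Sum>j\<in>UNIV. G j (X j v))"
    and nzd: "\<And>v. v \<in> V \<Longrightarrow> F v \<in> U \<Longrightarrow> v \<in> U"
    and exact: "\<And>q i. q < p \<Longrightarrow> exact_at q (\<lambda>_. V) (\<lambda>_. {u + F v | u v. u \<in> U \<and> v \<in> V}) i"
  shows "exact_at p (\<lambda>_. V) (\<lambda>_. U) i"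
  unfolding exact_at_def
proof (intro allI impI, elim conjE)
  fix c assume c: "\<forall>T. c T \<in> V" and dc: "\<forall>T. card T = Suc p \<longrightarrow> d c T \<in> U"
  note V' = additive_subgrpD[OF V] and U' = additive_subgrpD[OF U(1)]
  have G0: "G j 0 = 0" for j using G_add[of 0 0 j] V' by simp
  have Gminus: "G j (- v) = - G j v" if "v \<in> V" for j v
    using G_add[of v "- v" j] that V' G0 by (simp add: eq_neg_iff_add_eq_0 add.commute)
  have Gsum: "G j (sum f A) = (\<Sum>a\<in>A. G j (f a))" if "\<And>a. a \<in> A \<Longrightarrow> f a \<in> V" for j and f :: "'n \<Rightarrow> 'v" and A
    using that by (induction A rule: infinite_finite_induct) (auto simp: G0 G_add additive_subgrp_sum[OF V])
  have Gsgn: "G j (sgn_pow m v) = sgn_pow m (G j v)" if "v \<in> V" for j m v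
    using that by (auto simp: sgn_pow_def Gminus)
  have FV: "F v \<in> V" if "v \<in> V" for v
    using that F XV GV by (auto intro: additive_subgrp_sum[OF V])
  have dV: "d e T \<in> V" if "\<And>T. e T \<in> V" for e T
    by (rule d_in[OF V]) (use that XV in auto)
  have dG: "d (\<lambda>T. G j (e T)) T = G j (d e T)" if "\<And>T. e T \<in> V" for j e T
  proof -
    have w: "wedge k e T \<in> V" for k using that V' by (auto simp: wedge_def sgn_pow_in[OF V])
    have "wedge k (\<lambda>T. G j (e T)) T = G j (wedge k e T)" for k
      using that by (auto simp: wedge_def Gsgn G0)
    then show ?thesis
      unfolding d_def using w XV by (simp add: Gsum G_X)
  qed
  have dF: "d (\<lambda>T. F (e T)) T = F (d e T)" if e: "\<And>T. e T \<in> V" for e T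
  proof -
    have Xe: "X j (e T) \<in> V" for j T using e XV by auto
    have "d (\<lambda>T. F (e T)) T = d (\<lambda>T. \<Sum>j\<in>UNIV. X j (G j (e T))) T"
      using e by (simp add: F G_X)
    also have "\<dots> = (\<Sum>k\<in>UNIV. \<Sum>j\<in>UNIV. X k (X j (wedge k (\<lambda>T. G j (e T)) T)))"
      unfolding d_def by (simp add: wedge_sum_X X_sum)
    also have "\<dots> = (\<Sum>j\<in>UNIV. X j (d (\<lambda>T. G j (e T)) T))"
      unfolding d_def by (subst sum.swap) (simp add: X_sum X_commute)
    also have "\<dots> = F (d e T)"
      using dV[OF e] by (simp add: dG[OF e] F G_X)
    finally show ?thesis .
  qed
  define b where "b = (\<lambda>T. \<Sum>j\<in>UNIV. G j (contract j c T))"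
  have con: "contract j c T \<in> V" for j T
    using c V' by (auto simp: contract_def sgn_pow_in[OF V])
  have bV: "b T \<in> V" for T
    unfolding b_def by (intro additive_subgrp_sum[OF V] GV con)
  have db: "d b T = (\<Sum>j\<in>UNIV. G j (d (contract j c) T))" for T
  proof -
    have "d b T = (\<Sum>j\<in>UNIV. d (\<lambda>T. G j (contract j c T)) T)"
      unfolding b_def d_def by (subst sum.swap) (rule sum.cong, simp_all add: wedge_def sgn_pow_sum X_sum)
    then show ?thesis using dG con by simp
  qed
  have homotopy: "F (c T) - d b T \<in> U" if "card T = p" for T
  proof -
    have "F (c T) - d b T = (\<Sum>j\<in>UNIV. G j (X j (c T)) - G j (d (contract j c) T))"
      using c by (simp add: F db sum_subtractf)
    also have "\<dots> = (\<Sum>j\<in>UNIV. G j (contract j (d c) T))"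
    proof (intro sum.cong refl)
      fix j
      have "d c S \<in> V" for S
        using c by (intro dV) simp
      then have V1: "contract j (d c) T \<in> V" "d (contract j c) T \<in> V"
        using con V'(1) by (auto intro!: dV simp: contract_def sgn_pow_in[OF V])
      show "G j (X j (c T)) - G j (d (contract j c) T) = G j (contract j (d c) T)"
        unfolding contract_d[of j c T, symmetric] using G_add[OF V1] by simp
    qed
    also have "\<dots> \<in> U"
      using dc that U' by (intro additive_subgrp_sum[OF U(1)] GU)
        (auto simp: contract_def intro!: sgn_pow_in[OF U(1)])
    finally show ?thesis .
  qed
  show "\<exists>b. (\<forall>T. b T \<in> V) \<and> (\<forall>T. card T = p \<longrightarrow> c T - d b T \<in> U)"
  proof (cases p)
    \<comment> \<open>There are no coboundaries in cochain degree zero, so \<open>F c\<close> itself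
      lies in \<open>U\<close> and \<open>nzd\<close> cancels \<open>F\<close>.\<close>
    case 0
    have "d b T = 0" if "card T = 0" for T
      using that by (simp add: d_def wedge_def)
    then show ?thesis
      using 0 homotopy nzd c V' by (intro exI[of _ "\<lambda>_. 0"]) (auto simp: d_def wedge_def)
  next
    case (Suc q)
    have "d b T \<in> {u + F v | u v. u \<in> U \<and> v \<in> V}" if "card T = Suc q" for T
    proof -
      have "d b T = - (F (c T) - d b T) + F (c T)" by simp
      then show ?thesis
        using homotopy[of T] that Suc c U' by blast
    qed
    then obtain e where e: "\<And>T. e T \<in> V"
      and e': "\<And>T. card T = q \<Longrightarrow> b T - d e T \<in> {u + F v | u v. u \<in> U \<and> v \<in> V}"
      using exact_atD[OF exact[of q 0], of b] Suc bV by (metis (no_types, lifting) lessI)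
    have "\<exists>v. v \<in> V \<and> (card T = q \<longrightarrow> b T - d e T - F v \<in> U)" for T
    proof (cases "card T = q")
      case True
      then obtain u v where uv: "b T - d e T = u + F v" "u \<in> U" "v \<in> V" using e' by blast
      then have "b T - d e T - F v = u" by (simp add: algebra_simps)
      then show ?thesis using uv by auto
    qed (use V' in auto)
    then obtain a where aV: "\<And>T. a T \<in> V" and a: "\<And>T. card T = q \<Longrightarrow> b T - d e T - F (a T) \<in> U"
      by metis
    \<comment> \<open>Modulo \<open>U\<close>, \<open>b\<close> equals \<open>d e + F a\<close> in
      degree \<open>q\<close>, so \<open>d d = 0\<close> gives \<open>d b = F (d a)\<close>. Hence
      \<open>F (c - d a)\<close> lies in \<open>U\<close>, and \<open>F\<close> can be
      cancelled.\<close>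
    have "c T - d a T \<in> U" if T: "card T = p" for T
    proof (rule nzd)
      show "c T - d a T \<in> V" using c dV aV V' by auto
      have F_diff: "F (u - v) = F u - F v" if "u \<in> V" "v \<in> V" for u v
        using that V' XV by (simp add: F X_diff sum_subtractf G_add[of _ "- _", simplified] Gminus)
      have "d (\<lambda>T. b T - d e T - F (a T)) T \<in> U"
        by (rule d_in[OF U(1)]) (use a XU T Suc in auto)
      then have "d b T - F (d a T) \<in> U"
        using aV by (simp add: d_diff d_d dF)
      moreover have "F (c T - d a T) = (F (c T) - d b T) + (d b T - F (d a T))"
        using c aV dV by (simp add: F_diff)
      ultimately show "F (c T - d a T) \<in> U"
        using homotopy[OF T] U' by metis
    qed
    then show ?thesis using aV by blast
  qed
qed

text \<open>The long exact cohomology sequence of a nonzerodivisor \<open>F\<close> of degree one,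
  done by hand: the failure of \<open>c\<close> to be a cocycle modulo \<open>U\<close> is some
  \<open>F a\<close>, injectivity makes \<open>a\<close> a cocycle, exactness at
  \<open>Suc p\<close> writes \<open>a\<close> as \<open>d b\<close>, and exactness at
  \<open>p\<close> applies to \<open>c - F b\<close>. Two positions are used to obtain one, which is
  why the range shrinks.\<close>

lemma exact_at_quotient:
  fixes F :: "'v \<Rightarrow> 'v"
  assumes V: "\<And>i. additive_subgrp (V i)" and U: "\<And>i. additive_subgrp (U i)" "\<And>i. U i \<subseteq> V i"
    and XV: "\<And>i j v. v \<in> V i \<Longrightarrow> X j v \<in> V (i + 1)" and XU: "\<And>i j v. v \<in> U i \<Longrightarrow> X j v \<in> U (i + 1)"
    and FV: "\<And>i v. v \<in> V i \<Longrightarrow> F v \<in> V (i + 1)" and FU: "\<And>i v. v \<in> U i \<Longrightarrow> F v \<in> U (i + 1)"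
    and F_add: "\<And>u v. F (u + v) = F u + F v" and F_X: "\<And>k v. F (X k v) = X k (F v)"
    and nzd: "\<And>i v. v \<in> V i \<Longrightarrow> F v \<in> U (i + 1) \<Longrightarrow> v \<in> U i"
    and exact: "\<And>i. exact_at p V U i" "\<And>i. exact_at (Suc p) V U i"
  shows "exact_at p V (\<lambda>i. {u + F v | u v. u \<in> U i \<and> v \<in> V (i - 1)}) i"
  unfolding exact_at_def
proof (intro allI impI, elim conjE)
  fix c assume c: "\<forall>T. c T \<in> V i"
    and dc: "\<forall>T. card T = Suc p \<longrightarrow> d c T \<in> {u + F v | u v. u \<in> U (i + 1) \<and> v \<in> V (i + 1 - 1)}"
  note V' = additive_subgrpD[OF V] and U' = additive_subgrpD[OF U(1)]
  have F0: "F 0 = 0" using F_add[of 0 0] by simp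
  have Fminus: "F (- v) = - F v" for v
    using F_add[of v "- v"] F0 by (simp add: eq_neg_iff_add_eq_0 add.commute)
  have Fdiff: "F (u - v) = F u - F v" for u v
    using F_add[of u "- v"] Fminus by simp
  have Fsum: "F (sum f A) = (\<Sum>a\<in>A. F (f a))" for f :: "'n \<Rightarrow> 'v" and A
    by (induction A rule: infinite_finite_induct) (auto simp: F0 F_add)
  have Fsgn: "F (sgn_pow m v) = sgn_pow m (F v)" for m v
    by (auto simp: sgn_pow_def Fminus)
  have dF: "d (\<lambda>T. F (e T)) T = F (d e T)" for e T
    by (auto simp: d_def Fsum F_X wedge_def Fsgn F0 intro!: sum.cong)
  have dV: "d e T \<in> V (i + 1)" if "\<And>T. e T \<in> V i" for e T i
    by (rule d_in[OF V]) (use that XV in auto)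
  have "\<exists>v. v \<in> V i \<and> (card T = Suc p \<longrightarrow> d c T - F v \<in> U (i + 1))" for T
  proof (cases "card T = Suc p")
    case True
    then obtain u v where uv: "d c T = u + F v" "u \<in> U (i + 1)" "v \<in> V i" using dc by auto
    then show ?thesis by (intro exI[of _ v]) auto
  qed (use V' in auto)
  then obtain a where aV: "\<And>T. a T \<in> V i" and a: "\<And>T. card T = Suc p \<Longrightarrow> d c T - F (a T) \<in> U (i + 1)"
    by metis
  \<comment> \<open>\<open>d c - F a\<close> has values in \<open>U\<close>, and
    \<open>d (d c) = 0\<close>, so \<open>F (d a)\<close> lies in \<open>U\<close>.\<close>
  have da: "d a T \<in> U (i + 1)" if T: "card T = Suc (Suc p)" for T
  proof (rule nzd)
    show "d a T \<in> V (i + 1)" using aV by (rule dV)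
    have "d (\<lambda>T. d c T - F (a T)) T \<in> U (i + 1 + 1)"
      by (intro d_in[OF U(1)] XU a) (use T in simp)
    then show "F (d a T) \<in> U (i + 1 + 1)"
      using U'(3) by (force simp: d_diff d_d dF)
  qed
  obtain b where bV: "\<And>T. b T \<in> V (i - 1)" and b: "\<And>T. card T = Suc p \<Longrightarrow> a T - d b T \<in> U i"
    using exact_atD[OF exact(2)[of i], of a] aV da by metis
  have Fb: "F (b T) \<in> V i" for T using FV[OF bV] by simp
  have "d (\<lambda>T. c T - F (b T)) T \<in> U (i + 1)" if T: "card T = Suc p" for T
  proof -
    have "d (\<lambda>T. c T - F (b T)) T = (d c T - F (a T)) + F (a T - d b T)"
      by (simp add: d_diff dF Fdiff)
    then show ?thesis using U'(4)[OF a[OF T] FU[OF b[OF T]]] by simp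
  qed
  moreover have "c T - F (b T) \<in> V i" for T
    using c Fb by (intro V'(2)) auto
  ultimately obtain e where eV: "\<And>T. e T \<in> V (i - 1)" and e: "\<And>T. card T = p \<Longrightarrow> c T - F (b T) - d e T \<in> U i"
    using exact_atD[OF exact(1)[of i], of "\<lambda>T. c T - F (b T)"] by metis
  have "c T - d e T \<in> {u + F v | u v. u \<in> U i \<and> v \<in> V (i - 1)}" if "card T = p" for T
  proof -
    have "c T - d e T = (c T - F (b T) - d e T) + F (b T)" by simp
    then show ?thesis using e[OF that] bV by blast
  qed
  then show "\<exists>b. (\<forall>T. b T \<in> V (i - 1)) \<and>
      (\<forall>T. card T = p \<longrightarrow> c T - d b T \<in> {u + F v | u v. u \<in> U i \<and> v \<in> V (i - 1)})"
    using eV by blast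
qed

end

section \<open>Generic linear forms\<close>

text \<open>Fraction-free Gaussian elimination in one parameter: either the rows are dependent over
  the polynomial ring, or specialisation keeps them independent away from the roots of finitely many
  pivots.\<close>

lemma polynomial_vectors_dependent_or_generically_independent:
  fixes M :: "'s \<Rightarrow> 't \<Rightarrow> 'l::field poly"
  assumes "finite S"
  shows "(\<exists>a. (\<exists>s\<in>S. a s \<noteq> 0) \<and> (\<forall>t\<in>T. (\<Sum>s\<in>S. a s * M s t) = 0)) \<or>
    finite {c. \<exists>l. (\<exists>s\<in>S. l s \<noteq> 0) \<and> (\<forall>t\<in>T. (\<Sum>s\<in>S. l s * poly (M s t) c) = 0)}"
  using assms
proof (induction S arbitrary: M rule: finite_induct)
  case (insert x S)
  show ?case
  proof (cases "\<forall>t\<in>T. M x t = 0")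
    case True
    have "(\<Sum>s\<in>insert x S. (if s = x then 1 else 0) * M s t) = 0" if "t \<in> T" for t
      using insert.hyps True that by (intro sum.neutral) auto
    then show ?thesis
      by (intro disjI1 exI[of _ "\<lambda>s. if s = x then 1 else 0"]) auto
  next
    case False
    then obtain t0 where t0: "t0 \<in> T" "M x t0 \<noteq> 0" by blast
    \<comment> \<open>Row \<open>x\<close> clears column \<open>t0\<close> from the remaining rows;
      cross-multiplication with the pivot avoids division.\<close>
    define N where "N s t = M x t0 * M s t - M s t0 * M x t" for s t
    from insert.IH[of N] show ?thesis
    proof
      assume "\<exists>a. (\<exists>s\<in>S. a s \<noteq> 0) \<and> (\<forall>t\<in>T. (\<Sum>s\<in>S. a s * N s t) = 0)"
      then obtain a where a: "\<exists>s\<in>S. a s \<noteq> 0" "\<And>t. t \<in> T \<Longrightarrow> (\<Sum>s\<in>S. a s * N s t) = 0" by blast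
      \<comment> \<open>Undoing the elimination: the multiples of row \<open>x\<close> that were
        subtracted in \<open>N\<close> are collected in its coefficient. On \<open>S\<close> the
        coefficients are multiplied by the nonzero pivot, so they do not all vanish.\<close>
      define b where "b s = (if s = x then - (\<Sum>s\<in>S. a s * M s t0) else M x t0 * a s)" for s
      have "(\<Sum>s\<in>insert x S. b s * M s t) = 0" if "t \<in> T" for t
      proof -
        have "(\<Sum>s\<in>insert x S. b s * M s t) = b x * M x t + (\<Sum>s\<in>S. b s * M s t)"
          using insert.hyps by simp
        also have "(\<Sum>s\<in>S. b s * M s t) = (\<Sum>s\<in>S. M x t0 * a s * M s t)"
          using insert.hyps by (intro sum.cong) (auto simp: b_def)
        also have "b x * M x t + \<dots> = (\<Sum>s\<in>S. a s * N s t)"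
          by (simp add: b_def N_def sum_distrib_left sum_distrib_right sum_subtractf algebra_simps)
        finally show ?thesis using a(2)[OF that] by simp
      qed
      moreover have "\<exists>s\<in>insert x S. b s \<noteq> 0"
        using a(1) t0 insert.hyps by (auto simp: b_def)
      ultimately show ?thesis by blast
    next
      assume fin: "finite {c. \<exists>l. (\<exists>s\<in>S. l s \<noteq> 0) \<and> (\<forall>t\<in>T. (\<Sum>s\<in>S. l s * poly (N s t) c) = 0)}"
        (is "finite ?A")
      \<comment> \<open>Where the pivot does not vanish at \<open>c\<close>, a relation among the
        specialised rows of \<open>M\<close> restricts on \<open>S\<close> to a relation among those
        of \<open>N\<close>, and column \<open>t0\<close> shows that it is not concentrated on
        \<open>x\<close>.\<close>
      have "{c. \<exists>l. (\<exists>s\<in>insert x S. l s \<noteq> 0) \<and> (\<forall>t\<in>T. (\<Sum>s\<in>insert x S. l s * poly (M s t) c) = 0)}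
          \<subseteq> ?A \<union> {c. poly (M x t0) c = 0}"
      proof
        fix c assume "c \<in> {c. \<exists>l. (\<exists>s\<in>insert x S. l s \<noteq> 0) \<and> (\<forall>t\<in>T. (\<Sum>s\<in>insert x S. l s * poly (M s t) c) = 0)}"
        then obtain l where l: "\<exists>s\<in>insert x S. l s \<noteq> 0"
          "\<And>t. t \<in> T \<Longrightarrow> l x * poly (M x t) c + (\<Sum>s\<in>S. l s * poly (M s t) c) = 0"
          using insert.hyps by auto
        show "c \<in> ?A \<union> {c. poly (M x t0) c = 0}"
        proof (cases "poly (M x t0) c = 0")
          case False
          have "(\<Sum>s\<in>S. l s * poly (N s t) c) = 0" if "t \<in> T" for t
          proof -
            have "(\<Sum>s\<in>S. l s * poly (N s t) c) = poly (M x t0) c * (\<Sum>s\<in>S. l s * poly (M s t) c)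
                - (\<Sum>s\<in>S. l s * poly (M s t0) c) * poly (M x t) c"
              by (simp add: N_def sum_distrib_left sum_distrib_right sum_subtractf algebra_simps)
            also have "(\<Sum>s\<in>S. l s * poly (M s t) c) = - (l x * poly (M x t) c)"
              using l(2)[OF that] by (simp add: eq_neg_iff_add_eq_0 add.commute)
            also have "(\<Sum>s\<in>S. l s * poly (M s t0) c) = - (l x * poly (M x t0) c)"
              using l(2)[OF t0(1)] by (simp add: eq_neg_iff_add_eq_0 add.commute)
            finally show ?thesis by (simp add: algebra_simps)
          qed
          moreover have "\<exists>s\<in>S. l s \<noteq> 0"
          proof (rule ccontr)
            assume "\<not> (\<exists>s\<in>S. l s \<noteq> 0)"
            then show False using l(1) l(2)[OF t0(1)] False by auto
          qed
          ultimately show ?thesis by blast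
        qed simp
      qed
      moreover have "finite {c. poly (M x t0) c = 0}"
        using poly_roots_finite[OF t0(2)] .
      ultimately show ?thesis
        using fin by (meson finite_UnI finite_subset)
    qed
  qed
qed simp

section \<open>Dimensions and coordinates modulo a subspace\<close>

context vector_space
begin

lemma span_image_sum:
  assumes "finite S" "x \<in> span (f ` S)"
  shows "\<exists>l. x = (\<Sum>s\<in>S. scale (l s) (f s))"
  using assms(2)
proof (induction rule: span_induct_alt)
  case base
  show ?case by (intro exI[of _ "\<lambda>_. 0"]) simp
next
  case (step c y z)
  then obtain s l where s: "s \<in> S" "y = f s" and l: "z = (\<Sum>s\<in>S. scale (l s) (f s))" by auto
  have "scale c y + z = (\<Sum>t\<in>S. scale ((if t = s then c else 0) + l t) (f t))"
    using assms(1) s by (simp add: scale_left_distrib sum.distrib l if_distrib[of "\<lambda>c. scale c _"] cong: if_cong)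
  then show ?case by (intro exI[of _ "\<lambda>t. (if t = s then c else 0) + l t"])
qed

text \<open>A basis of \<open>U\<close> is enlarged by the vectors \<open>f s\<close> one after
  another; if one of them were already in the span, its expansion would be a relation modulo
  \<open>U\<close> with coefficient 1. The finite set \<open>A\<close> ensures that
  \<open>dim\<close> is a true dimension and not the default value of an infinite-dimensional
  space.\<close>

lemma dim_extend_independent_mod:
  assumes U: "subspace U" "U \<subseteq> span A" "finite A" and S: "finite S"
    and indep: "\<And>l. (\<Sum>s\<in>S. scale (l s) (f s)) \<in> U \<Longrightarrow> \<forall>s\<in>S. l s = 0"
  shows "dim (U \<union> f ` S) = dim U + card S"
proof -
  obtain B0 where B0: "B0 \<subseteq> U" "independent B0" "U \<subseteq> span B0" "card B0 = dim U"
    using basis_exists by blast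
  have finB0: "finite B0"
    using independent_span_bound[OF U(3) B0(2)] B0(1) U(2) by blast
  have "\<exists>B. finite B \<and> independent B \<and> span B = span (U \<union> f ` S) \<and> card B = dim U + card S"
    using S indep
  proof (induction S rule: finite_induct)
    case empty
    have "span B0 = span U"
      using B0 U(1) by (metis span_eq span_mono span_superset subset_trans span_eq_iff)
    then show ?case using finB0 B0 by auto
  next
    case (insert x S)
    have "\<forall>s\<in>S. l s = 0" if "(\<Sum>s\<in>S. scale (l s) (f s)) \<in> U" for l
    proof -
      have "(\<Sum>s\<in>insert x S. scale ((if s = x then 0 else l s)) (f s)) = (\<Sum>s\<in>S. scale (l s) (f s))"
        using insert.hyps by (auto intro!: sum.cong)
      then have "\<forall>s\<in>insert x S. (if s = x then 0 else l s) = 0"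
        by (intro insert.prems) (use that in simp)
      then show ?thesis using insert.hyps by (metis insertCI)
    qed
    from insert.IH[OF this] obtain B where B: "finite B" "independent B" "span B = span (U \<union> f ` S)"
      "card B = dim U + card S" by blast
    have notin: "f x \<notin> span B"
    proof
      assume "f x \<in> span B"
      then obtain u w where uw: "f x = u + w" "u \<in> span U" "w \<in> span (f ` S)"
        unfolding B span_Un by blast
      obtain l where l: "w = (\<Sum>s\<in>S. scale (l s) (f s))"
        using span_image_sum[OF insert.hyps(1) uw(3)] by blast
      have "(\<Sum>s\<in>insert x S. scale (if s = x then 1 else - l s) (f s)) = f x + (\<Sum>s\<in>S. - scale (l s) (f s))"
        using insert.hyps by (auto intro!: sum.cong)
      also have "\<dots> = u" using uw l by (simp add: sum_negf)
      finally have "\<forall>s\<in>insert x S. (if s = x then 1 else - l s) = 0"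
        using uw(2) U(1) insert.prems[of "\<lambda>s. if s = x then 1 else - l s"] by (simp add: span_eq_iff[THEN iffD2])
      then show False by auto
    qed
    then have "f x \<notin> B" using span_base by blast
    moreover have "span (insert (f x) B) = span (U \<union> f ` insert x S)"
      unfolding span_insert B by (simp add: span_insert)
    ultimately show ?case
      using B insert.hyps independent_insertI[OF notin B(2)] by (intro exI[of _ "insert (f x) B"]) auto
  qed
  then show ?thesis by (metis dim_eq_card)
qed

lemma additive_sum:
  fixes \<kappa> :: "'b \<Rightarrow> 't \<Rightarrow> 'a"
  assumes V: "subspace V" and \<kappa>: "\<forall>v\<in>V. \<forall>w\<in>V. \<forall>t. \<kappa> (v + w) t = \<kappa> v t + \<kappa> w t"
    and f: "\<And>a. a \<in> A \<Longrightarrow> f a \<in> V"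
  shows "\<kappa> (sum f A) t = (\<Sum>a\<in>A. \<kappa> (f a) t)"
proof -
  have "\<kappa> 0 t = \<kappa> 0 t + \<kappa> 0 t"
    using bspec[OF bspec[OF \<kappa> subspace_0[OF V]] subspace_0[OF V]] by (simp only: add_0_left)
  then have zero: "\<kappa> 0 t = 0" by (metis add_cancel_right_right)
  show ?thesis
    using f by (induction A rule: infinite_finite_induct) (simp_all add: zero \<kappa> subspace_sum[OF V])
qed

text \<open>A basis of \<open>U\<close> is extended to one of \<open>V\<close>; \<open>S\<close>
  consists of the added vectors and \<kappa> reads off coefficients. So \<open>V / U\<close> is
  handled as the functions on \<open>S\<close>, without a quotient space.\<close>

lemma quotient_coordinates:
  assumes U: "subspace U" and V: "subspace V" "U \<subseteq> V" "V \<subseteq> span A" "finite A"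
  obtains S \<kappa> where "finite S" "S \<subseteq> V" "dim V = dim U + card S"
    "\<And>v w t. v \<in> V \<Longrightarrow> w \<in> V \<Longrightarrow> \<kappa> (v + w) t = \<kappa> v t + \<kappa> w t"
    "\<And>c v t. v \<in> V \<Longrightarrow> \<kappa> (scale c v) t = c * \<kappa> v t"
    "\<And>v. v \<in> V \<Longrightarrow> v - (\<Sum>s\<in>S. scale (\<kappa> v s) s) \<in> U"
    "\<And>v t. v \<in> U \<Longrightarrow> t \<in> S \<Longrightarrow> \<kappa> v t = 0"
    "\<And>l s. s \<in> S \<Longrightarrow> \<kappa> (\<Sum>r\<in>S. scale (l r) r) s = l s"
proof -
  obtain B0 where B0: "B0 \<subseteq> U" "independent B0" "U \<subseteq> span B0"
    by (rule basis_exists)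
  have "B0 \<subseteq> V" using B0 V by blast
  from maximal_independent_subset_extend[OF this B0(2)] obtain B where
    B: "B0 \<subseteq> B" "B \<subseteq> V" "independent B" "V \<subseteq> span B" by blast
  have finB: "finite B"
    using independent_span_bound[OF V(4) B(3)] B(2) V(3) by blast
  define S where "S = B - B0"
  define \<kappa> where "\<kappa> v t = representation B v t" for v t
  have rep: "(\<Sum>b\<in>B. scale (\<kappa> v b) b) = v" if "v \<in> V" for v
    using that B finB unfolding \<kappa>_def by (intro sum_representation_eq) auto
  have \<kappa>0: "\<kappa> v t = 0" if "v \<in> U" "t \<in> S" for v t
  proof -
    have "representation B v = representation B0 v"
      using that B0 B by (intro representation_extend) auto
    moreover have "representation B0 v t = 0"
      using that representation_ne_zero[of B0 v t] by (auto simp: S_def)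
    ultimately show ?thesis by (simp add: \<kappa>_def)
  qed
  have mod: "v - (\<Sum>s\<in>S. scale (\<kappa> v s) s) \<in> U" if "v \<in> V" for v
  proof -
    have "v = (\<Sum>s\<in>S. scale (\<kappa> v s) s) + (\<Sum>s\<in>B0. scale (\<kappa> v s) s)"
      using rep[OF that] sum.subset_diff[OF B(1) finB, of "\<lambda>s. scale (\<kappa> v s) s"] by (simp add: S_def)
    moreover have "(\<Sum>s\<in>B0. scale (\<kappa> v s) s) \<in> U"
      using B0 U by (intro subspace_sum subspace_scale) auto
    ultimately show ?thesis by (metis add_diff_cancel_left')
  qed
  have "card B0 = dim U" "card B = dim V"
    using B0 B by (auto intro: basis_card_eq_dim)
  then have "dim V = dim U + card S"
    using B(1) finB card_mono[of B B0] by (simp add: S_def card_Diff_subset finite_subset)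
  moreover have add: "\<kappa> (v + w) t = \<kappa> v t + \<kappa> w t" if "v \<in> V" "w \<in> V" for v w t
    using that B by (simp add: \<kappa>_def representation_add subsetD)
  moreover have scale: "\<kappa> (scale c v) t = c * \<kappa> v t" if "v \<in> V" for c v t
    using that B by (simp add: \<kappa>_def representation_scale subsetD)
  moreover have "\<kappa> (\<Sum>r\<in>S. scale (l r) r) s = l s" if "s \<in> S" for l s
  proof -
    have SV: "r \<in> V" if "r \<in> S" for r using that B(2) by (auto simp: S_def)
    have "\<kappa> (\<Sum>r\<in>S. scale (l r) r) s = (\<Sum>r\<in>S. l r * \<kappa> r s)"
      using SV add by (subst additive_sum[OF V(1)]) (auto simp: scale subspace_scale[OF V(1)])
    also have "\<dots> = (\<Sum>r\<in>S. if r = s then l r else 0)"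
      using B by (intro sum.cong) (auto simp: \<kappa>_def representation_basis S_def)
    finally show ?thesis using that finB by (simp add: S_def)
  qed
  moreover have "finite S" "S \<subseteq> V" using finB B(2) by (auto simp: S_def)
  ultimately show ?thesis
    using that[of S \<kappa>, OF _ _ _ _ _ mod \<kappa>0] by blast
qed

end

section \<open>Graded families of vector spaces and generic linear forms\<close>

definition difference :: "(int \<Rightarrow> int) \<Rightarrow> int \<Rightarrow> int" where
  "difference h i = h i - h (i - 1)"

text \<open>The components are subspaces of one ambient space and need not be independent of each
  other. Finite dimension in each degree takes the place of finite generation, which is not visible
  on matrices.\<close>

locale graded_family = vector_space scale + koszul X \<nu>
  for scale :: "'l::field \<Rightarrow> 'v::ab_group_add \<Rightarrow> 'v" and X :: "'n::finite \<Rightarrow> 'v \<Rightarrow> 'v" and \<nu> :: "'n \<Rightarrow> nat" +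
  fixes V :: "int \<Rightarrow> 'v set"
  assumes X_scale: "X j (scale c v) = scale c (X j v)"
    and V_subspace: "subspace (V i)"
    and V_finite: "\<exists>A. finite A \<and> V i \<subseteq> span A"
    and X_V: "v \<in> V i \<Longrightarrow> X j v \<in> V (i + 1)"
begin

definition graded_submodule :: "(int \<Rightarrow> 'v set) \<Rightarrow> bool" where
  "graded_submodule U \<longleftrightarrow> (\<forall>i. subspace (U i) \<and> U i \<subseteq> V i) \<and> (\<forall>i j. \<forall>v\<in>U i. X j v \<in> U (i + 1))"

lemma graded_submoduleD:
  assumes "graded_submodule U"
  shows "subspace (U i)" "v \<in> U i \<Longrightarrow> v \<in> V i" "v \<in> U i \<Longrightarrow> X j v \<in> U (i + 1)"
  using assms by (auto simp: graded_submodule_def)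

lemma subspace_additive: "subspace W \<Longrightarrow> additive_subgrp W"
  by (simp add: additive_subgrp_def subspace_0 subspace_diff)

text \<open>McCoy's argument: a polynomial annihilated by \<open>\<Sum>\<^sub>j u\<^bsup>\<nu> j\<^esup> X\<^sub>j\<close> can be multiplied by monomials
  until all its coefficients are annihilated by every \<open>X\<^sub>j\<close>.\<close>
lemma mccoy:
  assumes U: "graded_submodule U"
    and socle: "\<And>i v. v \<in> V i \<Longrightarrow> \<forall>j. X j v \<in> U (i + 1) \<Longrightarrow> v \<in> U i"
    and g: "\<And>k. g k \<in> V i" "\<And>k. k > D \<Longrightarrow> g k = 0"
    and rel: "\<And>k. (\<Sum>j\<in>UNIV. if \<nu> j \<le> k then X j (g (k - \<nu> j)) else 0) \<in> U (i + 1)"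
  shows "g k \<in> U i"
proof -
  note U' = graded_submoduleD[OF U]
  obtain n where n: "\<And>j. \<nu> j < n"
    using finite_nat_set_iff_bounded[of "range \<nu>"] by auto
  \<comment> \<open>Downward induction on \<open>m\<close>: the variables numbered below
    \<open>m\<close> already send every coefficient into \<open>U\<close>. For \<open>m = n\<close>
    the hypothesis \<open>socle\<close> finishes; for \<open>m = 0\<close> nothing is
    presupposed.\<close>
  have "\<forall>k. g k \<in> U i"
    if "m \<le> n" and "\<And>k. g k \<in> V i" and "\<And>k. k > D \<Longrightarrow> g k = 0"
      and "\<And>k. (\<Sum>j\<in>UNIV. if \<nu> j \<le> k then X j (g (k - \<nu> j)) else 0) \<in> U (i + 1)"
      and "\<And>j k. \<nu> j < m \<Longrightarrow> X j (g k) \<in> U (i + 1)" for m i and g :: "nat \<Rightarrow> 'v"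
    using that
  proof (induction m arbitrary: i g rule: inc_induct)
    case base
    then show ?case using socle n by blast
  next
    case (step m)
    note gV = step.prems(1) and g0 = step.prems(2) and rel = step.prems(3) and low = step.prems(4)
    show ?case
    proof (cases "\<exists>j0. \<nu> j0 = m")
      case False
      then have "X j (g k) \<in> U (i + 1)" if "\<nu> j < Suc m" for j k
        using low that by (metis less_SucE)
      then show ?thesis using step.IH[OF gV g0 rel] by blast
    next
      case True
      then obtain j0 where j0: "\<nu> j0 = m" by blast
      define Y where "Y e = X j0 ^^ e" for e
      have Y_Suc: "Y (Suc e) v = X j0 (Y e v)" "Y (Suc e) v = Y e (X j0 v)" for e v
        by (simp_all add: Y_def funpow_swap1)
      have Y_X: "Y e (X j v) = X j (Y e v)" for e j v
        by (induction e) (simp_all add: Y_def X_commute)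
      have Y_add: "Y e (u + v) = Y e u + Y e v" for e u v
        by (induction e) (simp_all add: Y_def X_add)
      have Y_0 [simp]: "Y e 0 = 0" for e
        by (induction e) (simp_all add: Y_def)
      have Y_sum: "Y e (sum f A) = (\<Sum>a\<in>A. Y e (f a))" for e and f :: "'n \<Rightarrow> 'v" and A
        by (induction A rule: infinite_finite_induct) (simp_all add: Y_add)
      have Y_V: "v \<in> V i \<Longrightarrow> Y e v \<in> V (i + int e)" for e v i
        by (induction e) (auto simp: Y_def add.assoc[symmetric] add.commute[of 1] dest: X_V[of _ _ j0])
      have Y_U: "v \<in> U i \<Longrightarrow> Y e v \<in> U (i + int e)" for e v i
        by (induction e) (auto simp: Y_def add.assoc[symmetric] add.commute[of 1] dest: U'(3)[of _ _ j0])
      \<comment> \<open>In the coefficient of index \<open>k + m\<close> of the relation, the term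
        of \<open>j0\<close> is \<open>X j0 (g k)\<close>. Variables numbered below \<open>m\<close>
        contribute elements of \<open>U\<close>; those above \<open>m\<close> involve some
        \<open>g q\<close> with \<open>q < k\<close>, which \<open>k\<close> powers of
        \<open>X j0\<close> already send into \<open>U\<close>.\<close>
      have nilp: "Y (Suc k) (g k) \<in> U (i + int (Suc k))" for k
      proof (induction k rule: less_induct)
        case (less k)
        define R where "R = (\<Sum>j\<in>UNIV. if \<nu> j \<le> k + m then X j (g (k + m - \<nu> j)) else 0)"
        have "Y k R \<in> U (i + 1 + int k)"
          unfolding R_def by (intro Y_U rel)
        moreover have "Y k R = (\<Sum>j\<in>UNIV. Y k (if \<nu> j \<le> k + m then X j (g (k + m - \<nu> j)) else 0))"
          unfolding R_def by (rule Y_sum)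
        moreover have "\<dots> = Y (Suc k) (g k) +
            (\<Sum>j\<in>UNIV - {j0}. Y k (if \<nu> j \<le> k + m then X j (g (k + m - \<nu> j)) else 0))"
          by (subst sum.remove[of _ j0]) (auto simp: j0 Y_Suc(2))
        moreover have "(\<Sum>j\<in>UNIV - {j0}. Y k (if \<nu> j \<le> k + m then X j (g (k + m - \<nu> j)) else 0)) \<in> U (i + 1 + int k)"
        proof (rule subspace_sum[OF U'(1)])
          fix j assume "j \<in> UNIV - {j0}"
          then have ne: "\<nu> j \<noteq> m" using inj_\<nu> j0 by (auto dest: injD)
          show "Y k (if \<nu> j \<le> k + m then X j (g (k + m - \<nu> j)) else 0) \<in> U (i + 1 + int k)"
          proof (cases "\<nu> j \<le> k + m")
            case le: True
            show ?thesis
            proof (cases "\<nu> j < m")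
              case True
              then show ?thesis using le low[of j] Y_U by simp
            next
              case False
              define q where "q = k + m - \<nu> j"
              have q: "q < k" using False ne le by (auto simp: q_def)
              have "Y (k - Suc q) (Y (Suc q) (g q)) \<in> U (i + int (Suc q) + int (k - Suc q))"
                using less.IH[OF q] by (rule Y_U)
              moreover have "Y (k - Suc q) (Y (Suc q) (g q)) = Y k (g q)"
                using q by (simp add: Y_def flip: funpow_add[unfolded comp_def, THEN fun_cong] del: funpow.simps)
              moreover have "i + int (Suc q) + int (k - Suc q) = i + int k" using q by simp
              ultimately have "X j (Y k (g q)) \<in> U (i + int k + 1)" using U'(3) by simp
              then show ?thesis using le by (simp add: Y_X q_def algebra_simps)
            qed
          qed (simp add: subspace_0[OF U'(1)])
        qed
        ultimately have "Y (Suc k) (g k) \<in> U (i + 1 + int k)"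
          using subspace_diff[OF U'(1), of "Y k R" "i + 1 + int k"] by fastforce
        then show ?case by (simp add: algebra_simps)
      qed
      \<comment> \<open>The coefficients \<open>Y e (g k)\<close> satisfy the same relation in
        degree \<open>i + e\<close>, and now \<open>X j0\<close> sends them into \<open>U\<close> as
        well, so the induction hypothesis for \<open>Suc m\<close> applies.\<close>
      have descend: "\<forall>k. Y e (g k) \<in> U (i + int e)" if "\<forall>k. Y (Suc e) (g k) \<in> U (i + int (Suc e))" for e
      proof (rule step.IH)
        show "Y e (g k) \<in> V (i + int e)" for k using Y_V gV by blast
        show "Y e (g k) = 0" if "k > D" for k using g0[OF that] by simp
        show "X j (Y e (g k)) \<in> U (i + int e + 1)" if "\<nu> j < Suc m" for j k
        proof (cases "\<nu> j = m")
          case True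
          then have "j = j0" using j0 inj_\<nu> by (auto dest: injD)
          then show ?thesis using \<open>\<forall>k. Y (Suc e) (g k) \<in> U (i + int (Suc e))\<close>
            by (simp add: Y_Suc(1)[symmetric] algebra_simps)
        next
          case False
          then have "X j (g k) \<in> U (i + 1)" using that low by simp
          from Y_U[OF this, of e] show ?thesis by (simp add: Y_X algebra_simps)
        qed
        fix k
        have "Y e (\<Sum>j\<in>UNIV. if \<nu> j \<le> k then X j (g (k - \<nu> j)) else 0) \<in> U (i + 1 + int e)"
          by (intro Y_U rel)
        moreover have "Y e (\<Sum>j\<in>UNIV. if \<nu> j \<le> k then X j (g (k - \<nu> j)) else 0)
            = (\<Sum>j\<in>UNIV. if \<nu> j \<le> k then X j (Y e (g (k - \<nu> j))) else 0)"
          unfolding Y_sum by (intro sum.cong) (auto simp: Y_X)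
        ultimately show "(\<Sum>j\<in>UNIV. if \<nu> j \<le> k then X j (Y e (g (k - \<nu> j))) else 0) \<in> U (i + int e + 1)"
          by (simp add: algebra_simps)
      qed
      \<comment> \<open>As \<open>g\<close> vanishes beyond \<open>D\<close>, the exponents in
        \<open>nilp\<close> that matter are at most \<open>Suc D\<close>; from there
        \<open>descend\<close> lowers the exponent to zero.\<close>
      have top: "\<forall>k. Y (Suc D) (g k) \<in> U (i + int (Suc D))"
      proof
        fix k
        show "Y (Suc D) (g k) \<in> U (i + int (Suc D))"
        proof (cases "k \<le> D")
          case True
          have "Y (D - k) (Y (Suc k) (g k)) \<in> U (i + int (Suc k) + int (D - k))"
            by (intro Y_U nilp)
          moreover have "Y (D - k) (Y (Suc k) (g k)) = Y (Suc D) (g k)"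
            using True by (simp add: Y_def flip: funpow_add[unfolded comp_def, THEN fun_cong] del: funpow.simps)
          ultimately show ?thesis using True by (simp add: algebra_simps)
        qed (simp add: g0 subspace_0[OF U'(1)])
      qed
      have "\<forall>k. Y e (g k) \<in> U (i + int e)" if "e \<le> Suc D" for e
        using that
      proof (induction e rule: inc_induct)
        case (step e)
        show ?case by (rule descend[OF step.IH])
      qed (rule top)
      from this[of 0] show ?thesis by (simp add: Y_def)
    qed
  qed
  from this[of 0 g i, OF _ g rel] show ?thesis by simp
qed

text \<open>A curve of linear forms with one parameter suffices: \<nu> is injective, so distinct
  variables carry distinct powers of \<open>c\<close>, and these are what McCoy's argument
  separates.\<close>

definition generic_form :: "'l \<Rightarrow> 'v \<Rightarrow> 'v" where
  "generic_form c v = (\<Sum>j\<in>UNIV. scale (c ^ \<nu> j) (X j v))"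

lemma generic_form_add: "generic_form c (u + v) = generic_form c u + generic_form c v"
  by (simp add: generic_form_def X_add scale_right_distrib sum.distrib)

lemma generic_form_scale: "generic_form c (scale a v) = scale a (generic_form c v)"
  by (simp add: generic_form_def X_scale scale_sum_right mult.commute)

lemma generic_form_0 [simp]: "generic_form c 0 = 0"
  by (simp add: generic_form_def)

lemma generic_form_diff: "generic_form c (u - v) = generic_form c u - generic_form c v"
  by (simp add: generic_form_def X_diff scale_right_diff_distrib sum_subtractf)

lemma generic_form_sum: "generic_form c (sum f A) = (\<Sum>a\<in>A. generic_form c (f a))"
  by (simp add: generic_form_def X_sum scale_sum_right sum.swap[of _ A])

lemma generic_form_X: "generic_form c (X k v) = X k (generic_form c v)"
  by (simp add: generic_form_def X_sum X_scale X_commute)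

lemma generic_form_V: "v \<in> V i \<Longrightarrow> generic_form c v \<in> V (i + 1)"
  unfolding generic_form_def by (intro subspace_sum subspace_scale V_subspace X_V)

lemma generic_form_U: "graded_submodule U \<Longrightarrow> v \<in> U i \<Longrightarrow> generic_form c v \<in> U (i + 1)"
  unfolding generic_form_def by (intro subspace_sum subspace_scale) (auto dest: graded_submoduleD)

text \<open>On \<open>V i / U i\<close> the form is a matrix whose entries are polynomials in
  \<open>c\<close>. If injectivity failed for infinitely many \<open>c\<close>, the rows would be
  dependent over the polynomial ring; such a dependence is a nonzero polynomial with coefficients in
  \<open>V i / U i\<close> annihilated by the form, which \<open>mccoy\<close> excludes.\<close>

lemma finitely_many_zero_divisors:
  assumes U: "graded_submodule U"
    and socle: "\<And>i v. v \<in> V i \<Longrightarrow> \<forall>j. X j v \<in> U (i + 1) \<Longrightarrow> v \<in> U i"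
  shows "finite {c. \<exists>v\<in>V i - U i. generic_form c v \<in> U (i + 1)}"
proof -
  note U' = graded_submoduleD[OF U]
  obtain A where A: "finite A" "V i \<subseteq> span A" using V_finite by blast
  obtain A' where A': "finite A'" "V (i + 1) \<subseteq> span A'" using V_finite by blast
  obtain S \<kappa> where S: "finite S" "S \<subseteq> V i"
    "\<And>v w t. v \<in> V i \<Longrightarrow> w \<in> V i \<Longrightarrow> \<kappa> (v + w) t = \<kappa> v t + \<kappa> w t"
    "\<And>c v t. v \<in> V i \<Longrightarrow> \<kappa> (scale c v) t = c * \<kappa> v t"
    "\<And>v. v \<in> V i \<Longrightarrow> v - (\<Sum>s\<in>S. scale (\<kappa> v s) s) \<in> U i"
    "\<And>v t. v \<in> U i \<Longrightarrow> t \<in> S \<Longrightarrow> \<kappa> v t = 0"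
    "\<And>l s. s \<in> S \<Longrightarrow> \<kappa> (\<Sum>r\<in>S. scale (l r) r) s = l s"
    by (rule quotient_coordinates[OF U'(1) V_subspace _ A(2,1)]) (use U' in blast)+
  obtain T \<tau> where T: "finite T" "T \<subseteq> V (i + 1)"
    "\<And>v w t. v \<in> V (i + 1) \<Longrightarrow> w \<in> V (i + 1) \<Longrightarrow> \<tau> (v + w) t = \<tau> v t + \<tau> w t"
    "\<And>c v t. v \<in> V (i + 1) \<Longrightarrow> \<tau> (scale c v) t = c * \<tau> v t"
    "\<And>v. v \<in> V (i + 1) \<Longrightarrow> v - (\<Sum>s\<in>T. scale (\<tau> v s) s) \<in> U (i + 1)"
    "\<And>v t. v \<in> U (i + 1) \<Longrightarrow> t \<in> T \<Longrightarrow> \<tau> v t = 0"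
    by (rule quotient_coordinates[OF U'(1) V_subspace _ A'(2,1)]) (use U' in blast)+
  have \<tau>_0: "\<tau> 0 t = 0" for t
    using T(4)[of 0 0 t] subspace_0[OF V_subspace] by simp
  have "\<forall>v\<in>V (i + 1). \<forall>w\<in>V (i + 1). \<forall>t. \<tau> (v + w) t = \<tau> v t + \<tau> w t"
    using T(3) by blast
  note \<tau>_sum = additive_sum[OF V_subspace this]
  \<comment> \<open>Row \<open>s\<close> holds the coordinates of the image of \<open>s\<close>,
    with \<open>c\<close> as the polynomial variable.\<close>
  define M where "M s t = (\<Sum>j\<in>UNIV. monom (\<tau> (X j s) t) (\<nu> j))" for s t
  have M: "poly (M s t) c = \<tau> (generic_form c s) t" if "s \<in> S" for s t c
    using that S(2) X_V
    by (simp add: M_def generic_form_def poly_sum poly_monom \<tau>_sum T(4) subset_iff subspace_scale[OF V_subspace] mult.commute)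
  have "\<not> (\<exists>a. (\<exists>s\<in>S. a s \<noteq> 0) \<and> (\<forall>t\<in>T. (\<Sum>s\<in>S. a s * M s t) = 0))"
  proof
    assume "\<exists>a. (\<exists>s\<in>S. a s \<noteq> 0) \<and> (\<forall>t\<in>T. (\<Sum>s\<in>S. a s * M s t) = 0)"
    then obtain a where a: "\<exists>s\<in>S. a s \<noteq> 0" "\<And>t. t \<in> T \<Longrightarrow> (\<Sum>s\<in>S. a s * M s t) = 0" by blast
    \<comment> \<open>The dependence \<open>a\<close> is regarded as a single polynomial with the
      vectors \<open>g k\<close> as coefficients; \<open>D\<close> bounds its degree.\<close>
    define g where "g k = (\<Sum>s\<in>S. scale (coeff (a s) k) s)" for k
    define D where "D = Max (insert 0 ((\<lambda>s. degree (a s)) ` S))"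
    have gV: "g k \<in> V i" for k
      unfolding g_def using S(2) by (intro subspace_sum subspace_scale V_subspace) auto
    have g0: "g k = 0" if "k > D" for k
    proof -
      have "degree (a s) \<le> D" if "s \<in> S" for s
        unfolding D_def using that S(1) by (intro Max_ge) auto
      then show ?thesis using that by (force simp: g_def intro!: sum.neutral coeff_eq_0)
    qed
    have "g k \<in> U i" for k
    proof (rule mccoy[OF U socle gV g0])
      fix k
      define w where "w = (\<Sum>j\<in>UNIV. if \<nu> j \<le> k then X j (g (k - \<nu> j)) else 0)"
      have XgV: "(if \<nu> j \<le> k then X j (g (k - \<nu> j)) else 0) \<in> V (i + 1)" for j
        using gV X_V subspace_0[OF V_subspace] by simp
      then have wV: "w \<in> V (i + 1)"
        unfolding w_def by (intro subspace_sum V_subspace)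
      have \<tau>Xg: "\<tau> (X j (g q)) t = (\<Sum>s\<in>S. coeff (a s) q * \<tau> (X j s) t)" for j q t
      proof -
        have "X j (g q) = (\<Sum>s\<in>S. scale (coeff (a s) q) (X j s))"
          by (simp add: g_def X_sum X_scale)
        then show ?thesis
          using S(2) X_V subspace_scale[OF V_subspace]
          by (simp add: T(4) subset_iff \<tau>_sum)
      qed
      have "\<tau> w t = 0" if "t \<in> T" for t
      proof -
        have "\<tau> w t = (\<Sum>j\<in>UNIV. \<tau> (if \<nu> j \<le> k then X j (g (k - \<nu> j)) else 0) t)"
          unfolding w_def by (rule \<tau>_sum) (rule XgV)
        also have "\<dots> = (\<Sum>j\<in>UNIV. \<Sum>s\<in>S. if \<nu> j \<le> k then \<tau> (X j s) t * coeff (a s) (k - \<nu> j) else 0)"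
          by (intro sum.cong refl) (simp add: \<tau>Xg \<tau>_0 mult.commute)
        also have "\<dots> = (\<Sum>s\<in>S. \<Sum>j\<in>UNIV. if \<nu> j \<le> k then \<tau> (X j s) t * coeff (a s) (k - \<nu> j) else 0)"
          by (rule sum.swap)
        also have "\<dots> = coeff (\<Sum>s\<in>S. a s * M s t) k"
          by (auto simp: coeff_sum M_def sum_distrib_left mult.commute[of "a _"] coeff_monom_mult intro!: sum.cong)
        finally show ?thesis using a(2)[OF that] by simp
      qed
      then show "w \<in> U (i + 1)" using T(5)[OF wV] by simp
    qed
    then have "\<kappa> (g k) s = 0" if "s \<in> S" for k s using S(6) that by blast
    moreover have "\<kappa> (g k) s = coeff (a s) k" if "s \<in> S" for k s
      unfolding g_def by (rule S(7)[OF that])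
    ultimately show False using a(1) by (metis leading_coeff_0_iff)
  qed
  then have "finite {c. \<exists>l. (\<exists>s\<in>S. l s \<noteq> 0) \<and> (\<forall>t\<in>T. (\<Sum>s\<in>S. l s * poly (M s t) c) = 0)}"
    using polynomial_vectors_dependent_or_generically_independent[OF S(1), of T M] by blast
  moreover have "{c. \<exists>v\<in>V i - U i. generic_form c v \<in> U (i + 1)} \<subseteq> \<dots>"
  proof
    fix c assume "c \<in> {c. \<exists>v\<in>V i - U i. generic_form c v \<in> U (i + 1)}"
    then obtain v where v: "v \<in> V i" "v \<notin> U i" "generic_form c v \<in> U (i + 1)" by blast
    \<comment> \<open>Passing to the representative of \<open>v\<close> modulo \<open>U\<close> in
      the span of \<open>S\<close> turns membership of its image in \<open>U\<close> into a relation
      among the rows.\<close>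
    define v' where "v' = (\<Sum>s\<in>S. scale (\<kappa> v s) s)"
    have "generic_form c (v - v') \<in> U (i + 1)"
      unfolding v'_def by (intro generic_form_U[OF U] S(5) v)
    then have F: "generic_form c v' \<in> U (i + 1)"
      using subspace_diff[OF U'(1) v(3)] by (fastforce simp: generic_form_diff)
    have "(\<Sum>s\<in>S. \<kappa> v s * poly (M s t) c) = 0" if "t \<in> T" for t
    proof -
      have "0 = \<tau> (generic_form c v') t" using T(6)[OF F that] by simp
      also have "\<dots> = (\<Sum>s\<in>S. \<kappa> v s * \<tau> (generic_form c s) t)"
        unfolding v'_def using S(2) generic_form_V subspace_scale[OF V_subspace]
        by (simp add: generic_form_sum generic_form_scale \<tau>_sum T(4) subset_iff)
      finally show ?thesis by (simp add: M)
    qed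
    moreover have "\<exists>s\<in>S. \<kappa> v s \<noteq> 0"
    proof (rule ccontr)
      assume "\<not> (\<exists>s\<in>S. \<kappa> v s \<noteq> 0)"
      then have "(\<Sum>s\<in>S. scale (\<kappa> v s) s) = 0" by (intro sum.neutral) auto
      then show False using S(5)[OF v(1)] v(2) by simp
    qed
    ultimately show "c \<in> {c. \<exists>l. (\<exists>s\<in>S. l s \<noteq> 0) \<and> (\<forall>t\<in>T. (\<Sum>s\<in>S. l s * poly (M s t) c) = 0)}"
      by blast
  qed
  ultimately show ?thesis by (rule rev_finite_subset)
qed

text \<open>The exceptional parameters are finitely many in each degree, hence countable altogether,
  and any parameter outside them serves all degrees.\<close>

lemma generic_form_nonzerodivisor:
  assumes "uncountable (UNIV :: 'l set)" "graded_submodule U"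
    and "\<And>i v. v \<in> V i \<Longrightarrow> \<forall>j. X j v \<in> U (i + 1) \<Longrightarrow> v \<in> U i"
  obtains c where "\<And>i v. v \<in> V i \<Longrightarrow> generic_form c v \<in> U (i + 1) \<Longrightarrow> v \<in> U i"
proof -
  have "countable (\<Union>i. {c. \<exists>v\<in>V i - U i. generic_form c v \<in> U (i + 1)})"
    using finitely_many_zero_divisors[OF assms(2,3)] by (simp add: countable_finite)
  then have "(\<Union>i. {c. \<exists>v\<in>V i - U i. generic_form c v \<in> U (i + 1)}) \<noteq> UNIV"
    using assms(1) by metis
  then show ?thesis using that by blast
qed

text \<open>A 0-cochain is an element, and there are no coboundaries to correct it by; so exactness
  at 0 says that no nonzero class is annihilated by all variables.\<close>

lemma exact_at_socle:
  assumes U: "graded_submodule U" and exact: "exact_at 0 V U i"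
    and v: "v \<in> V i" "\<forall>j. X j v \<in> U (i + 1)"
  shows "v \<in> U i"
proof -
  have "d (\<lambda>_. v) T \<in> U (i + 1)" for T
    by (rule d_in[OF subspace_additive[OF graded_submoduleD(1)[OF U]]]) (simp add: v(2))
  then obtain b where "v - d b {} \<in> U i"
    using exact_atD[OF exact, of "\<lambda>_. v"] v(1) by (metis card.empty)
  then show ?thesis by (simp add: d_def wedge_def)
qed

text \<open>The form is injective from degree \<open>i - 1\<close> to degree \<open>i\<close> of
  \<open>V / U\<close>, so a basis of the former stays independent modulo \<open>U i\<close>.
  Equivalently, the Hilbert function of the new quotient is the difference of the old one.\<close>

lemma dim_quotient_generic_form:
  assumes U: "graded_submodule U"
    and nzd: "\<And>i v. v \<in> V i \<Longrightarrow> generic_form c v \<in> U (i + 1) \<Longrightarrow> v \<in> U i"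
  shows "int (dim {u + generic_form c v | u v. u \<in> U i \<and> v \<in> V (i - 1)})
    = int (dim (U i)) + int (dim (V (i - 1))) - int (dim (U (i - 1)))"
proof -
  note U' = graded_submoduleD[OF U]
  define W where "W = {u + generic_form c v | u v. u \<in> U i \<and> v \<in> V (i - 1)}"
  obtain A where A: "finite A" "V (i - 1) \<subseteq> span A" using V_finite by blast
  obtain A' where A': "finite A'" "V i \<subseteq> span A'" using V_finite by blast
  obtain S \<kappa> where S: "finite S" "S \<subseteq> V (i - 1)" "dim (V (i - 1)) = dim (U (i - 1)) + card S"
    "\<And>v w t. v \<in> V (i - 1) \<Longrightarrow> w \<in> V (i - 1) \<Longrightarrow> \<kappa> (v + w) t = \<kappa> v t + \<kappa> w t"
    "\<And>c v t. v \<in> V (i - 1) \<Longrightarrow> \<kappa> (scale c v) t = c * \<kappa> v t"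
    "\<And>v. v \<in> V (i - 1) \<Longrightarrow> v - (\<Sum>s\<in>S. scale (\<kappa> v s) s) \<in> U (i - 1)"
    "\<And>v t. v \<in> U (i - 1) \<Longrightarrow> t \<in> S \<Longrightarrow> \<kappa> v t = 0"
    "\<And>l s. s \<in> S \<Longrightarrow> \<kappa> (\<Sum>r\<in>S. scale (l r) r) s = l s"
    by (rule quotient_coordinates[OF U'(1) V_subspace _ A(2,1)]) (use U' in blast)+
  have "dim (U i \<union> generic_form c ` S) = dim (U i) + card S"
  proof (rule dim_extend_independent_mod[OF U'(1) _ A'(1) S(1)])
    show "U i \<subseteq> span A'" using U'(2) A'(2) by blast
    fix l assume l: "(\<Sum>s\<in>S. scale (l s) (generic_form c s)) \<in> U i"
    define v where "v = (\<Sum>s\<in>S. scale (l s) s)"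
    have "v \<in> V (i - 1)"
      unfolding v_def using S(2) by (intro subspace_sum subspace_scale V_subspace) auto
    moreover have "generic_form c v \<in> U (i - 1 + 1)"
      using l by (simp add: v_def generic_form_sum generic_form_scale)
    ultimately have "v \<in> U (i - 1)" by (rule nzd)
    then have "\<kappa> v s = 0" if "s \<in> S" for s using S(7) that by blast
    moreover have "\<kappa> v s = l s" if "s \<in> S" for s
      unfolding v_def by (rule S(8)[OF that])
    ultimately show "\<forall>s\<in>S. l s = 0" by metis
  qed
  moreover have "span (U i \<union> generic_form c ` S) = span W"
  proof (rule antisym; rule span_minimal)
    show "U i \<union> generic_form c ` S \<subseteq> span W"
    proof -
      have "u \<in> W" if "u \<in> U i" for u
        using that subspace_0[OF V_subspace] unfolding W_def
        by (intro CollectI exI[of _ u] exI[of _ 0]) auto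
      moreover have "generic_form c s \<in> W" if "s \<in> S" for s
        using that subspace_0[OF U'(1)] S(2) unfolding W_def
        by (intro CollectI exI[of _ 0] exI[of _ s]) auto
      ultimately show ?thesis by (auto intro: span_base)
    qed
    show "W \<subseteq> span (U i \<union> generic_form c ` S)"
    proof
      fix w assume "w \<in> W"
      then obtain u v where w: "w = u + generic_form c v" "u \<in> U i" "v \<in> V (i - 1)" by (auto simp: W_def)
      define v' where "v' = (\<Sum>s\<in>S. scale (\<kappa> v s) s)"
      have "generic_form c (v - v') \<in> U (i - 1 + 1)"
        unfolding v'_def by (intro generic_form_U[OF U] S(6) w)
      moreover have "generic_form c v' \<in> span (U i \<union> generic_form c ` S)"
        unfolding v'_def generic_form_sum generic_form_scale
        by (intro span_sum span_scale span_base) auto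
      moreover have "w = u + generic_form c (v - v') + generic_form c v'"
        using w by (simp add: generic_form_diff)
      ultimately show "w \<in> span (U i \<union> generic_form c ` S)"
        using w(2) by (auto intro!: span_add intro: span_base)
    qed
  qed (rule subspace_span)+
  ultimately have "dim W = dim (U i) + card S" by (metis span_eq_dim)
  then show ?thesis using S(3) by (simp add: W_def)
qed

text \<open>\<open>difference\<close> is multiplication of the Hilbert series by 1 - t. Each step
  divides by one generic form, which keeps \<open>V\<close>, enlarges \<open>U\<close> to
  \<open>W\<close> and costs one cochain degree of exactness; after \<open>r\<close> steps the value
  is the dimension of a quotient.\<close>

theorem iterated_difference_nonneg:
  assumes "uncountable (UNIV :: 'l set)" "graded_submodule U"
    and "\<And>q i. q < r \<Longrightarrow> exact_at q V U i"
  shows "0 \<le> (difference ^^ r) (\<lambda>i. int (dim (V i)) - int (dim (U i))) i"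
  using assms(2,3)
proof (induction r arbitrary: U)
  case 0
  obtain A where A: "finite A" "V i \<subseteq> span A" using V_finite by blast
  note U' = graded_submoduleD[OF 0(1)]
  have "\<exists>S. dim (V i) = dim (U i) + card (S :: 'v set)"
    by (rule quotient_coordinates[OF U'(1) V_subspace _ A(2,1)]) (use U' in blast)+
  then show ?case by auto
next
  case (Suc r)
  note U = Suc.prems(1)
  note U' = graded_submoduleD[OF U]
  obtain c where nzd: "\<And>i v. v \<in> V i \<Longrightarrow> generic_form c v \<in> U (i + 1) \<Longrightarrow> v \<in> U i"
    using generic_form_nonzerodivisor[OF assms(1) U] exact_at_socle[OF U Suc.prems(2)] by blast
  define W where "W = (\<lambda>i. {u + generic_form c v | u v. u \<in> U i \<and> v \<in> V (i - 1)})"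
  have WV: "W i \<subseteq> V i" for i
  proof
    fix w assume "w \<in> W i"
    then obtain u v where "w = u + generic_form c v" "u \<in> V i" "v \<in> V (i - 1)"
      using U'(2) by (auto simp: W_def)
    then show "w \<in> V i"
      using generic_form_V[of v "i - 1" c] subspace_add[OF V_subspace] by simp
  qed
  have W: "graded_submodule W"
    unfolding graded_submodule_def
  proof (intro conjI allI ballI WV)
    fix i
    have "subspace (generic_form c ` V (i - 1))"
    proof (rule subspaceI)
      show "0 \<in> generic_form c ` V (i - 1)"
        using subspace_0[OF V_subspace] by (intro image_eqI[of _ _ 0]) simp_all
      show "x + y \<in> generic_form c ` V (i - 1)"
        if "x \<in> generic_form c ` V (i - 1)" "y \<in> generic_form c ` V (i - 1)" for x y
        using that by (auto simp: generic_form_add[symmetric] intro!: imageI subspace_add[OF V_subspace])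
      show "scale a x \<in> generic_form c ` V (i - 1)" if "x \<in> generic_form c ` V (i - 1)" for a x
        using that by (auto simp: generic_form_scale[symmetric] intro!: imageI subspace_scale[OF V_subspace])
    qed
    from subspace_sums[OF U'(1) this, of i]
    show "subspace (W i)"
      by (rule back_subst[of subspace]) (auto simp: W_def)
  next
    fix i j v assume "v \<in> W i"
    then obtain u w where uw: "v = u + generic_form c w" "u \<in> U i" "w \<in> V (i - 1)" by (auto simp: W_def)
    show "X j v \<in> W (i + 1)"
      unfolding W_def uw(1) X_add using U'(3)[OF uw(2)] X_V[OF uw(3), of j]
      by (auto simp: generic_form_X[symmetric])
  qed
  have "exact_at q V W i" if "q < r" for q i
    unfolding W_def
    by (rule exact_at_quotient)
      (use that Suc.prems(2) U' nzd X_V in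
        \<open>auto intro: subspace_additive V_subspace generic_form_V generic_form_U[OF U]
          simp: generic_form_add generic_form_X\<close>)
  from Suc.IH[OF W this] have "0 \<le> (difference ^^ r) (\<lambda>i. int (dim (V i)) - int (dim (W i))) i" .
  moreover have "(\<lambda>i. int (dim (V i)) - int (dim (W i)))
      = difference (\<lambda>i. int (dim (V i)) - int (dim (U i)))"
    using dim_quotient_generic_form[OF U nzd] by (simp add: W_def difference_def fun_eq_iff)
  ultimately show ?case by (simp add: funpow_swap1)
qed

end

section \<open>Extension of the base field\<close>

text \<open>Series with coefficients 0 and 1 already encode all sets of natural numbers, however
  small the coefficient field is.\<close>

lemma uncountable_fls: "uncountable (UNIV :: 'k::zero_neq_one fls set)"
proof
  assume "countable (UNIV :: 'k fls set)"
  moreover have "inj (\<lambda>S. fps_to_fls (Abs_fps (\<lambda>n. if n \<in> S then 1 else 0 :: 'k)))"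
  proof (rule injI)
    fix S T assume "fps_to_fls (Abs_fps (\<lambda>n. if n \<in> S then 1 else 0 :: 'k)) = fps_to_fls (Abs_fps (\<lambda>n. if n \<in> T then 1 else 0))"
    then have "(if n \<in> S then 1 else 0 :: 'k) = (if n \<in> T then 1 else 0)" for n
      by (simp add: fps_eq_iff)
    then show "S = T" by (metis subsetI subset_antisym zero_neq_one)
  qed
  ultimately have "countable (UNIV :: nat set set)"
    by (metis countable_image_inj_on countable_subset subset_UNIV)
  then obtain f :: "nat \<Rightarrow> nat set" where "range f = UNIV"
    by (metis UNIV_not_empty uncountable_def)
  then show False using Cantors_theorem[of UNIV] by auto
qed

lemma fls_nth_sum: "fls_nth (sum f A) n = (\<Sum>a\<in>A. fls_nth (f a) n)"
  by (induction A rule: infinite_finite_induct) auto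

section \<open>Graded modules as families of matrices\<close>

definition coord_space :: "(int \<Rightarrow> nat) \<Rightarrow> int \<Rightarrow> (int \<times> nat \<Rightarrow> 'f::zero) set" where
  "coord_space h i = {v. \<forall>x. v x \<noteq> 0 \<longrightarrow> fst x = i \<and> snd x < h i}"

text \<open>\<open>A j i b a\<close> is the entry in row \<open>b\<close> and column
  \<open>a\<close> of the matrix of \<open>x_j\<close> from degree \<open>i\<close> to degree
  \<open>i + 1\<close>. In this form an extension of the field is the entrywise embedding of
  \<open>A\<close>.\<close>

definition coord_op :: "(int \<Rightarrow> nat) \<Rightarrow> ('n \<Rightarrow> int \<Rightarrow> nat \<Rightarrow> nat \<Rightarrow> 'f) \<Rightarrow> 'n \<Rightarrow> (int \<times> nat \<Rightarrow> 'f::comm_ring_1) \<Rightarrow> int \<times> nat \<Rightarrow> 'f" where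
  "coord_op h A j v x =
     (if snd x < h (fst x) then \<Sum>a<h (fst x - 1). A j (fst x - 1) (snd x) a * v (fst x - 1, a) else 0)"

abbreviation fun_scale :: "'f::field \<Rightarrow> ('x \<Rightarrow> 'f) \<Rightarrow> 'x \<Rightarrow> 'f" where
  "fun_scale \<equiv> (\<lambda>c v x. c * v x)"

lemma vector_space_fun_scale: "vector_space fun_scale"
  by unfold_locales (auto simp: fun_eq_iff algebra_simps)

lemma coord_op_add: "coord_op h A j (u + v) = coord_op h A j u + coord_op h A j v"
  by (auto simp: coord_op_def fun_eq_iff algebra_simps sum.distrib)

lemma coord_op_scale: "coord_op h A j (fun_scale c v) = fun_scale c (coord_op h A j v)"
  by (auto simp: coord_op_def fun_eq_iff algebra_simps sum_distrib_left)

lemma coord_op_in: "v \<in> coord_space h i \<Longrightarrow> coord_op h A j v \<in> coord_space h (i + 1)"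
  unfolding coord_space_def coord_op_def
proof (intro CollectI allI impI)
  fix x assume v: "v \<in> {v. \<forall>x. v x \<noteq> 0 \<longrightarrow> fst x = i \<and> snd x < h i}"
    and nz: "(if snd x < h (fst x) then \<Sum>a<h (fst x - 1). A j (fst x - 1) (snd x) a * v (fst x - 1, a) else 0) \<noteq> 0"
  then obtain a where "v (fst x - 1, a) \<noteq> 0"
    by (metis (no_types, lifting) mult_zero_right sum.neutral)
  then have "fst x - 1 = i" using v by force
  then have "fst x = i + 1" by simp
  then show "fst x = i + 1 \<and> snd x < h (i + 1)"
    using nz by (auto split: if_splits)
qed

lemma subspace_coord_space: "module.subspace fun_scale (coord_space h i)"
proof -
  interpret vector_space fun_scale by (rule vector_space_fun_scale)
  show ?thesis
    unfolding subspace_def coord_space_def by (auto) (metis add.right_neutral)+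
qed

lemma sum_fun_apply: "sum f A x = (\<Sum>a\<in>A. f a x)" for f :: "'a \<Rightarrow> 'x \<Rightarrow> 'f::comm_monoid_add"
  by (induction A rule: infinite_finite_induct) auto

lemma coord_space_basis:
  fixes h :: "int \<Rightarrow> nat" and i :: int
  defines "B \<equiv> (\<lambda>a. (\<lambda>x. if x = (i, a) then 1 else 0 :: 'f::field)) ` {..<h i}"
  shows "finite B" "coord_space h i \<subseteq> module.span fun_scale B"
    "vector_space.dim fun_scale (coord_space h i :: (int \<times> nat \<Rightarrow> 'f) set) = h i"
proof -
  interpret vector_space "fun_scale :: 'f \<Rightarrow> (int \<times> nat \<Rightarrow> 'f) \<Rightarrow> _" by (rule vector_space_fun_scale)
  define e where "e = (\<lambda>(a::nat) x. if x = (i, a) then 1 else 0 :: 'f)"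
  have B: "B = e ` {..<h i}" by (simp add: B_def e_def)
  have inj: "inj_on e {..<h i}" by (auto simp: inj_on_def e_def fun_eq_iff split: if_splits)
  show fin: "finite B" by (simp add: B)
  have sub: "B \<subseteq> coord_space h i" by (auto simp: B e_def coord_space_def split: if_splits)
  show span: "coord_space h i \<subseteq> span B"
  proof
    fix v :: "int \<times> nat \<Rightarrow> 'f" assume v: "v \<in> coord_space h i"
    have "v = (\<Sum>a<h i. fun_scale (v (i, a)) (e a))"
    proof
      fix x :: "int \<times> nat"
      have "(\<Sum>a<h i. fun_scale (v (i, a)) (e a)) x = (\<Sum>a<h i. if a = snd x then (if fst x = i then v x else 0) else 0)"
        unfolding sum_fun_apply by (intro sum.cong) (auto simp: e_def prod_eq_iff)
      also have "\<dots> = v x"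
      proof (cases "v x = 0")
        case False
        then have "fst x = i" "snd x < h i" using v unfolding coord_space_def by blast+
        then show ?thesis by simp
      qed (simp cong: if_cong)
      finally show "v x = (\<Sum>a<h i. fun_scale (v (i, a)) (e a)) x" by simp
    qed
    also have "\<dots> \<in> span B" by (intro span_sum span_scale span_base) (auto simp: B)
    finally show "v \<in> span B" .
  qed
  have "independent B"
  proof (rule independent_if_scalars_zero[OF fin])
    fix f b assume sum: "(\<Sum>b\<in>B. fun_scale (f b) b) = 0" and b: "b \<in> B"
    then obtain a where a: "b = e a" "a < h i" by (auto simp: B)
    have "0 = (\<Sum>b\<in>B. fun_scale (f b) b) (i, a)" using sum by simp
    also have "\<dots> = (\<Sum>a'<h i. if a' = a then f (e a) else 0)"
      unfolding B sum.reindex[OF inj] sum_fun_apply by (intro sum.cong) (auto simp: e_def)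
    finally show "f b = 0" using a by simp
  qed
  then show "dim (coord_space h i) = h i"
    using basis_card_eq_dim[OF sub span] card_image[OF inj] by (simp add: B)
qed

lemma fls_nth_coord_op:
  "fls_nth (coord_op h (\<lambda>j i b a. fls_const (A j i b a)) j v x) n = coord_op h A j (\<lambda>x. fls_nth (v x) n) x"
  by (simp add: coord_op_def fls_nth_sum)

text \<open>Exactness of the complex survives the extension of the field \<open>'k\<close> to the uncountable
  field \<open>'k fls\<close>, because all matrices involved have entries in \<open>'k\<close>: the equations
  can be solved for one coefficient at a time.\<close>
lemma exact_at_fls:
  fixes A :: "'n::finite \<Rightarrow> int \<Rightarrow> nat \<Rightarrow> nat \<Rightarrow> 'k::field"
  assumes "koszul (coord_op h A) \<nu>"
    and exact: "koszul.exact_at (coord_op h A) \<nu> q (coord_space h) (\<lambda>_. {0}) i"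
  shows "koszul (coord_op h (\<lambda>j i b a. fls_const (A j i b a))) \<nu>" (is "koszul ?XL \<nu>")
    and "koszul.exact_at (coord_op h (\<lambda>j i b a. fls_const (A j i b a))) \<nu> q (coord_space h) (\<lambda>_. {0}) i"
proof -
  interpret K: koszul "coord_op h A" \<nu> by fact
  show "koszul ?XL \<nu>"
  proof
    show "inj \<nu>" by (rule K.inj_\<nu>)
    show "?XL j (?XL k v) = ?XL k (?XL j v)" for j k v
    proof (rule ext, rule fls_eqI)
      fix x n
      show "fls_nth (?XL j (?XL k v) x) n = fls_nth (?XL k (?XL j v) x) n"
        unfolding fls_nth_coord_op by (rule K.X_commute[of j k "\<lambda>x. fls_nth (v x) n", THEN fun_cong])
    qed
  qed (rule coord_op_add)
  then interpret L: koszul ?XL \<nu> .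
  have nth_d: "fls_nth (L.d c T x) n = K.d (\<lambda>T x. fls_nth (c T x) n) T x" for c T x n
  proof -
    have "fls_nth (L.wedge j c T y) n = K.wedge j (\<lambda>T x. fls_nth (c T x) n) T y" for j y
      by (simp add: L.wedge_def K.wedge_def sgn_pow_def)
    then show ?thesis
      by (simp add: L.d_def K.d_def sum_fun_apply fls_nth_sum fls_nth_coord_op)
  qed
  show "L.exact_at q (coord_space h) (\<lambda>_. {0}) i"
    unfolding L.exact_at_def
  proof (intro allI impI, elim conjE)
    fix c assume c: "\<forall>T. c T \<in> coord_space h i" and dc: "\<forall>T. card T = Suc q \<longrightarrow> L.d c T \<in> {0}"
    \<comment> \<open>A common lower bound for the exponents in \<open>c\<close>, which exists
      because there are finitely many sets \<open>T\<close> and coordinates \<open>a\<close>. Below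
      it the solutions are chosen zero, so that they assemble to a Laurent series again.\<close>
    define N where "N = Min (insert 0 ((\<lambda>(T, a). fls_subdegree (c T (i, a))) ` (UNIV \<times> {..<h i})))"
    have N: "fls_nth (c T x) n = 0" if "n < N" for T x n
    proof (cases "c T x = 0")
      case False
      then obtain a where a: "x = (i, a)" "a < h i"
        using c by (cases x) (auto simp: coord_space_def)
      then have "N \<le> fls_subdegree (c T x)"
        unfolding N_def by (intro Min_le) auto
      then show ?thesis using that by simp
    qed simp
    define cn where "cn n = (\<lambda>T x. fls_nth (c T x) n)" for n
    have "\<exists>b. (\<forall>T. b T \<in> coord_space h (i - 1)) \<and> (\<forall>T. card T = q \<longrightarrow> cn n T - K.d b T \<in> {0}) \<and> (n < N \<longrightarrow> (\<forall>T. b T = 0))" for n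
    proof (cases "n < N")
      case True
      have "K.d (\<lambda>_. 0) T = 0" for T
        using K.d_diff[of "\<lambda>_. 0" "\<lambda>_. 0" T] by simp
      then show ?thesis using True N
        by (intro exI[of _ "\<lambda>_. 0"]) (auto simp: coord_space_def cn_def fun_eq_iff)
    next
      case False
      have "cn n T \<in> coord_space h i" for T
        unfolding coord_space_def cn_def
      proof (intro CollectI allI impI)
        fix x assume "fls_nth (c T x) n \<noteq> 0"
        then have "c T x \<noteq> 0" by auto
        then show "fst x = i \<and> snd x < h i" using c unfolding coord_space_def by blast
      qed
      moreover have "K.d (cn n) T \<in> {0}" if "card T = Suc q" for T
      proof -
        have "L.d c T = 0" using dc that by simp
        then have "K.d (cn n) T x = 0" for x unfolding cn_def nth_d[symmetric] by simp
        then show ?thesis by (simp add: fun_eq_iff)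
      qed
      ultimately show ?thesis
        using K.exact_atD[OF exact, of "cn n"] False by metis
    qed
    then obtain bn where bn: "\<And>n T. bn n T \<in> coord_space h (i - 1)"
      "\<And>n T. card T = q \<Longrightarrow> cn n T = K.d (bn n) T" "\<And>n T. n < N \<Longrightarrow> bn n T = 0"
      by (metis eq_iff_diff_eq_0 singletonD)
    define b where "b T x = Abs_fls (\<lambda>n. bn n T x)" for T x
    have nth_b: "fls_nth (b T x) n = bn n T x" for T x n
      unfolding b_def by (rule nth_Abs_fls_lower_bound[of N]) (simp add: bn(3))
    have "b T \<in> coord_space h (i - 1)" for T
      unfolding coord_space_def
    proof (intro CollectI allI impI)
      fix x assume "b T x \<noteq> 0"
      then obtain n where "bn n T x \<noteq> 0" using nth_b by (metis fls_eqI fls_zero_nth)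
      then show "fst x = i - 1 \<and> snd x < h (i - 1)" using bn(1)[of n T] unfolding coord_space_def by blast
    qed
    moreover have "c T - L.d b T \<in> {0}" if "card T = q" for T
    proof -
      have "c T x = L.d b T x" for x
        by (rule fls_eqI) (use fun_cong[OF bn(2)[OF that]] in \<open>simp add: nth_d nth_b cn_def\<close>)
      then show ?thesis by (simp add: fun_eq_iff)
    qed
    ultimately show "\<exists>b. (\<forall>T. b T \<in> coord_space h (i - 1)) \<and> (\<forall>T. card T = q \<longrightarrow> c T - L.d b T \<in> {0})"
      by blast
  qed
qed

text \<open>With \<open>U\<close> zero and the matrices read over Laurent series, the dimensions
  over the larger field are still the \<open>h i\<close>, so the conclusion speaks about the
  original module.\<close>

theorem coord_iterated_difference_nonneg:
  fixes A :: "'n::finite \<Rightarrow> int \<Rightarrow> nat \<Rightarrow> nat \<Rightarrow> 'k::field"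
  assumes K: "koszul (coord_op h A) \<nu>"
    and exact: "\<And>q i. q < r \<Longrightarrow> koszul.exact_at (coord_op h A) \<nu> q (coord_space h) (\<lambda>_. {0}) i"
  shows "0 \<le> (difference ^^ r) (\<lambda>i. int (h i)) i"
proof (cases "r = 0")
  case False
  let ?X = "coord_op h (\<lambda>j i b a. fls_const (A j i b a))"
  interpret L: koszul ?X \<nu>
    using exact_at_fls(1)[OF K exact] False by blast
  interpret vs: vector_space "fun_scale :: 'k fls \<Rightarrow> (int \<times> nat \<Rightarrow> 'k fls) \<Rightarrow> _"
    by (rule vector_space_fun_scale)
  interpret gf: graded_family "fun_scale :: 'k fls \<Rightarrow> (int \<times> nat \<Rightarrow> 'k fls) \<Rightarrow> _" ?X \<nu> "coord_space h"
  proof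
    show "vs.subspace (coord_space h i)" for i by (rule subspace_coord_space)
    show "\<exists>B. finite B \<and> (coord_space h i :: (int \<times> nat \<Rightarrow> 'k fls) set) \<subseteq> vs.span B" for i
      using coord_space_basis(1,2) by blast
  qed (rule coord_op_scale coord_op_in; assumption?)+
  have "gf.graded_submodule (\<lambda>_. {0})"
    unfolding gf.graded_submodule_def using L.X_zero by (auto simp: vs.subspace_def coord_space_def)
  from gf.iterated_difference_nonneg[OF uncountable_fls this, of r i] exact_at_fls(2)[OF K exact]
  have "0 \<le> (difference ^^ r) (\<lambda>i. int (vs.dim (coord_space h i :: (int \<times> nat \<Rightarrow> 'k fls) set)) - int (vs.dim {0 :: int \<times> nat \<Rightarrow> 'k fls})) i"
    by blast
  moreover have "vs.dim {0 :: int \<times> nat \<Rightarrow> 'k fls} = 0"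
    using vs.dim_unique[of "{}" "{0}" 0] by (simp add: vs.independent_empty vs.span_empty)
  ultimately show ?thesis by (simp add: coord_space_basis(3))
qed simp

section \<open>Graded modules in coordinates\<close>

text \<open>The bridge between vector spaces given as records and spaces of functions. Coordinates
  are total functions vanishing outside \<open>E\<close>, which makes linearity a pointwise
  identity.\<close>

definition coordinates :: "('k::field, 'm) module \<Rightarrow> 'e set \<Rightarrow> ('m \<Rightarrow> 'e \<Rightarrow> 'k) \<Rightarrow> bool" where
  "coordinates V E \<phi> \<longleftrightarrow>
     bij_betw \<phi> (carrier V) {v. \<forall>e. v e \<noteq> 0 \<longrightarrow> e \<in> E} \<and>
     (\<forall>x\<in>carrier V. \<forall>y\<in>carrier V. \<phi> (x \<oplus>\<^bsub>V\<^esub> y) = (\<lambda>e. \<phi> x e + \<phi> y e)) \<and>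
     (\<forall>c. \<forall>x\<in>carrier V. \<phi> (c \<odot>\<^bsub>V\<^esub> x) = (\<lambda>e. c * \<phi> x e))"

lemma coordinatesD:
  assumes "coordinates V E \<phi>"
  shows "inj_on \<phi> (carrier V)"
    "(\<And>e. v e \<noteq> 0 \<Longrightarrow> e \<in> E) \<Longrightarrow> \<exists>x\<in>carrier V. \<phi> x = v"
    "x \<in> carrier V \<Longrightarrow> \<phi> x e \<noteq> 0 \<Longrightarrow> e \<in> E"
    "x \<in> carrier V \<Longrightarrow> y \<in> carrier V \<Longrightarrow> \<phi> (x \<oplus>\<^bsub>V\<^esub> y) e = \<phi> x e + \<phi> y e"
    "x \<in> carrier V \<Longrightarrow> \<phi> (c \<odot>\<^bsub>V\<^esub> x) e = c * \<phi> x e"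
proof -
  have bij: "bij_betw \<phi> (carrier V) {v. \<forall>e. v e \<noteq> 0 \<longrightarrow> e \<in> E}"
    using assms unfolding coordinates_def by blast
  show "inj_on \<phi> (carrier V)" using bij by (rule bij_betw_imp_inj_on)
  show "\<exists>x\<in>carrier V. \<phi> x = v" if "\<And>e. v e \<noteq> 0 \<Longrightarrow> e \<in> E"
  proof -
    have "v \<in> \<phi> ` carrier V" using bij_betw_imp_surj_on[OF bij] that by simp
    then show ?thesis by auto
  qed
  show "x \<in> carrier V \<Longrightarrow> \<phi> x e \<noteq> 0 \<Longrightarrow> e \<in> E"
    using bij_betwE[OF bij] by blast
  have add: "\<forall>x\<in>carrier V. \<forall>y\<in>carrier V. \<phi> (x \<oplus>\<^bsub>V\<^esub> y) = (\<lambda>e. \<phi> x e + \<phi> y e)"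
    and smult: "\<forall>c. \<forall>x\<in>carrier V. \<phi> (c \<odot>\<^bsub>V\<^esub> x) = (\<lambda>e. c * \<phi> x e)"
    using assms unfolding coordinates_def by blast+
  show "\<phi> (x \<oplus>\<^bsub>V\<^esub> y) e = \<phi> x e + \<phi> y e" if "x \<in> carrier V" "y \<in> carrier V"
    using add that by simp
  show "\<phi> (c \<odot>\<^bsub>V\<^esub> x) e = c * \<phi> x e" if "x \<in> carrier V"
    using smult that by simp
qed

lemma coordinates_eqI:
  assumes "coordinates V E \<phi>" "x \<in> carrier V" "y \<in> carrier V" "\<And>e. e \<in> E \<Longrightarrow> \<phi> x e = \<phi> y e"
  shows "x = y"
proof (rule inj_onD[OF coordinatesD(1)[OF assms(1)] ext])
  show "\<phi> x e = \<phi> y e" for e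
    using assms coordinatesD(3)[OF assms(1)] by metis
qed (use assms in auto)

text \<open>The axioms hold pointwise for functions and are pulled back along the injective \<phi>;
  additive inverses come from its surjectivity.\<close>

lemma vectorspace_coordinates:
  fixes V :: "('k::field, 'm) module"
  assumes \<phi>: "coordinates V E \<phi>"
    and add: "\<And>x y. x \<in> carrier V \<Longrightarrow> y \<in> carrier V \<Longrightarrow> x \<oplus>\<^bsub>V\<^esub> y \<in> carrier V"
    and smult: "\<And>c x. x \<in> carrier V \<Longrightarrow> c \<odot>\<^bsub>V\<^esub> x \<in> carrier V"
    and zero: "\<zero>\<^bsub>V\<^esub> \<in> carrier V" "\<phi> \<zero>\<^bsub>V\<^esub> = (\<lambda>_. 0)"
  shows "vectorspace (class_ring :: 'k ring) V"
proof -
  note \<phi>' = coordinatesD[OF \<phi>]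
  note eqI = coordinates_eqI[OF \<phi>]
  show ?thesis
  proof (rule vs_criteria[OF class_field zero(1)]; (intro allI impI ballI)?; (elim conjE)?)
    fix v assume v: "v \<in> carrier V"
    obtain w where w: "w \<in> carrier V" "\<phi> w = (\<lambda>e. - \<phi> v e)"
      using \<phi>'(2)[of "\<lambda>e. - \<phi> v e"] \<phi>'(3)[OF v] by auto
    show "\<exists>w\<in>carrier V. v \<oplus>\<^bsub>V\<^esub> w = \<zero>\<^bsub>V\<^esub>"
      using v w by (intro bexI[of _ w] eqI) (auto simp: add zero \<phi>'(4))
  qed (use add smult zero in \<open>auto intro!: eqI simp: \<phi>'(4,5) algebra_simps\<close>)
qed

text \<open>The preimages of the unit functions of \<open>E\<close> form a basis, since \<phi>
  recovers the coefficients of every linear combination of them.\<close>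

lemma dim_coordinates:
  fixes V :: "('k::field, 'm) module"
  assumes vs: "vectorspace (class_ring :: 'k ring) V"
    and \<phi>: "coordinates V E \<phi>" and E: "finite E"
  shows "vectorspace.dim (class_ring :: 'k ring) V = card E"
proof -
  interpret vectorspace "class_ring :: 'k ring" V by fact
  note \<phi>' = coordinatesD[OF \<phi>]
  note eqI = coordinates_eqI[OF \<phi>]
  have \<phi>0: "\<phi> \<zero>\<^bsub>V\<^esub> e = 0" for e
  proof -
    have "\<phi> \<zero>\<^bsub>V\<^esub> e = \<phi> \<zero>\<^bsub>V\<^esub> e + \<phi> \<zero>\<^bsub>V\<^esub> e"
      using \<phi>'(4)[OF M.zero_closed M.zero_closed, of e] by (simp only: M.l_zero M.zero_closed)
    then show ?thesis by (metis add_cancel_right_right)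
  qed
  have \<phi>_finsum: "\<phi> (finsum V g B) e = (\<Sum>b\<in>B. \<phi> (g b) e)" if "g \<in> B \<rightarrow> carrier V" for g :: "'m \<Rightarrow> 'm" and B e
    using that
    by (induction B rule: infinite_finite_induct) (auto simp: \<phi>0 \<phi>'(4))
  have "\<exists>x\<in>carrier V. \<phi> x = (\<lambda>e'. if e' = e then 1 else 0)" if "e \<in> E" for e
    using that by (intro \<phi>'(2)) (auto split: if_splits)
  then have "\<forall>e\<in>E. \<exists>x. x \<in> carrier V \<and> \<phi> x = (\<lambda>e'. if e' = e then 1 else 0)" by blast
  from bchoice[OF this] obtain u where "\<forall>e\<in>E. u e \<in> carrier V \<and> \<phi> (u e) = (\<lambda>e'. if e' = e then 1 else 0)" ..
  then have u: "e \<in> E \<Longrightarrow> u e \<in> carrier V" "e \<in> E \<Longrightarrow> \<phi> (u e) e' = (if e' = e then 1 else 0)" for e e'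
    by simp_all
  have inj: "inj_on u E"
    using u(2) by (intro inj_onI) (metis zero_neq_one)
  have B: "finite (u ` E)" "u ` E \<subseteq> carrier V" using E u by auto
  have \<phi>_lincomb: "\<phi> (lincomb a (u ` E)) e = a (u e)" if "e \<in> E" for a e
  proof -
    have "\<phi> (lincomb a (u ` E)) e = (\<Sum>b\<in>u ` E. a b * \<phi> b e)"
      unfolding lincomb_def using B by (subst \<phi>_finsum) (auto simp: \<phi>'(5) subset_iff intro!: sum.cong)
    also have "\<dots> = (\<Sum>e'\<in>E. if e' = e then a (u e) else 0)"
      unfolding sum.reindex[OF inj] using that u(2) by (intro sum.cong) auto
    finally show ?thesis using that E by simp
  qed
  have "basis (u ` E)"
    unfolding basis_criterion[OF B]
  proof (intro allI impI ex1I conjI)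
    fix v assume v: "v \<in> carrier V"
    define a where "a = restrict (\<lambda>b. \<phi> v (inv_into E u b)) (u ` E)"
    show "a \<in> u ` E \<rightarrow>\<^sub>E carrier class_ring" by (simp add: a_def)
    show "lincomb a (u ` E) = v"
      using v B \<phi>_lincomb inj by (intro eqI lincomb_closed) (auto simp: a_def)
    fix b assume b: "b \<in> u ` E \<rightarrow>\<^sub>E carrier class_ring \<and> lincomb b (u ` E) = v"
    show "b = a"
    proof (rule extensionalityI[of _ "u ` E"])
      show "b \<in> extensional (u ` E)" using b by (auto simp: PiE_def)
      show "b x = a x" if "x \<in> u ` E" for x
        using that b \<phi>_lincomb[of _ b] inj by (auto simp: a_def)
    qed (simp add: a_def)
  qed
  then show ?thesis
    using dim_basis[OF B(1)] card_image[OF inj] by simp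
qed

lemma coordinates_exist:
  fixes V :: "('k::field, 'm) module"
  assumes "vectorspace (class_ring :: 'k ring) V" "vectorspace.fin_dim (class_ring :: 'k ring) V"
  obtains \<phi> where "coordinates V {..<vectorspace.dim (class_ring :: 'k ring) V} \<phi>"
proof -
  interpret vectorspace "class_ring :: 'k ring" V by fact
  obtain \<beta> where \<beta>: "finite \<beta>" "basis \<beta>" using finite_basis_exists[OF assms(2)] by blast
  then have \<beta>C: "\<beta> \<subseteq> carrier V" by (simp add: basis_def)
  have dim: "dim = card \<beta>" by (rule dim_basis[OF \<beta>])
  obtain f where f: "bij_betw f {..<dim} \<beta>"
    unfolding dim using ex_bij_betw_nat_finite[OF \<beta>(1)] by (auto simp: atLeast0LessThan)
  have ex1: "\<exists>!a. a \<in> \<beta> \<rightarrow>\<^sub>E UNIV \<and> lincomb a \<beta> = v" if "v \<in> carrier V" for v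
    using basis_criterion[OF \<beta>(1) \<beta>C] \<beta>(2) that by simp
  define a where "a v = (THE a. a \<in> \<beta> \<rightarrow>\<^sub>E UNIV \<and> lincomb a \<beta> = v)" for v
  have a: "a v \<in> \<beta> \<rightarrow>\<^sub>E UNIV" "lincomb (a v) \<beta> = v" if "v \<in> carrier V" for v
    using theI'[OF ex1[OF that]] by (simp_all add: a_def)
  have a_eq: "a (lincomb b \<beta>) x = b x" if "x \<in> \<beta>" for b x
  proof -
    have "lincomb (restrict b \<beta>) \<beta> = lincomb b \<beta>"
      using \<beta>C by (intro lincomb_cong) auto
    moreover have "lincomb b \<beta> \<in> carrier V" using \<beta>C by (intro lincomb_closed) auto
    ultimately have "a (lincomb b \<beta>) = restrict b \<beta>"
      unfolding a_def by (intro the1_equality ex1) auto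
    then show ?thesis using that by simp
  qed
  define \<phi> where "\<phi> v n = (if n < dim then a v (f n) else 0)" for v n
  have fb: "f n \<in> \<beta>" if "n < dim" for n using f that by (auto simp: bij_betw_def)
  have "coordinates V {..<dim} \<phi>"
    unfolding coordinates_def
  proof (intro conjI ballI allI)
    show "bij_betw \<phi> (carrier V) {v. \<forall>e. v e \<noteq> 0 \<longrightarrow> e \<in> {..<dim}}"
      unfolding bij_betw_def
    proof
      show "inj_on \<phi> (carrier V)"
      proof (rule inj_onI)
        fix v w assume v: "v \<in> carrier V" and w: "w \<in> carrier V" and eq: "\<phi> v = \<phi> w"
        have "a v x = a w x" if "x \<in> \<beta>" for x
        proof -
          obtain n where "n < dim" "x = f n" using f \<open>x \<in> \<beta>\<close> by (auto simp: bij_betw_def)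
          then show ?thesis using fun_cong[OF eq, of n] by (simp add: \<phi>_def)
        qed
        then have "lincomb (a v) \<beta> = lincomb (a w) \<beta>"
          using \<beta>C by (intro lincomb_cong) auto
        then show "v = w" using a(2) v w by simp
      qed
      show "\<phi> ` carrier V = {v. \<forall>e. v e \<noteq> 0 \<longrightarrow> e \<in> {..<dim}}"
      proof safe
        fix c :: "nat \<Rightarrow> 'k" assume c: "\<forall>e. c e \<noteq> 0 \<longrightarrow> e \<in> {..<dim}"
        define v where "v = lincomb (\<lambda>b. c (inv_into {..<dim} f b)) \<beta>"
        have "v \<in> carrier V" unfolding v_def using \<beta>C by (intro lincomb_closed) auto
        moreover have "\<phi> v n = c n" for n
          using c fb f by (auto simp: \<phi>_def v_def a_eq bij_betw_def)
        ultimately show "c \<in> \<phi> ` carrier V" by (metis ext image_eqI)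
      qed (auto simp: \<phi>_def split: if_splits)
    qed
  next
    fix v w assume v: "v \<in> carrier V" and w: "w \<in> carrier V"
    have "v \<oplus>\<^bsub>V\<^esub> w = lincomb (\<lambda>x. a v x + a w x) \<beta>"
      using lincomb_sum[OF \<beta>(1) \<beta>C, of "a v" "a w"] a v w by simp
    then show "\<phi> (v \<oplus>\<^bsub>V\<^esub> w) = (\<lambda>e. \<phi> v e + \<phi> w e)"
      by (auto simp: \<phi>_def a_eq fb)
  next
    fix c v assume v: "v \<in> carrier V"
    have "c \<odot>\<^bsub>V\<^esub> v = lincomb (\<lambda>x. c * a v x) \<beta>"
      using lincomb_smult[OF \<beta>C, of "a v" c] a v by simp
    then show "\<phi> (c \<odot>\<^bsub>V\<^esub> v) = (\<lambda>e. c * \<phi> v e)"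
      by (auto simp: \<phi>_def a_eq fb)
  qed
  then show ?thesis by (rule that)
qed

section \<open>Monomials, degrees and ideals of the polynomial ring\<close>

lemma lookup_single': "lookup (single k v) k' = (if k = k' then v else 0)"
  by (simp add: lookup_single when_def)

lemma mpoly_induct [case_names zero add_single]:
  assumes "P 0" and "\<And>f e c. P f \<Longrightarrow> P (f + single e c)"
  shows "P (f :: ('n::finite, 'k::field) mpoly)"
proof -
  have "P (\<Sum>e\<in>E. single e (lookup f e))" if "finite E" for E
    using that
  proof (induction E rule: finite_induct)
    case (insert e E)
    then show ?case
      unfolding sum.insert[OF insert.hyps] by (subst add.commute) (rule assms(2))
  qed (simp add: assms(1))
  moreover have "(\<Sum>e\<in>keys f. single e (lookup f e)) = f"
    by (rule poly_mapping_eqI) (auto simp: lookup_sum lookup_single' in_keys_iff)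
  ultimately show ?thesis by (metis finite_keys)
qed

lemma monom_degree_add: "monom_degree (a + b) = monom_degree a + monom_degree b"
  by (simp add: monom_degree_def lookup_add sum.distrib)

lemma monom_degree_zero [simp]: "monom_degree 0 = 0"
  by (simp add: monom_degree_def)

lemma monom_degree_single [simp]: "monom_degree (single i m) = m"
  by (simp add: monom_degree_def lookup_single')

lemma lookup_le_monom_degree: "lookup e i \<le> monom_degree e"
  unfolding monom_degree_def by (rule member_le_sum) auto

lemma finite_monom_degree: "finite {e :: 'n::finite \<Rightarrow>\<^sub>0 nat. monom_degree e \<le> d}"
proof (rule finite_imageD)
  have "lookup ` {e :: 'n \<Rightarrow>\<^sub>0 nat. monom_degree e \<le> d} \<subseteq> PiE UNIV (\<lambda>_. {..d})"
  proof (intro image_subsetI PiE_I)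
    fix e :: "'n \<Rightarrow>\<^sub>0 nat" and i assume "e \<in> {e. monom_degree e \<le> d}"
    then show "lookup e i \<in> {..d}"
      using lookup_le_monom_degree[of e i] by simp
  qed simp
  then show "finite (lookup ` {e :: 'n \<Rightarrow>\<^sub>0 nat. monom_degree e \<le> d})"
    by (rule finite_subset) (intro finite_PiE, auto)
qed (simp add: inj_on_def)

lemma single_homogeneous: "single e c \<in> homogeneous_part (int (monom_degree e))"
  by (simp add: homogeneous_part_def)

lemma const_homogeneous: "const c \<in> homogeneous_part 0"
  using single_homogeneous[of 0 c] by (simp add: const_def)

lemma var_homogeneous: "var i \<in> homogeneous_part 1"
  using single_homogeneous[of "single i 1" 1] by (simp add: var_def)

lemma const_hom: "const (a + b) = const a + const b" "const (a * b) = const a * const b" "const 1 = 1"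
  by (simp_all add: const_def single_add mult_single)

lemma ideal_class_ringI:
  fixes L :: "('n::finite, 'k::field) mpoly set"
  assumes zero: "0 \<in> L" and add: "\<And>a b. a \<in> L \<Longrightarrow> b \<in> L \<Longrightarrow> a + b \<in> L" and mult: "\<And>c a. a \<in> L \<Longrightarrow> c * a \<in> L"
  shows "ideal L class_ring"
proof (rule idealI[OF class_ring.ring_axioms])
  show "subgroup L (add_monoid class_ring)"
  proof
    fix x :: "('n, 'k) mpoly" assume "x \<in> L"
    moreover have "inv\<^bsub>add_monoid class_ring\<^esub> x = (-1) * x"
    proof -
      have "inv\<^bsub>add_monoid class_ring\<^esub> x = a_inv class_ring x" by (simp only: a_inv_def)
      also have "\<dots> = - x" by (simp only: class_ring_simps)
      finally show ?thesis by simp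
    qed
    ultimately show "inv\<^bsub>add_monoid class_ring\<^esub> x \<in> L" using mult[of x "-1"] by simp
  qed (auto simp: add zero)
qed (use mult in \<open>auto simp: mult.commute\<close>)

text \<open>The combinations of the variables form an ideal that contains the variables, so they
  exhaust the generated one. The \<open>g j\<close> become the coefficients of the contracting
  homotopy for a possibly inhomogeneous element.\<close>

lemma irrelevant_ideal_sum:
  assumes "f \<in> (irrelevant_ideal :: ('n::finite, 'k::field) mpoly set)"
  shows "\<exists>g. f = (\<Sum>j\<in>UNIV. g j * var j)"
proof -
  define L where "L = {f :: ('n, 'k) mpoly. \<exists>g. f = (\<Sum>j\<in>UNIV. g j * var j)}"
  have add: "a + b \<in> L" if "a \<in> L" "b \<in> L" for a b
  proof -
    obtain g h where "a = (\<Sum>j\<in>UNIV. g j * var j)" "b = (\<Sum>j\<in>UNIV. h j * var j)"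
      using \<open>a \<in> L\<close> \<open>b \<in> L\<close> by (auto simp: L_def)
    then have "a + b = (\<Sum>j\<in>UNIV. (g j + h j) * var j)" by (simp add: sum.distrib distrib_right)
    then show ?thesis by (auto simp: L_def)
  qed
  have mult: "c * a \<in> L" if "a \<in> L" for a c
  proof -
    obtain g where "a = (\<Sum>j\<in>UNIV. g j * var j)" using \<open>a \<in> L\<close> by (auto simp: L_def)
    then have "c * a = (\<Sum>j\<in>UNIV. (c * g j) * var j)" by (simp add: sum_distrib_left mult.assoc)
    then show ?thesis unfolding L_def by (intro CollectI exI[of _ "\<lambda>j. c * g j"])
  qed
  have zero: "0 \<in> L" by (auto simp: L_def intro!: exI[of _ "\<lambda>_. 0"])
  have "ideal L class_ring" by (intro ideal_class_ringI zero add mult)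
  moreover have "range var \<subseteq> L"
  proof safe
    fix i :: 'n
    have "(\<Sum>j\<in>UNIV. (if j = i then 1 else 0) * var j) = (var i :: ('n, 'k) mpoly)"
      by (simp add: if_distrib[of "\<lambda>x. x * _"] cong: if_cong)
    then show "var i \<in> L" unfolding L_def by (intro CollectI exI[of _ "\<lambda>j. if j = i then 1 else 0"]) simp
  qed
  ultimately have "irrelevant_ideal \<subseteq> L"
    unfolding irrelevant_ideal_def by (rule ring.genideal_minimal[OF class_ring.ring_axioms])
  then show ?thesis using assms by (auto simp: L_def)
qed

section \<open>Homogeneous components\<close>

context graded_module
begin

lemma smult_in [simp]: "x \<in> carrier M \<Longrightarrow> f \<odot>\<^bsub>M\<^esub> x \<in> carrier M"
  using smult_closed[of f x] by simp

lemma smult_poly: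
  assumes "x \<in> carrier M"
  shows "(f + g) \<odot>\<^bsub>M\<^esub> x = f \<odot>\<^bsub>M\<^esub> x \<oplus>\<^bsub>M\<^esub> g \<odot>\<^bsub>M\<^esub> x" "(f * g) \<odot>\<^bsub>M\<^esub> x = f \<odot>\<^bsub>M\<^esub> (g \<odot>\<^bsub>M\<^esub> x)"
    "1 \<odot>\<^bsub>M\<^esub> x = x" "0 \<odot>\<^bsub>M\<^esub> x = \<zero>\<^bsub>M\<^esub>" "y \<in> carrier M \<Longrightarrow> f \<odot>\<^bsub>M\<^esub> (x \<oplus>\<^bsub>M\<^esub> y) = f \<odot>\<^bsub>M\<^esub> x \<oplus>\<^bsub>M\<^esub> f \<odot>\<^bsub>M\<^esub> y"
  using smult_l_distr[of f g x] smult_assoc1[of f g x] smult_one[of x] smult_l_null[of x]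
    smult_r_distr[of f x y] assms by simp_all

lemma smult_commute: "x \<in> carrier M \<Longrightarrow> f \<odot>\<^bsub>M\<^esub> (g \<odot>\<^bsub>M\<^esub> x) = g \<odot>\<^bsub>M\<^esub> (f \<odot>\<^bsub>M\<^esub> x)"
  by (simp add: mult.commute flip: smult_poly(2))

lemma smult_zero [simp]: "f \<odot>\<^bsub>M\<^esub> \<zero>\<^bsub>M\<^esub> = \<zero>\<^bsub>M\<^esub>"
  using rmult_0[of f] by simp

lemma smult_finsum:
  assumes "g \<in> A \<rightarrow> carrier M"
  shows "f \<odot>\<^bsub>M\<^esub> finsum M g A = finsum M (\<lambda>a. f \<odot>\<^bsub>M\<^esub> g a) A"
  using assms by (induction A rule: infinite_finite_induct) (auto simp: smult_poly(5) Pi_iff)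

lemma component_carrier [simp]: "x \<in> G i \<Longrightarrow> x \<in> carrier M"
  using additive_subgroup.a_subset[OF component_subgroup] by blast

lemma component_zero [simp]: "\<zero>\<^bsub>M\<^esub> \<in> G i"
  by (rule additive_subgroup.zero_closed[OF component_subgroup])

lemma component_add: "x \<in> G i \<Longrightarrow> y \<in> G i \<Longrightarrow> x \<oplus>\<^bsub>M\<^esub> y \<in> G i"
  by (rule additive_subgroup.a_closed[OF component_subgroup])

lemma const_smult_component: "x \<in> G i \<Longrightarrow> const c \<odot>\<^bsub>M\<^esub> x \<in> G i"
  using smult_component[OF const_homogeneous] by fastforce

definition comp :: "'m \<Rightarrow> int \<Rightarrow> 'm" where
  "comp x = (THE c. (\<forall>i. c i \<in> G i) \<and> finite {i. c i \<noteq> \<zero>\<^bsub>M\<^esub>} \<and> x = finsum M c {i. c i \<noteq> \<zero>\<^bsub>M\<^esub>})"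

lemma comp_properties:
  assumes "x \<in> carrier M"
  shows "comp x i \<in> G i" "finite {i. comp x i \<noteq> \<zero>\<^bsub>M\<^esub>}" "x = finsum M (comp x) {i. comp x i \<noteq> \<zero>\<^bsub>M\<^esub>}"
  using theI'[OF direct_sum_decomposition[OF assms]] unfolding comp_def[symmetric] by simp_all

lemma comp_carrier [simp]: "x \<in> carrier M \<Longrightarrow> comp x i \<in> carrier M"
  using comp_properties(1) component_carrier by blast

lemma finsum_superset:
  assumes "finite F" "A \<subseteq> F" "\<And>i. i \<in> F - A \<Longrightarrow> c i = \<zero>\<^bsub>M\<^esub>" "\<And>i. c i \<in> carrier M"
  shows "finsum M c A = finsum M c F"
  using assms by (intro M.add.finprod_mono_neutral_cong_left) auto

lemma comp_sum:
  assumes "x \<in> carrier M" "finite F" "\<And>i. i \<notin> F \<Longrightarrow> comp x i = \<zero>\<^bsub>M\<^esub>"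
  shows "x = finsum M (comp x) F"
proof -
  have "finsum M (comp x) {i. comp x i \<noteq> \<zero>\<^bsub>M\<^esub>} = finsum M (comp x) F"
    using assms by (intro finsum_superset) auto
  then show ?thesis using comp_properties(3)[OF assms(1)] by simp
qed

text \<open>Any finite set containing the support may be used, which avoids computing the exact
  supports of sums and products.\<close>

lemma comp_unique:
  assumes "\<And>i. c i \<in> G i" "finite F" "\<And>i. i \<notin> F \<Longrightarrow> c i = \<zero>\<^bsub>M\<^esub>" "x = finsum M c F"
  shows "comp x = c"
proof -
  have "finite {i. c i \<noteq> \<zero>\<^bsub>M\<^esub>}"
    by (rule finite_subset[OF _ assms(2)]) (use assms(3) in auto)
  moreover have "finsum M c {i. c i \<noteq> \<zero>\<^bsub>M\<^esub>} = finsum M c F"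
    using assms(2,3) component_carrier[OF assms(1)] by (intro finsum_superset) auto
  moreover have "x \<in> carrier M"
    unfolding assms(4) using component_carrier[OF assms(1)] by (intro M.finsum_closed) auto
  ultimately show ?thesis
    unfolding comp_def using direct_sum_decomposition[of x] assms by (intro the1_equality) auto
qed

lemma comp_add:
  assumes x: "x \<in> carrier M" and y: "y \<in> carrier M"
  shows "comp (x \<oplus>\<^bsub>M\<^esub> y) i = comp x i \<oplus>\<^bsub>M\<^esub> comp y i"
proof -
  let ?F = "{i. comp x i \<noteq> \<zero>\<^bsub>M\<^esub>} \<union> {i. comp y i \<noteq> \<zero>\<^bsub>M\<^esub>}"
  have fin: "finite ?F" using comp_properties(2) x y by blast
  have "x \<oplus>\<^bsub>M\<^esub> y = finsum M (comp x) ?F \<oplus>\<^bsub>M\<^esub> finsum M (comp y) ?F"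
    using comp_sum[OF x fin] comp_sum[OF y fin] by simp
  also have "\<dots> = finsum M (\<lambda>i. comp x i \<oplus>\<^bsub>M\<^esub> comp y i) ?F"
    using x y by (intro M.finsum_addf[symmetric]) auto
  finally have "comp (x \<oplus>\<^bsub>M\<^esub> y) = (\<lambda>i. comp x i \<oplus>\<^bsub>M\<^esub> comp y i)"
    using x y fin comp_properties(1) component_add by (intro comp_unique[of _ ?F]) auto
  then show ?thesis by simp
qed

lemma comp_component:
  assumes "x \<in> G i"
  shows "comp x = (\<lambda>j. if j = i then x else \<zero>\<^bsub>M\<^esub>)"
  using assms by (intro comp_unique[of _ "{i}"]) auto

lemma comp_zero [simp]: "comp \<zero>\<^bsub>M\<^esub> i = \<zero>\<^bsub>M\<^esub>"
  using comp_component[of "\<zero>\<^bsub>M\<^esub>" i] by simp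

lemma comp_smult:
  assumes f: "f \<in> homogeneous_part d" and x: "x \<in> carrier M"
  shows "comp (f \<odot>\<^bsub>M\<^esub> x) i = f \<odot>\<^bsub>M\<^esub> comp x (i - d)"
proof -
  let ?F = "{i. comp x i \<noteq> \<zero>\<^bsub>M\<^esub>}"
  have fin: "finite ?F" by (rule comp_properties(2)[OF x])
  have inj: "inj_on (\<lambda>i. i + d) ?F" by (simp add: inj_on_def)
  have "f \<odot>\<^bsub>M\<^esub> x = finsum M (\<lambda>i. f \<odot>\<^bsub>M\<^esub> comp x i) ?F"
    by (subst comp_properties(3)[OF x], rule smult_finsum) (use x in auto)
  also have "\<dots> = finsum M (\<lambda>i. f \<odot>\<^bsub>M\<^esub> comp x (i - d)) ((\<lambda>i. i + d) ` ?F)"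
    using M.finsum_reindex[OF _ inj, of "\<lambda>i. f \<odot>\<^bsub>M\<^esub> comp x (i - d)"] x by auto
  finally have "comp (f \<odot>\<^bsub>M\<^esub> x) = (\<lambda>i. f \<odot>\<^bsub>M\<^esub> comp x (i - d))"
  proof (rule comp_unique[rotated -1])
    show "f \<odot>\<^bsub>M\<^esub> comp x (i - d) \<in> G i" for i
      using smult_component[OF f comp_properties(1)[OF x], of "i - d"] by simp
    show "f \<odot>\<^bsub>M\<^esub> comp x (i - d) = \<zero>\<^bsub>M\<^esub>" if "i \<notin> (\<lambda>i. i + d) ` ?F" for i
    proof -
      have "i - d \<notin> ?F" using that by (metis diff_add_cancel image_eqI)
      then show ?thesis by simp
    qed
  qed (use fin in auto)
  then show ?thesis by simp
qed

lemma component_space_simps [simp]: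
  "carrier (component_space M G i) = G i" "x \<oplus>\<^bsub>component_space M G i\<^esub> y = x \<oplus>\<^bsub>M\<^esub> y"
  "\<zero>\<^bsub>component_space M G i\<^esub> = \<zero>\<^bsub>M\<^esub>" "c \<odot>\<^bsub>component_space M G i\<^esub> x = const c \<odot>\<^bsub>M\<^esub> x"
  by (simp_all add: component_space_def)

lemma vectorspace_component: "vectorspace class_ring (component_space M G i)"
proof (rule vs_criteria[OF class_field]; (intro allI impI ballI)?; (elim conjE)?)
  fix v assume v: "v \<in> carrier (component_space M G i)"
  then have "\<ominus>\<^bsub>M\<^esub> v \<in> G i"
    using additive_subgroup.a_inv_closed[OF component_subgroup] by simp
  then show "\<exists>w\<in>carrier (component_space M G i). v \<oplus>\<^bsub>component_space M G i\<^esub> w = \<zero>\<^bsub>component_space M G i\<^esub>"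
    using v by (intro bexI[of _ "\<ominus>\<^bsub>M\<^esub> v"]) (auto simp: M.r_neg)
qed (simp_all add: component_add const_smult_component const_hom smult_poly M.a_assoc, auto intro: M.a_comm)

text \<open>The component of degree \<open>i\<close> is spanned by the products of monomials with homogeneous
  components of the generators.\<close>
lemma component_finite_dimensional:
  assumes "finitely_generated M"
  shows "vectorspace.fin_dim class_ring (component_space M G i)"
    and "\<exists>b. \<forall>i<b. hilbert_function M G i = 0"
proof -
  obtain A where A: "finite A" "A \<subseteq> carrier M" "span A = carrier M"
    using assms unfolding finitely_generated_def by blast
  \<comment> \<open>The finitely many degrees in which some generator has a component.\<close>
  define E where "E = (\<Union>a\<in>A. {j. comp a j \<noteq> \<zero>\<^bsub>M\<^esub>})"
  have finE: "finite E"
    unfolding E_def using A comp_properties(2) by blast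
  define T where "T i = {single e 1 \<odot>\<^bsub>M\<^esub> comp a j | a e j. a \<in> A \<and> j \<in> E \<and> int (monom_degree e) + j = i}" for i
  have "T i \<subseteq> (\<lambda>(a, e, j). single e 1 \<odot>\<^bsub>M\<^esub> comp a j) `
      (A \<times> {e. monom_degree e \<le> nat (i - Min E)} \<times> E)" for i
    unfolding T_def
  proof clarify
    fix a j and e :: "'n \<Rightarrow>\<^sub>0 nat" assume aej: "a \<in> A" "j \<in> E" "i = int (monom_degree e) + j"
    have "Min E \<le> j" using aej finE by simp
    then show "single e 1 \<odot>\<^bsub>M\<^esub> comp a j \<in> (\<lambda>(a, e, j). single e 1 \<odot>\<^bsub>M\<^esub> comp a j) `
      (A \<times> {e'. monom_degree e' \<le> nat (int (monom_degree e) + j - Min E)} \<times> E)"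
      using aej by (intro image_eqI[of _ _ "(a, e, j)"]) auto
  qed
  then have finT: "finite (T i)" for i
    by (rule finite_subset) (intro finite_imageI finite_cartesian_product A finE finite_monom_degree)
  have TG: "T i \<subseteq> G i" for i
    unfolding T_def using smult_component[OF single_homogeneous comp_properties(1)] A by blast
  define W where "W i = LinearCombinations.module.span class_ring (component_space M G i) (T i)" for i
  have mod: "Module.module class_ring (component_space M G i)" for i
    using vectorspace_component by (simp add: vectorspace_def)
  have sub: "submodule class_ring (W i) (component_space M G i)" for i
    unfolding W_def using TG by (intro LinearCombinations.module.span_is_submodule[OF mod]) simp
  have TW: "T i \<subseteq> W i" for i
    unfolding W_def using TG by (intro LinearCombinations.module.in_own_span[OF mod]) simp
  have W: "W i \<subseteq> G i" "x \<in> W i \<Longrightarrow> y \<in> W i \<Longrightarrow> x \<oplus>\<^bsub>M\<^esub> y \<in> W i" "\<zero>\<^bsub>M\<^esub> \<in> W i"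
    "x \<in> W i \<Longrightarrow> const c \<odot>\<^bsub>M\<^esub> x \<in> W i" for i x y c
    using sub[of i] unfolding submodule_def by simp_all
  \<comment> \<open>Monomials carry one span into another because the product of two monomials is a
    monomial, so \<open>T i\<close> is sent into \<open>T\<close> of the shifted degree.\<close>
  have W_monom: "single e 1 \<odot>\<^bsub>M\<^esub> w \<in> W (i + int (monom_degree e))" if w: "w \<in> W i" for e :: "'n \<Rightarrow>\<^sub>0 nat" and i w
  proof -
    let ?W' = "{w \<in> G i. single e 1 \<odot>\<^bsub>M\<^esub> w \<in> W (i + int (monom_degree e))}"
    have "submodule class_ring ?W' (component_space M G i)"
    proof (rule LinearCombinations.submodule.intro)
      show "Module.module class_ring (component_space M G i)" by (rule mod)
      show "x \<oplus>\<^bsub>component_space M G i\<^esub> y \<in> ?W'" if "x \<in> ?W'" "y \<in> ?W'" for x y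
        using that by (auto simp: component_add smult_poly(5) W(2))
      show "c \<odot>\<^bsub>component_space M G i\<^esub> x \<in> ?W'" if "x \<in> ?W'" for c x
      proof -
        have "single e 1 \<odot>\<^bsub>M\<^esub> (const c \<odot>\<^bsub>M\<^esub> x) = const c \<odot>\<^bsub>M\<^esub> (single e 1 \<odot>\<^bsub>M\<^esub> x)"
          using that by (intro smult_commute) (blast intro: component_carrier)
        then show ?thesis using that by (auto simp: const_smult_component W(4))
      qed
    qed (auto simp: W)
    moreover have "T i \<subseteq> ?W'"
    proof
      fix t assume t: "t \<in> T i"
      then obtain a e' j where aej: "a \<in> A" "j \<in> E" "int (monom_degree e') + j = i"
        "t = single e' 1 \<odot>\<^bsub>M\<^esub> comp a j" by (auto simp: T_def)
      have "single e 1 \<odot>\<^bsub>M\<^esub> t = single (e + e') 1 \<odot>\<^bsub>M\<^esub> comp a j"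
        using A aej by (simp add: mult_single subset_iff flip: smult_poly(2))
      moreover have "\<dots> \<in> T (i + int (monom_degree e))"
        unfolding T_def using aej by (intro CollectI exI[of _ a] exI[of _ "e + e'"] exI[of _ j]) (simp add: monom_degree_add)
      ultimately have "single e 1 \<odot>\<^bsub>M\<^esub> t \<in> W (i + int (monom_degree e))"
        using TW by auto
      moreover have "t \<in> G i" using t TG by blast
      ultimately show "t \<in> ?W'" by blast
    qed
    ultimately have "W i \<subseteq> ?W'"
      unfolding W_def[of i] by (intro LinearCombinations.module.span_is_subset[OF mod])
    then show ?thesis using w by blast
  qed
  \<comment> \<open>This set is a submodule containing the generators, hence everything; for an
    element of \<open>G i\<close> this says that it lies in the span \<open>W i\<close> of the
    finite set \<open>T i\<close>.\<close>
  let ?W = "{x \<in> carrier M. \<forall>i. comp x i \<in> W i}"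
  have "submodule class_ring ?W M"
  proof (rule LinearCombinations.submodule.intro)
    show "Module.module class_ring M" by (rule module_axioms)
    show add: "x \<oplus>\<^bsub>M\<^esub> y \<in> ?W" if "x \<in> ?W" "y \<in> ?W" for x y
      using that by (auto simp: comp_add W(2))
    show "f \<odot>\<^bsub>M\<^esub> x \<in> ?W" if x: "x \<in> ?W" for f x
    proof (induction f rule: mpoly_induct)
      case (add_single f e c)
      have "single e c \<odot>\<^bsub>M\<^esub> x = const c \<odot>\<^bsub>M\<^esub> (single e 1 \<odot>\<^bsub>M\<^esub> x)"
        using x by (simp add: const_def mult_single flip: smult_poly(2))
      moreover have "comp \<dots> i = const c \<odot>\<^bsub>M\<^esub> (single e 1 \<odot>\<^bsub>M\<^esub> comp x (i - int (monom_degree e)))" for i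
        using x by (simp add: comp_smult[OF const_homogeneous] comp_smult[OF single_homogeneous])
      moreover have "\<dots> i \<in> W i" for i
        using W(4)[OF W_monom[of "comp x (i - int (monom_degree e))" "i - int (monom_degree e)" e]] x by simp
      ultimately have "single e c \<odot>\<^bsub>M\<^esub> x \<in> ?W" using x by simp
      with add_single show ?case using x add by (simp add: smult_poly(1))
    qed (use x in \<open>auto simp: smult_poly(4) W(3)\<close>)
  qed (auto simp: W(3))
  moreover have "A \<subseteq> ?W"
  proof safe
    fix a i assume a: "a \<in> A"
    then show "a \<in> carrier M" using A by blast
    show "comp a i \<in> W i"
    proof (cases "comp a i = \<zero>\<^bsub>M\<^esub>")
      case False
      have "single 0 1 \<odot>\<^bsub>M\<^esub> comp a i \<in> T i"
        unfolding T_def E_def using a False by (intro CollectI exI[of _ a] exI[of _ 0] exI[of _ i]) auto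
      then have "comp a i \<in> T i" using a A by (simp add: smult_poly(3) subset_iff)
      then show ?thesis using TW by blast
    qed (simp add: W)
  qed
  ultimately have all: "carrier M \<subseteq> ?W"
    unfolding A(3)[symmetric] by (intro span_is_subset)
  have WG: "W i = G i" for i
  proof (rule subset_antisym[OF W(1)])
    show "G i \<subseteq> W i"
    proof
      fix x assume x: "x \<in> G i"
      then have "comp x i \<in> W i" using all component_carrier by blast
      then show "x \<in> W i" by (simp add: comp_component[OF x])
    qed
  qed
  interpret vs: vectorspace class_ring "component_space M G i" for i by (rule vectorspace_component)
  show "vs.fin_dim i"
    unfolding vs.fin_dim_def using WG finT TG by (intro exI[of _ "T i"]) (auto simp: W_def)
  \<comment> \<open>Below the lowest degree in \<open>E\<close> there are no products to span with;
    inserting 0 covers the case that all generators vanish.\<close>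
  have "vs.dim i = 0" if "i < Min (insert 0 E)" for i
  proof -
    have "T i = {}"
      unfolding T_def using that finE by auto
    then have "vs.dim i \<le> card ({} :: 'm set)"
      using WG[of i] by (intro vs.gen_ge_dim) (auto simp: W_def)
    then show ?thesis by simp
  qed
  then show "\<exists>b. \<forall>i<b. vs.dim i = 0" by blast
qed

section \<open>Submodules generated by a sequence\<close>

lemma ideal_times_submodule: "submodule class_ring (ideal_times fs M) M"
  unfolding ideal_times_def by (intro span_is_submodule) auto

lemma ideal_times_subset: "ideal_times fs M \<subseteq> carrier M"
  using ideal_times_submodule[of fs] by (simp add: submodule_def)

lemma ideal_times_closed:
  "x \<in> ideal_times fs M \<Longrightarrow> y \<in> ideal_times fs M \<Longrightarrow> x \<oplus>\<^bsub>M\<^esub> y \<in> ideal_times fs M"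
  "\<zero>\<^bsub>M\<^esub> \<in> ideal_times fs M" "x \<in> ideal_times fs M \<Longrightarrow> f \<odot>\<^bsub>M\<^esub> x \<in> ideal_times fs M"
  using ideal_times_submodule[of fs] by (simp_all add: submodule_def)

lemma ideal_times_Nil: "ideal_times [] M = {\<zero>\<^bsub>M\<^esub>}"
proof -
  have "submodule class_ring {\<zero>\<^bsub>M\<^esub>} M"
    using module_axioms by unfold_locales (auto simp: Module.module_def)
  then have "ideal_times [] M \<subseteq> {\<zero>\<^bsub>M\<^esub>}"
    unfolding ideal_times_def by (intro span_is_subset) auto
  then show ?thesis using ideal_times_closed(2) by blast
qed

text \<open>Describes the submodule one element at a time, in the shape \<open>U + F V\<close> that
  the exactness results use.\<close>

lemma ideal_times_snoc:
  "ideal_times (fs @ [f]) M = {u \<oplus>\<^bsub>M\<^esub> f \<odot>\<^bsub>M\<^esub> x | u x. u \<in> ideal_times fs M \<and> x \<in> carrier M}" (is "_ = ?R")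
proof
  note u = subsetD[OF ideal_times_subset]
  have "submodule class_ring ?R M"
  proof (rule LinearCombinations.submodule.intro)
    show "Module.module class_ring M" by (rule module_axioms)
    show "?R \<subseteq> carrier M" using u by auto
    show "v \<oplus>\<^bsub>M\<^esub> w \<in> ?R" if vw: "v \<in> ?R" "w \<in> ?R" for v w
    proof -
      obtain a x b y where *: "v = a \<oplus>\<^bsub>M\<^esub> f \<odot>\<^bsub>M\<^esub> x" "w = b \<oplus>\<^bsub>M\<^esub> f \<odot>\<^bsub>M\<^esub> y"
        "a \<in> ideal_times fs M" "b \<in> ideal_times fs M" "x \<in> carrier M" "y \<in> carrier M"
        using vw by blast
      then have "v \<oplus>\<^bsub>M\<^esub> w = (a \<oplus>\<^bsub>M\<^esub> b) \<oplus>\<^bsub>M\<^esub> f \<odot>\<^bsub>M\<^esub> (x \<oplus>\<^bsub>M\<^esub> y)"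
        using u by (simp add: smult_poly(5) M.a_ac)
      then show ?thesis
        using * ideal_times_closed(1)[of a fs b]
        by (intro CollectI exI[of _ "a \<oplus>\<^bsub>M\<^esub> b"] exI[of _ "x \<oplus>\<^bsub>M\<^esub> y"]) simp
    qed
    show "\<zero>\<^bsub>M\<^esub> \<in> ?R"
      using ideal_times_closed(2) by (intro CollectI exI[of _ "\<zero>\<^bsub>M\<^esub>"]) auto
    show "g \<odot>\<^bsub>M\<^esub> v \<in> ?R" if v: "v \<in> ?R" for g v
    proof -
      obtain a x where *: "v = a \<oplus>\<^bsub>M\<^esub> f \<odot>\<^bsub>M\<^esub> x" "a \<in> ideal_times fs M" "x \<in> carrier M"
        using v by blast
      then have "g \<odot>\<^bsub>M\<^esub> v = g \<odot>\<^bsub>M\<^esub> a \<oplus>\<^bsub>M\<^esub> f \<odot>\<^bsub>M\<^esub> (g \<odot>\<^bsub>M\<^esub> x)"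
        using u by (simp add: smult_poly(5) smult_commute[of x g f])
      then show ?thesis
        using * ideal_times_closed(3)[of a fs g]
        by (intro CollectI exI[of _ "g \<odot>\<^bsub>M\<^esub> a"] exI[of _ "g \<odot>\<^bsub>M\<^esub> x"]) simp
    qed
  qed
  moreover have "{g \<odot>\<^bsub>M\<^esub> x | g x. g \<in> set (fs @ [f]) \<and> x \<in> carrier M} \<subseteq> ?R"
  proof safe
    fix g x assume g: "g \<in> set (fs @ [f])" and x: "x \<in> carrier M"
    show "\<exists>u y. g \<odot>\<^bsub>M\<^esub> x = u \<oplus>\<^bsub>M\<^esub> f \<odot>\<^bsub>M\<^esub> y \<and> u \<in> ideal_times fs M \<and> y \<in> carrier M"
    proof (cases "g \<in> set fs")
      case True
      then have "g \<odot>\<^bsub>M\<^esub> x \<in> ideal_times fs M"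
        unfolding ideal_times_def using x by (intro subsetD[OF in_own_span]) auto
      then show ?thesis using x by (intro exI[of _ "g \<odot>\<^bsub>M\<^esub> x"] exI[of _ "\<zero>\<^bsub>M\<^esub>"]) auto
    next
      case False
      then have "g = f" using g by auto
      then show ?thesis using x ideal_times_closed(2) by (intro exI[of _ "\<zero>\<^bsub>M\<^esub>"] exI[of _ x]) auto
    qed
  qed
  ultimately show "ideal_times (fs @ [f]) M \<subseteq> ?R"
    unfolding ideal_times_def[of "fs @ [f]"] by (intro span_is_subset)
  have "ideal_times fs M \<subseteq> ideal_times (fs @ [f]) M"
    unfolding ideal_times_def by (intro span_is_monotone) auto
  moreover have "f \<odot>\<^bsub>M\<^esub> x \<in> ideal_times (fs @ [f]) M" if "x \<in> carrier M" for x
    unfolding ideal_times_def using that by (intro subsetD[OF in_own_span]) auto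
  ultimately show "?R \<subseteq> ideal_times (fs @ [f]) M"
    using ideal_times_closed(1) by blast
qed

end

section \<open>The Koszul complex of a module in coordinates\<close>

locale coordinatized_module = graded_module M G
  for M :: "(('n::finite, 'k::field) mpoly, 'm) module" and G :: "int \<Rightarrow> 'm set" +
  fixes h :: "int \<Rightarrow> nat" and \<phi> :: "int \<Rightarrow> 'm \<Rightarrow> nat \<Rightarrow> 'k" and \<nu> :: "'n \<Rightarrow> nat"
  assumes coords: "coordinates (component_space M G i) {..<h i} (\<phi> i)"
    and inj_\<nu>: "inj \<nu>"
begin

lemma \<phi>_eqI: "x \<in> G i \<Longrightarrow> y \<in> G i \<Longrightarrow> (\<And>a. a < h i \<Longrightarrow> \<phi> i x a = \<phi> i y a) \<Longrightarrow> x = y"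
  using coordinates_eqI[OF coords] by simp

lemma \<phi>_surj: "(\<And>a. v a \<noteq> 0 \<Longrightarrow> a < h i) \<Longrightarrow> \<exists>x\<in>G i. \<phi> i x = v"
  using coordinatesD(2)[OF coords[of i], of v] by simp

lemma \<phi>_support: "x \<in> G i \<Longrightarrow> \<not> a < h i \<Longrightarrow> \<phi> i x a = 0"
  using coordinatesD(3)[OF coords[of i], of x a] by auto

lemma \<phi>_add: "x \<in> G i \<Longrightarrow> y \<in> G i \<Longrightarrow> \<phi> i (x \<oplus>\<^bsub>M\<^esub> y) a = \<phi> i x a + \<phi> i y a"
  using coordinatesD(4)[OF coords[of i], of x y a] by simp

lemma \<phi>_smult: "x \<in> G i \<Longrightarrow> \<phi> i (const c \<odot>\<^bsub>M\<^esub> x) a = c * \<phi> i x a"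
  using coordinatesD(5)[OF coords[of i], of x c a] by simp

lemma \<phi>_zero [simp]: "\<phi> i \<zero>\<^bsub>M\<^esub> a = 0"
proof -
  have "\<phi> i \<zero>\<^bsub>M\<^esub> a = \<phi> i \<zero>\<^bsub>M\<^esub> a + \<phi> i \<zero>\<^bsub>M\<^esub> a"
    using \<phi>_add[of "\<zero>\<^bsub>M\<^esub>" i "\<zero>\<^bsub>M\<^esub>" a] by (simp only: component_zero M.l_zero M.zero_closed)
  then show ?thesis by (metis add_cancel_right_right)
qed

lemma finsum_component: "g \<in> B \<rightarrow> G i \<Longrightarrow> finsum M g B \<in> G i"
proof (induction B rule: infinite_finite_induct)
  case (insert b B)
  then have "g b \<in> G i" "g \<in> B \<rightarrow> G i" by auto
  then show ?case
    using insert by (subst M.finsum_insert) (auto simp: component_add Pi_iff)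
qed auto

lemma \<phi>_finsum: "g \<in> B \<rightarrow> G i \<Longrightarrow> \<phi> i (finsum M g B) a = (\<Sum>b\<in>B. \<phi> i (g b) a)"
proof (induction B rule: infinite_finite_induct)
  case (insert b B)
  then have "g b \<in> G i" "g \<in> B \<rightarrow> G i" by auto
  then show ?case
    using insert by (subst M.finsum_insert) (auto simp: \<phi>_add finsum_component Pi_iff)
qed auto

definition unit_vec :: "int \<Rightarrow> nat \<Rightarrow> 'm" where
  "unit_vec i a = (SOME x. x \<in> G i \<and> (\<forall>a'. \<phi> i x a' = (if a' = a then 1 else 0)))"

lemma unit_vec:
  assumes "a < h i"
  shows "unit_vec i a \<in> G i" "\<phi> i (unit_vec i a) a' = (if a' = a then 1 else 0)"
proof -
  have "\<exists>x\<in>G i. \<phi> i x = (\<lambda>a'. if a' = a then 1 else 0)"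
    using assms by (intro \<phi>_surj) (auto split: if_splits)
  then have "\<exists>x. x \<in> G i \<and> (\<forall>a'. \<phi> i x a' = (if a' = a then 1 else 0))" by auto
  from someI_ex[OF this] show "unit_vec i a \<in> G i" "\<phi> i (unit_vec i a) a' = (if a' = a then 1 else 0)"
    unfolding unit_vec_def by blast+
qed

lemma unit_vec_expansion:
  assumes x: "x \<in> G i"
  shows "x = finsum M (\<lambda>a. const (\<phi> i x a) \<odot>\<^bsub>M\<^esub> unit_vec i a) {..<h i}"
proof (rule \<phi>_eqI[OF x])
  have closed: "(\<lambda>a. const (\<phi> i x a) \<odot>\<^bsub>M\<^esub> unit_vec i a) \<in> {..<h i} \<rightarrow> G i"
    using unit_vec const_smult_component by auto
  show "finsum M (\<lambda>a. const (\<phi> i x a) \<odot>\<^bsub>M\<^esub> unit_vec i a) {..<h i} \<in> G i"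
    by (rule finsum_component[OF closed])
  fix a assume a: "a < h i"
  have "\<phi> i (finsum M (\<lambda>a. const (\<phi> i x a) \<odot>\<^bsub>M\<^esub> unit_vec i a) {..<h i}) a
      = (\<Sum>b<h i. if b = a then \<phi> i x a else 0)"
    unfolding \<phi>_finsum[OF closed] by (intro sum.cong) (auto simp: \<phi>_smult unit_vec)
  then show "\<phi> i x a = \<phi> i (finsum M (\<lambda>a. const (\<phi> i x a) \<odot>\<^bsub>M\<^esub> unit_vec i a) {..<h i}) a"
    using a by simp
qed

definition entry :: "'n \<Rightarrow> int \<Rightarrow> nat \<Rightarrow> nat \<Rightarrow> 'k" where
  "entry j i b a = \<phi> (i + 1) (var j \<odot>\<^bsub>M\<^esub> unit_vec i a) b"

lemma var_component: "x \<in> G i \<Longrightarrow> var j \<odot>\<^bsub>M\<^esub> x \<in> G (i + 1)"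
  using smult_component[OF var_homogeneous] by (metis add.commute)

lemma \<phi>_var:
  assumes x: "x \<in> G i"
  shows "\<phi> (i + 1) (var j \<odot>\<^bsub>M\<^esub> x) b = (\<Sum>a<h i. entry j i b a * \<phi> i x a)"
proof -
  have u: "unit_vec i a \<in> carrier M" if "a < h i" for a using unit_vec(1)[OF that] by (rule component_carrier)
  have "var j \<odot>\<^bsub>M\<^esub> x = finsum M (\<lambda>a. var j \<odot>\<^bsub>M\<^esub> (const (\<phi> i x a) \<odot>\<^bsub>M\<^esub> unit_vec i a)) {..<h i}"
    by (subst unit_vec_expansion[OF x], rule smult_finsum) (use u in auto)
  also have "\<dots> = finsum M (\<lambda>a. const (\<phi> i x a) \<odot>\<^bsub>M\<^esub> (var j \<odot>\<^bsub>M\<^esub> unit_vec i a)) {..<h i}"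
    using u by (intro M.finsum_cong') (auto simp: smult_commute[of _ "var j"])
  finally have eq: "var j \<odot>\<^bsub>M\<^esub> x = finsum M (\<lambda>a. const (\<phi> i x a) \<odot>\<^bsub>M\<^esub> (var j \<odot>\<^bsub>M\<^esub> unit_vec i a)) {..<h i}" .
  have closed: "(\<lambda>a. const (\<phi> i x a) \<odot>\<^bsub>M\<^esub> (var j \<odot>\<^bsub>M\<^esub> unit_vec i a)) \<in> {..<h i} \<rightarrow> G (i + 1)"
    using unit_vec var_component const_smult_component by auto
  show ?thesis
    unfolding eq \<phi>_finsum[OF closed]
    using unit_vec(1) var_component by (intro sum.cong) (auto simp: \<phi>_smult entry_def)
qed

text \<open>The coordinates of all components at once. Elements of a regular sequence need not be
  homogeneous, so they act on the whole module only; since an element has finitely many components,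
  the image consists of the finitely supported functions in \<open>total_space\<close>.\<close>

definition total :: "'m \<Rightarrow> int \<times> nat \<Rightarrow> 'k" where
  "total x y = \<phi> (fst y) (comp x (fst y)) (snd y)"

definition total_space :: "(int \<times> nat \<Rightarrow> 'k) set" where
  "total_space = {v. finite {y. v y \<noteq> 0} \<and> (\<forall>y. v y \<noteq> 0 \<longrightarrow> snd y < h (fst y))}"

abbreviation "op \<equiv> coord_op h entry"

lemma total_add: "x \<in> carrier M \<Longrightarrow> y \<in> carrier M \<Longrightarrow> total (x \<oplus>\<^bsub>M\<^esub> y) = total x + total y"
  by (auto simp: total_def fun_eq_iff comp_add \<phi>_add comp_properties(1))

lemma total_zero: "total \<zero>\<^bsub>M\<^esub> = 0"
  by (auto simp: total_def fun_eq_iff)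

lemma total_inj: "inj_on total (carrier M)"
proof (rule inj_onI)
  fix x y assume x: "x \<in> carrier M" and y: "y \<in> carrier M" and eq: "total x = total y"
  have c: "comp x i = comp y i" for i
  proof (rule \<phi>_eqI[OF comp_properties(1)[OF x] comp_properties(1)[OF y]])
    show "\<phi> i (comp x i) a = \<phi> i (comp y i) a" for a
      using fun_cong[OF eq, of "(i, a)"] by (simp add: total_def)
  qed
  then have "comp y = comp x" by (intro ext) simp
  then show "x = y"
    using comp_properties(3)[OF x] comp_properties(3)[OF y] by simp
qed

lemma total_image: "total ` carrier M = total_space"
proof safe
  fix x assume x: "x \<in> carrier M"
  have supp: "a < h i" if "\<phi> i (comp x i) a \<noteq> 0" for i a
    using \<phi>_support[OF comp_properties(1)[OF x]] that by blast
  then have "{y. total x y \<noteq> 0} \<subseteq> Sigma {i. comp x i \<noteq> \<zero>\<^bsub>M\<^esub>} (\<lambda>i. {..<h i})"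
    by (auto simp: total_def)
  moreover have "finite (Sigma {i. comp x i \<noteq> \<zero>\<^bsub>M\<^esub>} (\<lambda>i. {..<h i}))"
    using comp_properties(2)[OF x] by auto
  ultimately show "total x \<in> total_space"
    using supp finite_subset by (auto simp: total_space_def total_def)
next
  fix v assume v: "v \<in> total_space"
  have "\<exists>x\<in>G i. \<phi> i x = (\<lambda>a. v (i, a))" for i
    using v by (intro \<phi>_surj) (auto simp: total_space_def)
  then obtain c where c: "\<And>i. c i \<in> G i" "\<And>i. \<phi> i (c i) = (\<lambda>a. v (i, a))" by metis
  define F where "F = fst ` {y. v y \<noteq> 0}"
  have finF: "finite F" using v by (simp add: F_def total_space_def)
  have c0: "c i = \<zero>\<^bsub>M\<^esub>" if "i \<notin> F" for i
  proof (rule \<phi>_eqI[OF c(1)])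
    show "\<phi> i (c i) a = \<phi> i \<zero>\<^bsub>M\<^esub> a" for a using that by (force simp: c(2) F_def)
  qed simp
  have "comp (finsum M c F) = c"
    using c(1) finF c0 by (intro comp_unique[of _ F]) auto
  then have "total (finsum M c F) = v"
    by (auto simp: total_def c(2))
  moreover have "finsum M c F \<in> carrier M" using component_carrier[OF c(1)] by (intro M.finsum_closed) auto
  ultimately show "v \<in> total ` carrier M" by blast
qed

lemma op_total:
  assumes x: "x \<in> carrier M"
  shows "op j (total x) = total (var j \<odot>\<^bsub>M\<^esub> x)"
proof
  fix y :: "int \<times> nat"
  have "total (var j \<odot>\<^bsub>M\<^esub> x) y = \<phi> (fst y) (var j \<odot>\<^bsub>M\<^esub> comp x (fst y - 1)) (snd y)"
    by (simp add: total_def comp_smult[OF var_homogeneous x])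
  also have "\<dots> = (\<Sum>a<h (fst y - 1). entry j (fst y - 1) (snd y) a * total x (fst y - 1, a))"
    using \<phi>_var[OF comp_properties(1)[OF x, of "fst y - 1"]] by (simp add: total_def)
  finally show "op j (total x) y = total (var j \<odot>\<^bsub>M\<^esub> x) y"
    using \<phi>_support[OF var_component[OF comp_properties(1)[OF x, of "fst y - 1"]], of "snd y" j]
    by (auto simp: coord_op_def total_def comp_smult[OF var_homogeneous x])
qed

lemma koszul_op: "koszul op \<nu>"
proof
  show "op j (u + v) = op j u + op j v" for j u v by (rule coord_op_add)
  show "inj \<nu>" by (rule inj_\<nu>)
  show "op j (op k v) = op k (op j v)" for j k v
  proof
    fix y :: "int \<times> nat"
    \<comment> \<open>\<open>op\<close> acts on all functions, whereas commutation is inherited from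
      the module, hence from finitely supported ones. The value at \<open>y\<close> depends on
      \<open>v\<close> only two degrees lower, so \<open>v\<close> may be cut down to that
      degree.\<close>
    define w where "w x = (if fst x = fst y - 1 - 1 \<and> snd x < h (fst x) then v x else 0)" for x
    have "{x. w x \<noteq> 0} \<subseteq> {fst y - 1 - 1} \<times> {..<h (fst y - 1 - 1)}" by (auto simp: w_def)
    then have "finite {x. w x \<noteq> 0}" by (rule finite_subset) simp
    then have "w \<in> total_space" by (auto simp: total_space_def w_def)
    then obtain x where x: "x \<in> carrier M" "w = total x" using total_image by blast
    have "op j (op k v) y = op j (op k w) y" for j k
      by (simp add: coord_op_def w_def)
    moreover have "op j (op k w) = op k (op j w)"
      using x by (simp add: op_total smult_commute[of x "var j"])
    ultimately show "op j (op k v) y = op k (op j v) y" by metis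
  qed
qed

sublocale koszul op \<nu> by (rule koszul_op)

lemma additive_subgrp_image:
  assumes "submodule class_ring U M"
  shows "additive_subgrp (total ` U)"
proof -
  have U: "U \<subseteq> carrier M" "\<And>x y. x \<in> U \<Longrightarrow> y \<in> U \<Longrightarrow> x \<oplus>\<^bsub>M\<^esub> y \<in> U" "\<zero>\<^bsub>M\<^esub> \<in> U" "\<And>f x. x \<in> U \<Longrightarrow> f \<odot>\<^bsub>M\<^esub> x \<in> U"
    using assms by (simp_all add: submodule_def)
  have "total x - total y \<in> total ` U" if "x \<in> U" "y \<in> U" for x y
  proof -
    define z where "z = (- 1) \<odot>\<^bsub>M\<^esub> y"
    have z: "z \<in> U" "z \<in> carrier M" "y \<in> carrier M" "x \<in> carrier M" using that U by (auto simp: z_def)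
    have "y \<oplus>\<^bsub>M\<^esub> z = \<zero>\<^bsub>M\<^esub>"
      using smult_poly(1)[of y 1 "-1"] z by (simp add: z_def smult_poly(3,4))
    then have "total y + total z = 0" using total_add[of y z] z total_zero by simp
    then have "total x - total y = total (x \<oplus>\<^bsub>M\<^esub> z)"
      using z by (simp add: total_add) (metis add.commute add_diff_cancel_left' diff_add_cancel eq_neg_iff_add_eq_0 diff_conv_add_uminus)
    then show ?thesis using that z U(2) by blast
  qed
  moreover have "0 \<in> total ` U" using U(3) total_zero by (metis image_eqI)
  ultimately show ?thesis by (auto simp: additive_subgrp_def)
qed

lemma additive_subgrp_total_space: "additive_subgrp total_space"
  unfolding total_image[symmetric]
  by (rule additive_subgrp_image) (use module_axioms in \<open>auto simp: submodule_def\<close>)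

text \<open>Downward induction on \<open>s\<close>: for the quotient by the whole sequence nothing
  is claimed, and \<open>exact_at_lift\<close> gains one cochain degree each time an element of the
  sequence is taken back. The families are constant, so the degree \<open>i\<close> is a
  dummy.\<close>

lemma exact_at_regular_sequence:
  assumes fs: "set fs \<subseteq> irrelevant_ideal" "regular_sequence M fs"
    and "s \<le> length fs" "q < length fs - s"
  shows "exact_at q (\<lambda>_. total_space) (\<lambda>_. total ` ideal_times (take s fs) M) i"
  using assms(3,4)
proof (induction s arbitrary: q i rule: inc_induct)
  case (step s)
  define f where "f = fs ! s"
  define U where "U = ideal_times (take s fs) M"
  have U: "U \<subseteq> carrier M" and U': "\<And>f x. x \<in> U \<Longrightarrow> f \<odot>\<^bsub>M\<^esub> x \<in> U"
    using ideal_times_subset ideal_times_closed(3) by (auto simp: U_def)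
  have "f \<in> irrelevant_ideal" using fs(1) step.hyps by (auto simp: f_def)
  then obtain g where g: "f = (\<Sum>j\<in>UNIV. g j * var j)" using irrelevant_ideal_sum by blast
  \<comment> \<open>Polynomials act on coordinates through the inverse of \<open>total\<close>.
    Outside \<open>total_space\<close> this action is arbitrary, which is why
    \<open>exact_at_lift\<close> asks for its properties on \<open>V\<close> alone.\<close>
  define pre where "pre v = inv_into (carrier M) total v" for v
  have pre: "pre (total x) = x" if "x \<in> carrier M" for x
    using that total_inj by (simp add: pre_def)
  have VD: "\<exists>x\<in>carrier M. v = total x" if "v \<in> total_space" for v
    using that total_image by blast
  have VI: "total x \<in> total_space" if "x \<in> carrier M" for x
    using that total_image by blast
  define act where "act f v = total (f \<odot>\<^bsub>M\<^esub> pre v)" for f v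
  have act: "act f (total x) = total (f \<odot>\<^bsub>M\<^esub> x)" if "x \<in> carrier M" for f x
    using that by (simp add: act_def pre)
  have act_sum: "act (sum k A) v = (\<Sum>j\<in>A. act (k j) v)" if "v \<in> total_space" for k :: "'n \<Rightarrow> _" and A v
    using VD[OF that]
    by (induction A rule: infinite_finite_induct) (auto simp: act total_add smult_poly total_zero)
  show ?case
    unfolding U_def[symmetric]
  proof (rule exact_at_lift[where F = "act f" and G = "\<lambda>j. act (g j)"])
    show "additive_subgrp total_space" by (rule additive_subgrp_total_space)
    show "additive_subgrp (total ` U)" unfolding U_def by (intro additive_subgrp_image ideal_times_submodule)
    show "total ` U \<subseteq> total_space" using U total_image by blast
    show "op j v \<in> total_space" if "v \<in> total_space" for j v
      using VD[OF that] by (auto simp: op_total VI)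
    show "op j v \<in> total ` U" if "v \<in> total ` U" for j v
      using that U U' by (auto simp: op_total subset_iff)
    show "act (g j) v \<in> total_space" if "v \<in> total_space" for j v
      using VD[OF that] by (auto simp: act VI)
    show "act (g j) v \<in> total ` U" if "v \<in> total ` U" for j v
      using that U U' by (auto simp: act subset_iff)
    show "act (g j) (u + v) = act (g j) u + act (g j) v" if "u \<in> total_space" "v \<in> total_space" for j u v
      using VD[OF that(1)] VD[OF that(2)] by (auto simp: act smult_poly(5) simp flip: total_add)
    show "act (g j) (op k v) = op k (act (g j) v)" if "v \<in> total_space" for j k v
      using VD[OF that] by (auto simp: act op_total smult_commute[of _ "g j" "var k"])
    show "act f v = (\<Sum>j\<in>UNIV. act (g j) (op j v))" if v: "v \<in> total_space" for v
    proof -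
      obtain x where x: "x \<in> carrier M" "v = total x" using VD[OF v] by blast
      have "act f v = (\<Sum>j\<in>UNIV. act (g j * var j) v)" unfolding g by (rule act_sum[OF v])
      then show ?thesis using x by (simp add: act op_total smult_poly(2))
    qed
    show "v \<in> total ` U" if v: "v \<in> total_space" and fv: "act f v \<in> total ` U" for v
    proof -
      obtain x where x: "x \<in> carrier M" "v = total x" using VD[OF v] by blast
      then obtain u where "u \<in> U" "total (f \<odot>\<^bsub>M\<^esub> x) = total u" using fv by (auto simp: act)
      then have "f \<odot>\<^bsub>M\<^esub> x \<in> U" using inj_onD[OF total_inj] x U by (metis smult_in subsetD)
      then have "x \<in> U"
        using fs(2) step.hyps x unfolding regular_sequence_def f_def U_def by blast
      then show ?thesis using x by blast
    qed
    fix q' i assume q': "q' < q"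
    have "take (Suc s) fs = take s fs @ [f]" using step.hyps by (simp add: take_Suc_conv_app_nth f_def)
    then have snoc: "ideal_times (take (Suc s) fs) M = {u \<oplus>\<^bsub>M\<^esub> f \<odot>\<^bsub>M\<^esub> x | u x. u \<in> U \<and> x \<in> carrier M}"
      by (simp add: ideal_times_snoc U_def)
    have sum: "total (u \<oplus>\<^bsub>M\<^esub> f \<odot>\<^bsub>M\<^esub> x) = total u + act f (total x)" if "u \<in> U" "x \<in> carrier M" for u x
      using that U by (simp add: total_add act subset_iff)
    have "total ` ideal_times (take (Suc s) fs) M = {u + act f v | u v. u \<in> total ` U \<and> v \<in> total_space}"
    proof safe
      fix y assume "y \<in> ideal_times (take (Suc s) fs) M"
      then obtain u x where ux: "y = u \<oplus>\<^bsub>M\<^esub> f \<odot>\<^bsub>M\<^esub> x" "u \<in> U" "x \<in> carrier M" unfolding snoc by blast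
      show "\<exists>u v. total y = u + act f v \<and> u \<in> total ` U \<and> v \<in> total_space"
        unfolding ux(1) sum[OF ux(2,3)] using ux VI by blast
    next
      fix u v assume "u \<in> U" "v \<in> total_space"
      moreover obtain x where "x \<in> carrier M" "v = total x" using VD[OF \<open>v \<in> total_space\<close>] by blast
      ultimately show "total u + act f v \<in> total ` ideal_times (take (Suc s) fs) M"
        unfolding snoc using sum by (intro image_eqI[of _ _ "u \<oplus>\<^bsub>M\<^esub> f \<odot>\<^bsub>M\<^esub> x"]) auto
    qed
    then show "exact_at q' (\<lambda>_. total_space) (\<lambda>_. {u + act f v | u v. u \<in> total ` U \<and> v \<in> total_space}) i"
      using step.IH[of q' i] q' step.prems by simp
  qed
qed simp

text \<open>The differential raises the degree by exactly one, so cutting an ungraded solution down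
  to degree \<open>i - 1\<close> leaves a solution for a cochain of degree \<open>i\<close>.\<close>

lemma exact_at_coord_space:
  assumes "set fs \<subseteq> irrelevant_ideal" "regular_sequence M fs" "q < length fs"
  shows "exact_at q (coord_space h) (\<lambda>_. {0}) i"
  unfolding exact_at_def
proof (intro allI impI, elim conjE)
  fix c assume c: "\<forall>T. c T \<in> coord_space h i" and dc: "\<forall>T. card T = Suc q \<longrightarrow> d c T \<in> {0}"
  define cut where "cut i v = (\<lambda>y :: int \<times> nat. if fst y = i then v y else 0 :: 'k)" for i v
  have cut_op: "op j (cut i v) = cut (i + 1) (op j v)" for j i v
    by (auto simp: coord_op_def cut_def fun_eq_iff)
  have cut_wedge: "wedge j (\<lambda>T. cut i (b T)) T = cut i (wedge j b T)" for j i b T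
    by (auto simp: wedge_def cut_def sgn_pow_def fun_eq_iff)
  have cut_d: "d (\<lambda>T. cut i (b T)) T = cut (i + 1) (d b T)" for i b T
    unfolding d_def cut_wedge cut_op by (auto simp: cut_def fun_eq_iff sum_fun_apply)
  have "coord_space h i \<subseteq> total_space"
  proof
    fix v :: "int \<times> nat \<Rightarrow> 'k" assume v: "v \<in> coord_space h i"
    then have "{y. v y \<noteq> 0} \<subseteq> {i} \<times> {..<h i}" by (auto simp: coord_space_def)
    then have "finite {y. v y \<noteq> 0}" by (rule finite_subset) simp
    then show "v \<in> total_space" using v unfolding coord_space_def total_space_def by blast
  qed
  then have "c T \<in> total_space" for T using c by blast
  moreover have "exact_at q (\<lambda>_. total_space) (\<lambda>_. {0}) i"
    using exact_at_regular_sequence[OF assms(1,2), of 0 q i] assms(3) by (simp add: ideal_times_Nil total_zero)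
  ultimately obtain b where b: "\<And>T. b T \<in> total_space" "\<And>T. card T = q \<Longrightarrow> c T - d b T \<in> {0}"
    using exact_atD[of q "\<lambda>_. total_space" "\<lambda>_. {0}" i c] dc by metis
  have "cut (i - 1) (b T) \<in> coord_space h (i - 1)" for T
    using b(1)[of T] by (auto simp: cut_def coord_space_def total_space_def split: if_splits)
  moreover have "c T - d (\<lambda>T. cut (i - 1) (b T)) T \<in> {0}" if "card T = q" for T
  proof -
    have "cut i (c T) = c T"
      using c by (fastforce simp: cut_def coord_space_def fun_eq_iff)
    moreover have "c T = d b T" using b(2)[OF that] by simp
    ultimately show ?thesis using cut_d[of "i - 1" b T] by simp
  qed
  ultimately show "\<exists>b. (\<forall>T. b T \<in> coord_space h (i - 1)) \<and> (\<forall>T. card T = q \<longrightarrow> c T - d b T \<in> {0})"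
    by (intro exI[of _ "\<lambda>T. cut (i - 1) (b T)"]) blast
qed

end

theorem regular_sequence_difference_nonneg:
  fixes M :: "(('n::finite, 'k::field) mpoly, 'm) module"
  assumes "graded_module M G" "finitely_generated M"
    and fs: "set fs \<subseteq> irrelevant_ideal" "regular_sequence M fs"
  shows "0 \<le> (difference ^^ length fs) (\<lambda>i. int (hilbert_function M G i)) i"
proof -
  interpret graded_module M G by fact
  define h where "h i = hilbert_function M G i" for i
  have "\<exists>\<phi>. coordinates (component_space M G i) {..<h i} \<phi>" for i
    unfolding h_def
    by (rule coordinates_exist[OF vectorspace_component component_finite_dimensional(1)[OF assms(2)]]) blast
  then obtain \<phi> where \<phi>: "\<And>i. coordinates (component_space M G i) {..<h i} (\<phi> i)" by metis
  obtain \<nu> :: "'n \<Rightarrow> nat" where \<nu>: "inj \<nu>"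
    using finite_imp_inj_to_nat_seg[of "UNIV :: 'n set"] by auto
  interpret coordinatized_module M G h \<phi> \<nu>
    by unfold_locales (rule \<phi> \<nu>)+
  show ?thesis
    using coord_iterated_difference_nonneg[OF koszul_op exact_at_coord_space[OF fs]] by (simp add: h_def)
qed

section \<open>Numerics of Hilbert series\<close>

text \<open>The series 1/(1 - t) with integer coefficients, given directly and not as a
  quotient.\<close>

definition geom :: "int fps" where "geom = Abs_fps (\<lambda>_. 1)"

lemma geom_inverse: "(1 - fps_X) * geom = 1"
proof (rule fps_ext)
  fix n show "fps_nth ((1 - fps_X) * geom) n = fps_nth 1 n"
    by (cases n) (simp_all add: geom_def left_diff_distrib)
qed

lemma geom_inverse_power:
  "j \<le> q \<Longrightarrow> (1 - fps_X) ^ q * geom ^ j = (1 - fps_X) ^ (q - j)"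
  "q \<le> j \<Longrightarrow> (1 - fps_X) ^ q * geom ^ j = geom ^ (j - q)"
proof -
  have one: "(1 - fps_X) ^ k * geom ^ k = 1" for k
    by (simp add: geom_inverse flip: power_mult_distrib)
  show "(1 - fps_X) ^ q * geom ^ j = (1 - fps_X) ^ (q - j)" if "j \<le> q"
  proof -
    have "(1 - fps_X :: int fps) ^ q = (1 - fps_X) ^ (q - j) * (1 - fps_X) ^ j"
      using that by (simp flip: power_add)
    then show ?thesis by (simp only: mult.assoc one mult_1_right)
  qed
  show "(1 - fps_X) ^ q * geom ^ j = geom ^ (j - q)" if "q \<le> j"
  proof -
    have "geom ^ j = geom ^ q * geom ^ (j - q)" using that by (simp flip: power_add)
    then show ?thesis by (simp only: mult.assoc[symmetric] one mult_1_left)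
  qed
qed

lemma fps_nth_one_minus_X_power:
  "fps_nth ((1 - fps_X :: int fps) ^ m) k = (-1) ^ k * int (m choose k)"
proof (induction m arbitrary: k)
  case 0
  then show ?case by (cases k) simp_all
next
  case (Suc m)
  show ?case
    by (cases k) (simp_all add: left_diff_distrib Suc algebra_simps)
qed

text \<open>Vanishing in negative degrees makes the generating function a power series;
  \<open>difference\<close> preserves this and multiplies the series by 1 - t.\<close>

lemma difference_fps:
  assumes "\<And>i. i < 0 \<Longrightarrow> h i = 0"
  shows "(difference ^^ r) h (int n) = fps_nth ((1 - fps_X) ^ r * Abs_fps (\<lambda>n. h (int n))) n"
  using assms
proof (induction r arbitrary: h)
  case (Suc r)
  have "(difference ^^ Suc r) h (int n) = (difference ^^ r) (difference h) (int n)"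
    by (simp add: funpow_swap1)
  also have "\<dots> = fps_nth ((1 - fps_X) ^ r * Abs_fps (\<lambda>n. difference h (int n))) n"
    using Suc.prems by (intro Suc.IH) (simp add: difference_def)
  also have "Abs_fps (\<lambda>n. difference h (int n)) = (1 - fps_X) * Abs_fps (\<lambda>n. h (int n))"
  proof (rule fps_ext)
    fix k show "fps_nth (Abs_fps (\<lambda>n. difference h (int n))) k = fps_nth ((1 - fps_X) * Abs_fps (\<lambda>n. h (int n))) k"
      using Suc.prems[of "-1"] by (cases k) (simp_all add: difference_def left_diff_distrib)
  qed
  finally show ?case by (simp add: mult_ac)
qed simp

section \<open>Sums of powers of t/(1 - t) and their numerators\<close>

definition alpha_series :: "nat \<Rightarrow> (nat \<Rightarrow> nat) \<Rightarrow> int fps" where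
  "alpha_series N \<alpha> = (\<Sum>j\<le>N. of_nat (\<alpha> j) * (fps_X * geom) ^ j)"

definition beta_sum :: "(nat \<Rightarrow> nat) \<Rightarrow> nat \<Rightarrow> nat \<Rightarrow> int" where
  "beta_sum \<alpha> q k = (\<Sum>j=0..k. (-1) ^ (k - j) * int ((q - j) choose (k - j)) * int (\<alpha> j))"

lemma fps_nth_of_nat_mult: "fps_nth (of_nat m * f) k = int m * fps_nth (f :: int fps) k"
  by (simp flip: fps_of_nat)

text \<open>For \<open>j \<le> q\<close> the denominator cancels and leaves t^j (1 - t)^(q - j); for
  \<open>j > q\<close> the factor t^j leaves no coefficient at any index
  \<open>k \<le> q\<close>.\<close>

lemma fps_nth_alpha_term:
  assumes "k \<le> q"
  shows "fps_nth ((1 - fps_X) ^ q * (fps_X * geom) ^ j) k =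
    (if j \<le> k then (-1) ^ (k - j) * int ((q - j) choose (k - j)) else 0)"
proof (cases "j \<le> q")
  case True
  have "(1 - fps_X) ^ q * (fps_X * geom) ^ j = fps_X ^ j * ((1 - fps_X) ^ q * geom ^ j)"
    by (simp add: power_mult_distrib mult_ac)
  also have "\<dots> = fps_X ^ j * (1 - fps_X) ^ (q - j)"
    by (simp only: geom_inverse_power(1)[OF True])
  finally have eq: "(1 - fps_X) ^ q * (fps_X * geom) ^ j = fps_X ^ j * (1 - fps_X) ^ (q - j)" .
  show ?thesis
    unfolding eq fps_X_power_mult_nth fps_nth_one_minus_X_power by simp
next
  case False
  have eq: "(1 - fps_X) ^ q * (fps_X * geom) ^ j = fps_X ^ j * ((1 - fps_X) ^ q * geom ^ j)"
    by (simp add: power_mult_distrib mult_ac)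
  show ?thesis
    unfolding eq fps_X_power_mult_nth using False assms by simp
qed

lemma fps_nth_alpha_series:
  assumes "k \<le> q" "\<And>j. j > N \<Longrightarrow> \<alpha> j = 0"
  shows "fps_nth ((1 - fps_X) ^ q * alpha_series N \<alpha>) k = beta_sum \<alpha> q k"
proof -
  have "fps_nth ((1 - fps_X) ^ q * alpha_series N \<alpha>) k
      = (\<Sum>j\<le>N. int (\<alpha> j) * fps_nth ((1 - fps_X) ^ q * (fps_X * geom) ^ j) k)"
    unfolding alpha_series_def sum_distrib_left fps_sum_nth
    by (intro sum.cong refl) (simp add: mult.left_commute[of _ "of_nat _"] fps_nth_of_nat_mult)
  also have "\<dots> = (\<Sum>j\<in>{..N} \<inter> {..k}. (-1) ^ (k - j) * int ((q - j) choose (k - j)) * int (\<alpha> j))"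
    unfolding sum.inter_restrict[OF finite_atMost] by (intro sum.cong refl) (simp add: fps_nth_alpha_term[OF assms(1)])
  also have "\<dots> = (\<Sum>j=0..k. (-1) ^ (k - j) * int ((q - j) choose (k - j)) * int (\<alpha> j))"
    by (rule sum.mono_neutral_left) (auto simp: assms(2))
  finally show ?thesis by (simp add: beta_sum_def)
qed

text \<open>If \<open>r > N\<close>, multiplying the series by (1 - t)^(r - 1) gives a polynomial P.
  Nonnegative coefficients of (1 - t) P mean that the coefficients of P do not decrease; they start
  at a nonnegative value and end at zero, so P vanishes.\<close>

lemma alpha_series_bound:
  assumes nonneg: "\<And>k. 0 \<le> fps_nth ((1 - fps_X) ^ r * alpha_series N \<alpha>) k"
    and nz: "alpha_series N \<alpha> \<noteq> 0"
  shows "r \<le> N"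
proof (rule ccontr)
  assume "\<not> r \<le> N"
  then obtain r' where r': "r = Suc r'" "N \<le> r'" by (cases r) auto
  define P where "P = (1 - fps_X) ^ r' * alpha_series N \<alpha>"
  have mono: "fps_nth P k \<le> fps_nth P (Suc k)" for k
    using nonneg[of "Suc k"] by (simp add: r' P_def[symmetric] mult.assoc left_diff_distrib)
  have start: "0 \<le> fps_nth P 0"
    using nonneg[of 0] by (simp add: r' P_def[symmetric] mult.assoc)
  have P: "P = (\<Sum>j\<le>N. of_nat (\<alpha> j) * (fps_X ^ j * (1 - fps_X) ^ (r' - j)))"
    unfolding P_def alpha_series_def sum_distrib_left
  proof (intro sum.cong refl)
    fix j assume "j \<in> {..N}"
    then have "(1 - fps_X) ^ r' * geom ^ j = (1 - fps_X) ^ (r' - j)"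
      using r' by (intro geom_inverse_power) auto
    then show "(1 - fps_X) ^ r' * (of_nat (\<alpha> j) * (fps_X * geom) ^ j) = of_nat (\<alpha> j) * (fps_X ^ j * (1 - fps_X) ^ (r' - j))"
      by (simp add: power_mult_distrib mult_ac)
  qed
  have zero: "fps_nth P k = 0" if "k > r'" for k
    unfolding P fps_sum_nth
  proof (rule sum.neutral, rule ballI)
    fix j assume "j \<in> {..N}"
    then have "r' - j < k - j" using that r' by auto
    then show "fps_nth (of_nat (\<alpha> j) * (fps_X ^ j * (1 - fps_X) ^ (r' - j)) :: int fps) k = 0"
      unfolding fps_nth_of_nat_mult fps_X_power_mult_nth fps_nth_one_minus_X_power by (simp add: binomial_eq_0)
  qed
  have "fps_nth P k = 0" for k
  proof -
    have "fps_nth P 0 \<le> fps_nth P k" "fps_nth P k \<le> fps_nth P (k + Suc r')"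
      using mono by (auto intro: lift_Suc_mono_le)
    then show ?thesis using start zero[of "k + Suc r'"] by simp
  qed
  then have "P = 0" by (intro fps_ext) simp
  moreover have "alpha_series N \<alpha> = geom ^ r' * P"
    using geom_inverse_power(1)[of r' r'] by (simp add: P_def mult_ac)
  ultimately show False using nz by simp
qed

text \<open>The terms with \<open>j \<le> q\<close> are brought over the denominator (1 - t)^q. The
  numerator has degree at most \<open>q\<close>, and its coefficients are the beta numbers, which up
  to index \<open>q\<close> do not involve the remaining \<open>\<alpha> j\<close>.\<close>

lemma alpha_series_decomposition:
  assumes "q \<le> N" "\<And>j. j > N \<Longrightarrow> \<alpha> j = 0"
  shows "alpha_series N \<alpha> =
    (\<Sum>k\<le>q. of_int (beta_sum \<alpha> q k) * (fps_X ^ k * geom ^ q)) + (\<Sum>j\<in>{q<..N}. of_nat (\<alpha> j) * (fps_X ^ j * geom ^ j))"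
proof -
  define \<alpha>' where "\<alpha>' j = (if j \<le> q then \<alpha> j else 0)" for j
  define R where "R = (1 - fps_X) ^ q * alpha_series q \<alpha>'"
  have R: "R = (\<Sum>k\<le>q. of_int (beta_sum \<alpha> q k) * fps_X ^ k)"
  proof (rule fps_ext)
    fix k
    have "fps_nth (\<Sum>k\<le>q. of_int (beta_sum \<alpha> q k) * fps_X ^ k) k = (\<Sum>i\<le>q. if k = i then beta_sum \<alpha> q i else 0)"
      unfolding fps_sum_nth by (intro sum.cong refl) (simp flip: fps_of_int)
    also have "\<dots> = (if k \<le> q then beta_sum \<alpha> q k else 0)" by simp
    also have "\<dots> = fps_nth R k"
    proof (cases "k \<le> q")
      case True
      then have "fps_nth R k = beta_sum \<alpha>' q k"
        unfolding R_def by (intro fps_nth_alpha_series) (auto simp: \<alpha>'_def)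
      also have "\<dots> = beta_sum \<alpha> q k"
        unfolding beta_sum_def using True by (intro sum.cong) (auto simp: \<alpha>'_def)
      finally show ?thesis using True by simp
    next
      case False
      have "fps_nth ((1 - fps_X) ^ q * (of_nat (\<alpha>' j) * (fps_X * geom) ^ j)) k = 0" if "j \<le> q" for j
      proof -
        have "(1 - fps_X) ^ q * (of_nat (\<alpha>' j) * (fps_X * geom) ^ j) = of_nat (\<alpha>' j) * (fps_X ^ j * ((1 - fps_X) ^ q * geom ^ j))"
          by (simp add: power_mult_distrib mult_ac)
        also have "\<dots> = of_nat (\<alpha>' j) * (fps_X ^ j * (1 - fps_X) ^ (q - j))"
          by (simp only: geom_inverse_power(1)[OF that])
        finally have eq: "(1 - fps_X) ^ q * (of_nat (\<alpha>' j) * (fps_X * geom) ^ j) = of_nat (\<alpha>' j) * (fps_X ^ j * (1 - fps_X) ^ (q - j))" .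
        show ?thesis
          using False that
          unfolding eq fps_nth_of_nat_mult fps_X_power_mult_nth fps_nth_one_minus_X_power by (simp add: binomial_eq_0)
      qed
      then show ?thesis using False by (simp add: R_def alpha_series_def sum_distrib_left fps_sum_nth)
    qed
    finally show "fps_nth R k = fps_nth (\<Sum>k\<le>q. of_int (beta_sum \<alpha> q k) * fps_X ^ k) k" by simp
  qed
  have "alpha_series N \<alpha> = (\<Sum>j\<in>{..q} \<union> {q<..N}. of_nat (\<alpha> j) * (fps_X * geom) ^ j)"
    unfolding alpha_series_def using assms(1) by (intro sum.cong) auto
  also have "\<dots> = (\<Sum>j\<le>q. of_nat (\<alpha> j) * (fps_X * geom) ^ j) + (\<Sum>j\<in>{q<..N}. of_nat (\<alpha> j) * (fps_X ^ j * geom ^ j))"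
    by (subst sum.union_disjoint) (auto simp: power_mult_distrib)
  also have "(\<Sum>j\<le>q. of_nat (\<alpha> j) * (fps_X * geom) ^ j) = alpha_series q \<alpha>'"
    unfolding alpha_series_def by (intro sum.cong) (auto simp: \<alpha>'_def)
  also have "\<dots> = geom ^ q * R"
    using geom_inverse_power(1)[of q q] by (simp add: R_def mult_ac)
  also have "\<dots> = (\<Sum>k\<le>q. of_int (beta_sum \<alpha> q k) * (fps_X ^ k * geom ^ q))"
    unfolding R sum_distrib_left by (intro sum.cong) (simp_all add: mult_ac)
  finally show ?thesis .
qed

text \<open>The generating function is a product over the variables in \<open>S\<close>, with one
  factor for the admissible exponents \<open>A\<close> of each. Allowing all exponents gives the
  monomials in the variables of \<open>S\<close>, allowing the positive ones those with support
  exactly \<open>S\<close>.\<close>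

lemma card_exponents:
  fixes S :: "'n::finite set" and A :: "nat set"
  shows "int (card {e. (\<forall>x\<in>S. e x \<in> A) \<and> (\<forall>x. x \<notin> S \<longrightarrow> e x = 0) \<and> (\<Sum>x\<in>UNIV. e x) = i}) =
    fps_nth (Abs_fps (\<lambda>k. if k \<in> A then 1 else 0) ^ card S) i" (is "int (card (?E S i)) = _")
proof -
  have fin: "finite (?E S i)" for S :: "'n set" and i
  proof (rule finite_subset)
    show "?E S i \<subseteq> PiE UNIV (\<lambda>_. {..i})"
    proof (intro subsetI PiE_I)
      fix e x assume "e \<in> ?E S i"
      then show "e x \<in> {..i}" using member_le_sum[of x UNIV e] by simp
    qed simp
  qed (simp add: finite_PiE)
  have "finite S" by simp
  then show ?thesis
  proof (induction S arbitrary: i rule: finite_induct)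
    case empty
    have "?E {} i = (if i = 0 then {\<lambda>_. 0} else {})" by (auto simp: fun_eq_iff)
    then show ?case by simp
  next
    case (insert y S)
    \<comment> \<open>Split by the exponent \<open>k\<close> of the new variable \<open>y\<close>;
      the other exponents sum to \<open>i - k\<close>, which produces the Cauchy product.\<close>
    have eq: "?E (insert y S) i = (\<Union>k\<in>{..i} \<inter> A. (\<lambda>e. e(y := k)) ` ?E S (i - k))" (is "?L = ?R")
    proof (rule Set.set_eqI, rule iffI)
      fix e assume e: "e \<in> ?L"
      then have sum: "e y + (\<Sum>x\<in>UNIV - {y}. e x) = i" by (simp add: sum.remove[symmetric])
      have "(\<Sum>x\<in>UNIV. (e(y := 0)) x) = (\<Sum>x\<in>UNIV - {y}. e x)"
        by (subst sum.remove[of _ y]) auto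
      then have "e(y := 0) \<in> ?E S (i - e y)"
        using e insert.hyps sum by auto
      moreover have "e y \<in> {..i} \<inter> A" using e sum by auto
      moreover have "e = (e(y := 0))(y := e y)" by simp
      ultimately show "e \<in> ?R" by blast
    next
      fix e assume "e \<in> ?R"
      then obtain k e' where k: "k \<le> i" "k \<in> A" "e' \<in> ?E S (i - k)" "e = e'(y := k)" by auto
      have "(\<Sum>x\<in>UNIV. e x) = k + (\<Sum>x\<in>UNIV - {y}. e' x)"
        unfolding k by (subst sum.remove[of _ y]) auto
      also have "(\<Sum>x\<in>UNIV - {y}. e' x) = (\<Sum>x\<in>UNIV. e' x)"
        using k insert.hyps by (subst (2) sum.remove[of _ y]) auto
      finally show "e \<in> ?L" using k by auto
    qed
    have "card ?R = (\<Sum>k\<in>{..i} \<inter> A. card ((\<lambda>e. e(y := k)) ` ?E S (i - k)))"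
    proof (rule card_UN_disjoint)
      show "\<forall>k\<in>{..i} \<inter> A. finite ((\<lambda>e. e(y := k)) ` ?E S (i - k))" using fin by blast
      show "\<forall>k\<in>{..i} \<inter> A. \<forall>l\<in>{..i} \<inter> A. k \<noteq> l \<longrightarrow>
          (\<lambda>e. e(y := k)) ` ?E S (i - k) \<inter> (\<lambda>e. e(y := l)) ` ?E S (i - l) = {}"
        by (auto simp: fun_eq_iff) metis
    qed simp
    also have "\<dots> = (\<Sum>k\<in>{..i} \<inter> A. card (?E S (i - k)))"
    proof (intro sum.cong refl card_image inj_onI)
      fix k e e' assume "e \<in> ?E S (i - k)" "e' \<in> ?E S (i - k)" "e(y := k) = e'(y := k)"
      moreover have "e y = 0" "e' y = 0" using calculation insert.hyps by auto
      ultimately show "e = e'" by (metis fun_upd_triv fun_upd_upd)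
    qed
    finally have "int (card (?E (insert y S) i)) = (\<Sum>k\<in>{..i} \<inter> A. fps_nth (Abs_fps (\<lambda>k. if k \<in> A then 1 else 0) ^ card S) (i - k))"
      unfolding eq by (simp add: insert.IH)
    also have "\<dots> = (\<Sum>k\<le>i. (if k \<in> A then 1 else 0) * fps_nth (Abs_fps (\<lambda>k. if k \<in> A then 1 else 0) ^ card S) (i - k))"
      unfolding sum.inter_restrict[OF finite_atMost] by (intro sum.cong) auto
    finally show ?case
      using insert.hyps by (simp add: fps_mult_nth atMost_atLeast0)
  qed
qed

lemma card_monomials:
  fixes S :: "'n::finite set"
  shows "int (card {e :: 'n \<Rightarrow>\<^sub>0 nat. keys e \<subseteq> S \<and> monom_degree e = i}) = fps_nth (geom ^ card S) i"
    and "int (card {e :: 'n \<Rightarrow>\<^sub>0 nat. keys e = S \<and> monom_degree e = i}) = fps_nth ((fps_X * geom) ^ card S) i"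
proof -
  have transfer: "card {e :: 'n \<Rightarrow>\<^sub>0 nat. P (lookup e)} = card {e. P e}" for P
  proof (rule bij_betw_same_card[of lookup], rule bij_betw_imageI)
    show "inj_on lookup {e :: 'n \<Rightarrow>\<^sub>0 nat. P (lookup e)}" by (simp add: inj_on_def)
    have "e \<in> lookup ` {e. P (lookup e)}" if "P e" for e :: "'n \<Rightarrow> nat"
      using that by (intro image_eqI[of _ _ "Abs_poly_mapping e"]) simp_all
    then show "lookup ` {e :: 'n \<Rightarrow>\<^sub>0 nat. P (lookup e)} = {e. P e}" by auto
  qed
  have "{e :: 'n \<Rightarrow>\<^sub>0 nat. keys e \<subseteq> S \<and> monom_degree e = i} =
      {e. (\<forall>x\<in>S. lookup e x \<in> UNIV) \<and> (\<forall>x. x \<notin> S \<longrightarrow> lookup e x = 0) \<and> (\<Sum>x\<in>UNIV. lookup e x) = i}"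
    by (auto simp: monom_degree_def in_keys_iff)
  then show "int (card {e :: 'n \<Rightarrow>\<^sub>0 nat. keys e \<subseteq> S \<and> monom_degree e = i}) = fps_nth (geom ^ card S) i"
    using transfer[of "\<lambda>e. (\<forall>x\<in>S. e x \<in> UNIV) \<and> (\<forall>x. x \<notin> S \<longrightarrow> e x = 0) \<and> (\<Sum>x\<in>UNIV. e x) = i"] card_exponents[of S UNIV i]
    by (simp add: geom_def)
  have "{e :: 'n \<Rightarrow>\<^sub>0 nat. keys e = S \<and> monom_degree e = i} =
      {e. (\<forall>x\<in>S. lookup e x \<in> {0<..}) \<and> (\<forall>x. x \<notin> S \<longrightarrow> lookup e x = 0) \<and> (\<Sum>x\<in>UNIV. lookup e x) = i}"
    by (auto simp: monom_degree_def in_keys_iff)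
  moreover have "Abs_fps (\<lambda>k. if k \<in> {0<..} then 1 else 0) = fps_X * geom"
  proof (rule fps_ext)
    fix k show "fps_nth (Abs_fps (\<lambda>k. if k \<in> {0<..} then 1 else 0)) k = fps_nth (fps_X * geom) k"
      by (cases k) (simp_all add: geom_def)
  qed
  ultimately show "int (card {e :: 'n \<Rightarrow>\<^sub>0 nat. keys e = S \<and> monom_degree e = i}) = fps_nth ((fps_X * geom) ^ card S) i"
    using transfer[of "\<lambda>e. (\<forall>x\<in>S. e x \<in> {0<..}) \<and> (\<forall>x. x \<notin> S \<longrightarrow> e x = 0) \<and> (\<Sum>x\<in>UNIV. e x) = i"] card_exponents[of S "{0<..}" i]
    by simp
qed

section \<open>Quotients of squarefree monomial ideals\<close>

lemma genideal_add_mult: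
  fixes A :: "('n::finite, 'k::field) mpoly set"
  shows "f \<in> genideal class_ring A \<Longrightarrow> g \<in> genideal class_ring A \<Longrightarrow> f + g \<in> genideal class_ring A"
    and "f \<in> genideal class_ring A \<Longrightarrow> g * f \<in> genideal class_ring A"
    and "0 \<in> genideal class_ring A"
proof -
  interpret ideal "genideal class_ring A" "class_ring :: ('n, 'k) mpoly ring"
    by (rule ring.genideal_ideal[OF class_ring.ring_axioms]) simp
  show "f \<in> genideal class_ring A \<Longrightarrow> g \<in> genideal class_ring A \<Longrightarrow> f + g \<in> genideal class_ring A"
    using a_closed[of f g] by simp
  show "f \<in> genideal class_ring A \<Longrightarrow> g * f \<in> genideal class_ring A"
    using I_l_closed[of f g] by simp
  show "0 \<in> genideal class_ring A" using zero_closed by simp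
qed

lemma mpoly_in_sum_of_monomials:
  fixes f :: "('n::finite, 'k::field) mpoly"
  assumes "0 \<in> L" "\<And>a b. a \<in> L \<Longrightarrow> b \<in> L \<Longrightarrow> a + b \<in> L"
    and "\<And>e c. e \<in> keys f \<Longrightarrow> single e c \<in> L"
  shows "f \<in> L"
proof -
  have "(\<Sum>e\<in>E. single e (lookup f e)) \<in> L" if "E \<subseteq> keys f" for E
    using finite_subset[OF that finite_keys] that
    by (induction E rule: finite_induct) (auto intro: assms)
  moreover have "(\<Sum>e\<in>keys f. single e (lookup f e)) = f"
    by (rule poly_mapping_eqI) (auto simp: lookup_sum lookup_single' in_keys_iff)
  ultimately show ?thesis by (metis order_refl)
qed

lemma keys_add_nat: "keys (a + b) = keys a \<union> keys (b :: 'n \<Rightarrow>\<^sub>0 nat)"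
  by (auto simp: in_keys_iff lookup_add)

lemma lookup_single_mult:
  "lookup (single a c * f) (a + e) = c * lookup (f :: ('n::finite, 'k::field) mpoly) e"
proof (induction f rule: mpoly_induct)
  case (add_single f e' c')
  then show ?case by (simp add: distrib_left lookup_add mult_single lookup_single')
qed simp

lemma lookup_const_mult: "lookup (const c * f) e = c * lookup f e"
  using lookup_single_mult[of 0 c f e] by (simp add: const_def)

text \<open>A squarefree monomial ideal contains a monomial according to its support alone;
  \<open>P\<close> tells which supports occur.\<close>

definition support_ideal :: "('n::finite set \<Rightarrow> bool) \<Rightarrow> ('n, 'k::field) mpoly set" where
  "support_ideal P = {f. \<forall>e\<in>keys f. P (keys e)}"

text \<open>A squarefree monomial divides another monomial exactly when its support is contained in
  the support of the other, so the generators matter through their supports only.\<close>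

lemma squarefree_monomial_ideal_support:
  fixes I :: "('n::finite, 'k::field) mpoly set"
  assumes "squarefree_monomial_ideal I"
  shows "\<exists>P. mono P \<and> I = support_ideal P"
proof -
  obtain A where A: "A \<subseteq> squarefree_monomials" "I = genideal class_ring A"
    using assms by (auto simp: squarefree_monomial_ideal_def)
  define P where "P S \<longleftrightarrow> (\<exists>a. single a 1 \<in> A \<and> keys a \<subseteq> S)" for S
  have "mono P" unfolding P_def by (intro monoI) (auto simp: le_bool_def)
  moreover have "I = support_ideal P"
  proof
    have "ideal (support_ideal P :: ('n, 'k) mpoly set) class_ring"
    proof (rule ideal_class_ringI)
      show "a + b \<in> support_ideal P" if "a \<in> support_ideal P" "b \<in> support_ideal P" for a b :: "('n, 'k) mpoly"
        using that Poly_Mapping.keys_add[of a b] unfolding support_ideal_def by blast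
      show "c * a \<in> support_ideal P" if "a \<in> support_ideal P" for c a :: "('n, 'k) mpoly"
        unfolding support_ideal_def
      proof (intro CollectI ballI)
        fix e assume "e \<in> keys (c * a)"
        then obtain x y where "e = x + y" "y \<in> keys a"
          using keys_mult[of c a] by auto
        moreover from this have "P (keys y)" using that by (simp add: support_ideal_def)
        ultimately show "P (keys e)"
          using monoD[OF \<open>mono P\<close>, of "keys y" "keys e"]
          by (simp add: keys_add_nat le_bool_def)
      qed
    qed (simp add: support_ideal_def)
    moreover have "A \<subseteq> support_ideal P"
    proof
      fix x assume x: "x \<in> A"
      then obtain e where "x = single e 1" using A(1) by (auto simp: squarefree_monomials_def)
      then show "x \<in> support_ideal P" using x by (auto simp: support_ideal_def P_def)
    qed
    ultimately show "I \<subseteq> support_ideal P"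
      unfolding A by (rule ring.genideal_minimal[OF class_ring.ring_axioms])
    show "support_ideal P \<subseteq> I"
    proof
      fix f :: "('n, 'k) mpoly" assume f: "f \<in> support_ideal P"
      show "f \<in> I"
      proof (rule mpoly_in_sum_of_monomials)
        fix e and c :: 'k assume "e \<in> keys f"
        then obtain a where a: "single a 1 \<in> A" "keys a \<subseteq> keys e"
          using f by (auto simp: support_ideal_def P_def)
        \<comment> \<open>Squarefreeness enters here: the exponents of \<open>a\<close> are at most
          1, so containment of supports is divisibility.\<close>
        have "lookup a i \<le> lookup e i" for i
        proof (cases "i \<in> keys a")
          case True
          have "single a (1 :: 'k) \<in> squarefree_monomials" using a(1) A(1) by blast
          then obtain b where b: "single a (1 :: 'k) = single b 1" "\<forall>i. lookup b i \<le> 1"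
            by (auto simp: squarefree_monomials_def)
          from b(1) have "keys (single a (1 :: 'k)) = keys (single b (1 :: 'k))" by simp
          then have "a = b" by simp
          then have "lookup a i \<le> 1" using b(2) by simp
          moreover have "lookup e i \<noteq> 0"
            using subsetD[OF a(2) True] by (simp only: in_keys_iff not_False_eq_True)
          ultimately show ?thesis by simp
        qed (simp add: in_keys_iff)
        then have "e = (e - a) + a"
          by (intro poly_mapping_eqI) (simp add: lookup_add lookup_minus)
        then have "single e c = single (e - a) c * single a 1"
          by (simp add: mult_single)
        moreover have "single a 1 \<in> I"
          using ring.genideal_self[OF class_ring.ring_axioms, of A] a(1) A(2) by auto
        ultimately show "single e c \<in> I"
          using genideal_add_mult(2) by (simp add: A(2))
      qed (use genideal_add_mult in \<open>auto simp: A(2)\<close>)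
    qed
  qed
  ultimately show ?thesis by blast
qed

definition indicator_exponent :: "'n::finite set \<Rightarrow> ('n \<Rightarrow>\<^sub>0 nat)" where
  "indicator_exponent S = Abs_poly_mapping (\<lambda>i. if i \<in> S then 1 else 0)"

lemma lookup_indicator_exponent: "lookup (indicator_exponent S) i = (if i \<in> S then 1 else 0)"
  by (simp add: indicator_exponent_def)

lemma keys_indicator_exponent [simp]: "keys (indicator_exponent S) = S"
  by (auto simp: in_keys_iff lookup_indicator_exponent split: if_splits)

lemma monom_degree_indicator_exponent [simp]: "monom_degree (indicator_exponent S) = card S"
  by (simp add: monom_degree_def lookup_indicator_exponent sum.If_cases)

lemma alpha_support_ideal:
  "alpha (support_ideal Q) (support_ideal P :: ('n::finite, 'k::field) mpoly set) j = card {S. Q S \<and> \<not> P S \<and> card S = j}"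
proof -
  let ?m = "\<lambda>S. single (indicator_exponent S) (1 :: 'k)"
  have single: "single e (1 :: 'k) \<in> support_ideal R \<longleftrightarrow> R (keys e)" for e R
    by (simp add: support_ideal_def)
  have "{u \<in> squarefree_monomials \<inter> homogeneous_part (int j). u \<in> support_ideal Q - support_ideal P}
      = ?m ` {S. Q S \<and> \<not> P S \<and> card S = j}"
  proof (rule subset_antisym; rule subsetI)
    fix u :: "('n, 'k) mpoly"
    assume u: "u \<in> {u \<in> squarefree_monomials \<inter> homogeneous_part (int j). u \<in> support_ideal Q - support_ideal P}"
    then obtain e where e: "u = single e 1" "\<forall>i. lookup e i \<le> 1"
      by (auto simp: squarefree_monomials_def)
    have eq: "e = indicator_exponent (keys e)"
    proof (rule poly_mapping_eqI)
      fix i show "lookup e i = lookup (indicator_exponent (keys e)) i"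
        using spec[OF e(2), of i] by (auto simp: lookup_indicator_exponent in_keys_iff)
    qed
    have "monom_degree e = j" using u by (auto simp: e(1) homogeneous_part_def)
    then have "card (keys e) = j"
      using monom_degree_indicator_exponent[of "keys e"] by (simp flip: eq)
    then show "u \<in> ?m ` {S. Q S \<and> \<not> P S \<and> card S = j}"
      using u eq by (intro image_eqI[of _ _ "keys e"]) (auto simp: e(1) single)
  qed (auto simp: single squarefree_monomials_def lookup_indicator_exponent homogeneous_part_def)
  moreover have "inj_on ?m {S. Q S \<and> \<not> P S \<and> card S = j}"
  proof (rule inj_onI)
    fix S T assume "?m S = ?m T"
    then have "keys (?m S) = keys (?m T)" by simp
    then have "indicator_exponent S = indicator_exponent T" by simp
    then show "S = T" by (metis keys_indicator_exponent)
  qed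
  ultimately show ?thesis by (simp add: alpha_def card_image)
qed

text \<open>The coefficients at the exponents in \<open>?E\<close> vanish on \<open>I\<close>, hence
  are well defined on cosets, and they determine the coset of a homogeneous element of
  \<open>J\<close>.\<close>

lemma dim_ideal_quotient_component:
  fixes P Q :: "'n::finite set \<Rightarrow> bool"
  defines "I \<equiv> support_ideal P :: ('n, 'k::field) mpoly set" and "J \<equiv> support_ideal Q :: ('n, 'k) mpoly set"
  assumes "I \<subseteq> J"
  shows "hilbert_function (ideal_quotient J I) (ideal_quotient_grading J I) i
    = card {e :: 'n \<Rightarrow>\<^sub>0 nat. int (monom_degree e) = i \<and> Q (keys e) \<and> \<not> P (keys e)}"
    (is "_ = card ?E")
proof -
  let ?V = "component_space (ideal_quotient J I) (ideal_quotient_grading J I) i"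
  let ?H = "J \<inter> homogeneous_part i"
  define coset where "coset f = {h + f | h. h \<in> I}" for f
  have coset_eq: "I +>\<^bsub>ideal_as_module J\<^esub> f = coset f" for f
    by (auto simp: a_r_coset_def' ideal_as_module_def coset_def)
  have I_add: "a + b \<in> I" if "a \<in> I" "b \<in> I" for a b
    using that Poly_Mapping.keys_add[of a b] unfolding I_def support_ideal_def by blast
  have I_minus: "- a \<in> I" if "a \<in> I" for a
    using that unfolding I_def support_ideal_def by simp
  have I_zero: "0 \<in> I" by (simp add: I_def support_ideal_def)
  have lookup_I: "lookup a e = 0" if "a \<in> I" "e \<in> ?E" for a e
    using that unfolding I_def support_ideal_def by (metis (mono_tags, lifting) in_keys_iff mem_Collect_eq)
  have coset_mem: "f \<in> coset f" for f using I_zero by (force simp: coset_def)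
  have coset_cong: "coset f = coset g" if "f - g \<in> I" for f g
  proof -
    have "h + f = (h + (f - g)) + g" "h + g = (h + - (f - g)) + f" for h by simp_all
    then show ?thesis using that I_add I_minus unfolding coset_def by blast
  qed
  have carrier: "carrier ?V = coset ` ?H"
    by (auto simp: component_space_def ideal_quotient_grading_def coset_eq)
  have add: "coset f \<oplus>\<^bsub>?V\<^esub> coset g = coset (f + g)" for f g
  proof -
    have "coset f \<oplus>\<^bsub>?V\<^esub> coset g = {x + y | x y. x \<in> coset f \<and> y \<in> coset g}"
      by (auto simp: component_space_def ideal_quotient_def quotient_module_def set_add_def' ideal_as_module_def)
    also have "\<dots> = coset (f + g)"
    proof (rule subset_antisym; rule subsetI)
      fix z assume "z \<in> {x + y | x y. x \<in> coset f \<and> y \<in> coset g}"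
      then obtain a b where "z = (a + f) + (b + g)" "a \<in> I" "b \<in> I" by (auto simp: coset_def)
      then show "z \<in> coset (f + g)" using I_add[of a b] by (auto simp: coset_def intro!: exI[of _ "a + b"])
    next
      fix z assume "z \<in> coset (f + g)"
      then obtain a where "z = (a + f) + g" "a \<in> I" by (auto simp: coset_def add.assoc)
      then show "z \<in> {x + y | x y. x \<in> coset f \<and> y \<in> coset g}"
        using coset_mem[of g] by (intro CollectI exI[of _ "a + f"] exI[of _ g]) (auto simp: coset_def)
    qed
    finally show ?thesis .
  qed
  have I_mult: "const c * a \<in> I" if "a \<in> I" for c a
    using that keys_mult[of "const c" a] unfolding I_def support_ideal_def const_def by (force split: if_splits)
  have smult: "c \<odot>\<^bsub>?V\<^esub> coset f = coset (const c * f)" for c f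
  proof -
    have "c \<odot>\<^bsub>?V\<^esub> coset f = (\<Union>x\<in>coset f. coset (const c * x))"
      by (simp add: component_space_def ideal_quotient_def quotient_module_def coset_eq)
        (simp add: ideal_as_module_def)
    moreover have "coset (const c * x) = coset (const c * f)" if "x \<in> coset f" for x
      using that I_mult by (intro coset_cong) (auto simp: coset_def algebra_simps)
    moreover have "coset f \<noteq> {}" using coset_mem by blast
    ultimately show ?thesis by (metis (no_types, lifting) SUP_eq_const)
  qed
  have zero: "\<zero>\<^bsub>?V\<^esub> = coset 0"
    by (simp add: component_space_def ideal_quotient_def quotient_module_def coset_def)
  \<comment> \<open>The choice of representative is immaterial, as two representatives of a coset
    differ by an element of \<open>I\<close>.\<close>
  define \<phi> where "\<phi> X e = (if e \<in> ?E then lookup (SOME f. f \<in> X) e else 0)" for X :: "('n, 'k) mpoly set" and e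
  have \<phi>: "\<phi> (coset f) e = (if e \<in> ?E then lookup f e else 0)" for f e
  proof -
    have "(SOME g. g \<in> coset f) \<in> coset f" using coset_mem by (rule someI)
    then obtain h where "h \<in> I" "(SOME g. g \<in> coset f) = h + f" by (auto simp: coset_def)
    then show ?thesis using lookup_I by (simp add: \<phi>_def lookup_add)
  qed
  have H_add: "f + g \<in> ?H" if "f \<in> ?H" "g \<in> ?H" for f g
    using that Poly_Mapping.keys_add[of f g] unfolding J_def support_ideal_def homogeneous_part_def by blast
  have H_smult: "const c * f \<in> ?H" if "f \<in> ?H" for c f
    using that keys_mult[of "const c" f] unfolding J_def support_ideal_def homogeneous_part_def const_def
    by (force split: if_splits)
  have finE: "finite ?E"
    by (rule finite_subset[OF _ finite_monom_degree[of "nat i"]]) auto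
  have "coordinates ?V ?E \<phi>"
    unfolding coordinates_def
  proof (intro conjI ballI allI)
    show "bij_betw \<phi> (carrier ?V) {v. \<forall>e. v e \<noteq> 0 \<longrightarrow> e \<in> ?E}"
    proof (rule bij_betw_imageI)
      show "inj_on \<phi> (carrier ?V)"
      proof (rule inj_onI)
        fix X Y assume "X \<in> carrier ?V" "Y \<in> carrier ?V" and eq: "\<phi> X = \<phi> Y"
        then obtain f g where fg: "X = coset f" "Y = coset g" "f \<in> ?H" "g \<in> ?H" unfolding carrier by blast
        have "f - g \<in> I"
          unfolding I_def support_ideal_def
        proof (intro CollectI ballI)
          fix e assume e: "e \<in> keys (f - g)"
          then have "e \<in> keys f \<union> keys g" using keys_diff[of f g] by blast
          then have "int (monom_degree e) = i" "Q (keys e)"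
            using fg(3,4) by (auto simp: J_def support_ideal_def homogeneous_part_def)
          moreover have "e \<notin> ?E"
            using fun_cong[OF eq, of e] e by (auto simp: fg \<phi> in_keys_iff lookup_minus split: if_splits)
          ultimately show "P (keys e)" by blast
        qed
        then show "X = Y" unfolding fg by (rule coset_cong)
      qed
      show "\<phi> ` carrier ?V = {v. \<forall>e. v e \<noteq> 0 \<longrightarrow> e \<in> ?E}"
      proof (rule subset_antisym; rule subsetI)
        fix v :: "('n \<Rightarrow>\<^sub>0 nat) \<Rightarrow> 'k" assume v: "v \<in> {v. \<forall>e. v e \<noteq> 0 \<longrightarrow> e \<in> ?E}"
        then have "finite {e. v e \<noteq> 0}" by (intro finite_subset[OF _ finE]) auto
        then have lookup: "lookup (Abs_poly_mapping v) = v" by simp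
        then have "Abs_poly_mapping v \<in> ?H"
          using v by (auto simp: J_def support_ideal_def homogeneous_part_def in_keys_iff)
        moreover have "\<phi> (coset (Abs_poly_mapping v)) = v"
          using v by (auto simp: \<phi> lookup fun_eq_iff)
        ultimately show "v \<in> \<phi> ` carrier ?V" unfolding carrier by (metis image_eqI)
      qed (auto simp: \<phi>_def split: if_splits)
    qed
  next
    fix X Y assume "X \<in> carrier ?V" "Y \<in> carrier ?V"
    then show "\<phi> (X \<oplus>\<^bsub>?V\<^esub> Y) = (\<lambda>e. \<phi> X e + \<phi> Y e)"
      unfolding carrier by (auto simp: add \<phi> lookup_add fun_eq_iff)
  next
    fix c X assume "X \<in> carrier ?V"
    then show "\<phi> (c \<odot>\<^bsub>?V\<^esub> X) = (\<lambda>e. c * \<phi> X e)"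
      unfolding carrier by (auto simp: smult \<phi> lookup_const_mult fun_eq_iff)
  qed
  moreover have "vectorspace class_ring ?V"
  proof (rule vectorspace_coordinates[OF calculation])
    show "X \<oplus>\<^bsub>?V\<^esub> Y \<in> carrier ?V" if "X \<in> carrier ?V" "Y \<in> carrier ?V" for X Y
    proof -
      obtain f g where fg: "X = coset f" "Y = coset g" "f \<in> ?H" "g \<in> ?H" using \<open>X \<in> carrier ?V\<close> \<open>Y \<in> carrier ?V\<close> unfolding carrier by blast
      show ?thesis unfolding fg add carrier by (intro imageI H_add fg)
    qed
    show "c \<odot>\<^bsub>?V\<^esub> X \<in> carrier ?V" if "X \<in> carrier ?V" for c X
    proof -
      obtain f where f: "X = coset f" "f \<in> ?H" using \<open>X \<in> carrier ?V\<close> unfolding carrier by blast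
      show ?thesis unfolding f smult carrier by (intro imageI H_smult f)
    qed
    have "0 \<in> ?H" by (simp add: J_def support_ideal_def homogeneous_part_def)
    then show "\<zero>\<^bsub>?V\<^esub> \<in> carrier ?V" unfolding carrier zero by (rule imageI)
    show "\<phi> \<zero>\<^bsub>?V\<^esub> = (\<lambda>_. 0)" unfolding zero by (auto simp: \<phi> fun_eq_iff)
  qed
  ultimately show ?thesis using dim_coordinates finE by blast
qed

text \<open>The monomials of \<open>J\<close> outside \<open>I\<close> are sorted by their support
  \<open>S\<close>; those with one fixed support contribute (t/(1 - t))^|S|, and
  \<open>alpha J I j\<close> counts the supports of size \<open>j\<close>.\<close>

lemma hilbert_function_ideal_quotient:
  fixes I J :: "('n::finite, 'k::field) mpoly set"
  assumes "squarefree_monomial_ideal I" "squarefree_monomial_ideal J" "I \<subset> J"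
  defines "h \<equiv> \<lambda>i. hilbert_function (ideal_quotient J I) (ideal_quotient_grading J I) i"
  shows "i < 0 \<Longrightarrow> h i = 0"
    and "int (h (int k)) = fps_nth (alpha_series CARD('n) (alpha J I)) k"
    and "j > CARD('n) \<Longrightarrow> alpha J I j = 0"
    and "\<exists>i. h i \<noteq> 0"
proof -
  obtain P Q where PQ: "I = support_ideal P" "J = support_ideal Q"
    using squarefree_monomial_ideal_support[OF assms(1)] squarefree_monomial_ideal_support[OF assms(2)] by blast
  have h: "h i = card {e :: 'n \<Rightarrow>\<^sub>0 nat. int (monom_degree e) = i \<and> Q (keys e) \<and> \<not> P (keys e)}" for i
    unfolding h_def PQ by (rule dim_ideal_quotient_component) (use assms(3) in \<open>simp add: PQ psubset_eq\<close>)
  show "h i = 0" if "i < 0" for i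
  proof -
    have "{e :: 'n \<Rightarrow>\<^sub>0 nat. int (monom_degree e) = i \<and> Q (keys e) \<and> \<not> P (keys e)} = {}"
      using that by auto
    then show ?thesis unfolding h by (simp only: card.empty)
  qed
  define \<S> where "\<S> = {S :: 'n set. Q S \<and> \<not> P S}"
  have \<alpha>: "alpha J I j = card {S \<in> \<S>. card S = j}" for j
    unfolding PQ alpha_support_ideal by (rule arg_cong[where f = card]) (auto simp: \<S>_def)
  show "alpha J I j = 0" if "j > CARD('n)" for j
  proof -
    have "{S \<in> \<S>. card S = j} = {}"
      using that by (auto simp: not_le[symmetric] intro: card_mono)
    then show ?thesis unfolding \<alpha> by simp
  qed
  show "int (h (int k)) = fps_nth (alpha_series CARD('n) (alpha J I)) k" for k
  proof -
    have "{e :: 'n \<Rightarrow>\<^sub>0 nat. int (monom_degree e) = int k \<and> Q (keys e) \<and> \<not> P (keys e)}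
        = (\<Union>S\<in>\<S>. {e. keys e = S \<and> monom_degree e = k})"
      by (auto simp: \<S>_def)
    moreover have "card (\<Union>S\<in>\<S>. {e :: 'n \<Rightarrow>\<^sub>0 nat. keys e = S \<and> monom_degree e = k})
        = (\<Sum>S\<in>\<S>. card {e :: 'n \<Rightarrow>\<^sub>0 nat. keys e = S \<and> monom_degree e = k})"
      by (rule card_UN_disjoint) (auto intro: finite_subset[OF _ finite_monom_degree[of k]])
    ultimately have "int (h (int k)) = (\<Sum>S\<in>\<S>. fps_nth ((fps_X * geom) ^ card S) k)"
      by (simp add: h card_monomials(2))
    also have "\<dots> = (\<Sum>j\<le>CARD('n). \<Sum>S\<in>{S \<in> \<S>. card S = j}. fps_nth ((fps_X * geom) ^ card S) k)"
      by (rule sum.group[symmetric]) (auto intro: card_mono)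
    also have "\<dots> = (\<Sum>j\<le>CARD('n). int (alpha J I j) * fps_nth ((fps_X * geom) ^ j) k)"
      by (intro sum.cong refl) (simp add: \<alpha>)
    also have "\<dots> = fps_nth (alpha_series CARD('n) (alpha J I)) k"
      by (simp add: alpha_series_def fps_sum_nth fps_nth_of_nat_mult)
    finally show ?thesis .
  qed
  obtain f where "f \<in> J" "f \<notin> I" using assms(3) by blast
  then obtain e where e: "e \<in> keys f" "\<not> P (keys e)" "Q (keys e)"
    by (auto simp: PQ support_ideal_def)
  have "finite {e' :: 'n \<Rightarrow>\<^sub>0 nat. int (monom_degree e') = int (monom_degree e) \<and> Q (keys e') \<and> \<not> P (keys e')}"
    by (rule finite_subset[OF _ finite_monom_degree[of "monom_degree e"]]) auto
  then have "h (int (monom_degree e)) \<noteq> 0"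
    unfolding h using e by auto
  then show "\<exists>i. h i \<noteq> 0" by blast
qed

section \<open>Sums of shifted polynomial rings\<close>

text \<open>Substitution of 0 for the variables outside \<open>T\<close>, a ring homomorphism onto
  the polynomials in the variables from \<open>T\<close>. Multiplying after it realises the action
  on the quotient ring.\<close>

definition restrict_vars :: "'n::finite set \<Rightarrow> ('n, 'k::field) mpoly \<Rightarrow> ('n, 'k) mpoly" where
  "restrict_vars T f = Abs_poly_mapping (\<lambda>e. if keys e \<subseteq> T then lookup f e else 0)"

lemma lookup_restrict_vars:
  "lookup (restrict_vars T f) e = (if keys e \<subseteq> T then lookup f e else 0)"
proof -
  have "finite {e. (if keys e \<subseteq> T then lookup f e else 0) \<noteq> 0}"
    by (rule finite_subset[OF _ finite_lookup[of f]]) auto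
  then show ?thesis by (simp add: restrict_vars_def)
qed

lemma keys_restrict_vars: "keys (restrict_vars T f) = {e \<in> keys f. keys e \<subseteq> T}"
  by (rule Set.set_eqI) (simp add: in_keys_iff[of _ "restrict_vars T f"] in_keys_iff[of _ f] lookup_restrict_vars)

lemma restrict_vars_add: "restrict_vars T (f + g) = restrict_vars T f + restrict_vars T g"
  by (rule poly_mapping_eqI) (simp add: lookup_restrict_vars lookup_add)

lemma restrict_vars_0 [simp]: "restrict_vars T 0 = 0"
  by (rule poly_mapping_eqI) (simp add: lookup_restrict_vars)

lemma restrict_vars_single:
  "restrict_vars T (single e c) = (if keys e \<subseteq> T then single e c else 0)"
  by (rule poly_mapping_eqI) (auto simp: lookup_restrict_vars lookup_single')

lemma restrict_vars_mult: "restrict_vars T (f * g) = restrict_vars T f * restrict_vars T g"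
proof (induction f rule: mpoly_induct)
  case (add_single f e c)
  have "restrict_vars T (single e c * g) = restrict_vars T (single e c) * restrict_vars T g"
    by (induction g rule: mpoly_induct)
      (auto simp: distrib_left restrict_vars_add mult_single restrict_vars_single keys_add_nat)
  then show ?case using add_single by (simp add: distrib_right restrict_vars_add)
qed simp

lemma homogeneous_add: "f \<in> homogeneous_part d \<Longrightarrow> g \<in> homogeneous_part d \<Longrightarrow> f + g \<in> homogeneous_part d"
  using Poly_Mapping.keys_add[of f g] unfolding homogeneous_part_def by blast

lemma homogeneous_mult:
  assumes "f \<in> homogeneous_part d" "g \<in> homogeneous_part d'"
  shows "f * g \<in> homogeneous_part (d + d')"
  unfolding homogeneous_part_def
proof (intro CollectI ballI)
  fix e assume "e \<in> keys (f * g)"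
  then obtain a b where "e = a + b" "a \<in> keys f" "b \<in> keys g"
    using keys_mult[of f g] by blast
  then show "int (monom_degree e) = d + d'"
    using assms by (auto simp: homogeneous_part_def monom_degree_add)
qed

definition homogeneous_component :: "int \<Rightarrow> ('n::finite, 'k::field) mpoly \<Rightarrow> ('n, 'k) mpoly" where
  "homogeneous_component d f = Abs_poly_mapping (\<lambda>e. if int (monom_degree e) = d then lookup f e else 0)"

lemma lookup_homogeneous_component:
  "lookup (homogeneous_component d f) e = (if int (monom_degree e) = d then lookup f e else 0)"
proof -
  have "finite {e. (if int (monom_degree e) = d then lookup f e else 0) \<noteq> 0}"
    by (rule finite_subset[OF _ finite_lookup[of f]]) auto
  then show ?thesis by (simp add: homogeneous_component_def)
qed

lemma keys_homogeneous_component: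
  "keys (homogeneous_component d f) = {e \<in> keys f. int (monom_degree e) = d}"
  by (auto simp: in_keys_iff lookup_homogeneous_component split: if_splits)

text \<open>The module \<open>\<Oplus>\<^sub>a S / (x\<^sub>i : i \<notin> T a) (- s a)\<close>, where \<open>a < m\<close>. The quotient rings are realised
  as the subrings of polynomials in the variables from \<open>T a\<close>, and a vector \<open>g\<close> of polynomials as
  the singleton \<open>{g}\<close>, since the elements of the competing modules are required to be sets.\<close>
locale polynomial_sum =
  fixes m :: nat and T :: "nat \<Rightarrow> 'n::finite set" and s :: "nat \<Rightarrow> nat" and field_type :: "'k::field itself"
begin

definition vectors :: "(nat \<Rightarrow> ('n, 'k) mpoly) set" where
  "vectors = {g. \<forall>a. \<forall>e\<in>keys (g a). a < m \<and> keys e \<subseteq> T a}"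

definition act :: "('n, 'k) mpoly \<Rightarrow> (nat \<Rightarrow> ('n, 'k) mpoly) \<Rightarrow> nat \<Rightarrow> ('n, 'k) mpoly" where
  "act f g a = restrict_vars (T a) f * g a"

definition N :: "(('n, 'k) mpoly, (nat \<Rightarrow> ('n, 'k) mpoly) set) module" where
  "N = \<lparr>carrier = (\<lambda>g. {g}) ` vectors, mult = undefined, one = undefined, zero = {\<lambda>_. 0},
      add = (\<lambda>X Y. {\<lambda>a. the_elem X a + the_elem Y a}), smult = (\<lambda>f X. {act f (the_elem X)})\<rparr>"

definition grading :: "int \<Rightarrow> (nat \<Rightarrow> ('n, 'k) mpoly) set set" where
  "grading i = (\<lambda>g. {g}) ` {g \<in> vectors. \<forall>a. g a \<in> homogeneous_part (i - int (s a))}"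

lemma N_simps [simp]:
  "carrier N = (\<lambda>g. {g}) ` vectors" "{g} \<oplus>\<^bsub>N\<^esub> {h} = {\<lambda>a. g a + h a}" "\<zero>\<^bsub>N\<^esub> = {\<lambda>_. 0}" "f \<odot>\<^bsub>N\<^esub> {g} = {act f g}"
  by (simp_all add: N_def)

lemma vectors_zero [simp]: "(\<lambda>_. 0) \<in> vectors"
  by (simp add: vectors_def)

lemma vectors_add: "g \<in> vectors \<Longrightarrow> h \<in> vectors \<Longrightarrow> (\<lambda>a. g a + h a) \<in> vectors"
  unfolding vectors_def
proof (intro CollectI allI ballI)
  fix a e assume gh: "g \<in> {g. \<forall>a. \<forall>e\<in>keys (g a). a < m \<and> keys e \<subseteq> T a}"
    "h \<in> {g. \<forall>a. \<forall>e\<in>keys (g a). a < m \<and> keys e \<subseteq> T a}"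
  assume "e \<in> keys (g a + h a)"
  then have "e \<in> keys (g a) \<union> keys (h a)" by (rule subsetD[OF Poly_Mapping.keys_add])
  then show "a < m \<and> keys e \<subseteq> T a" using gh by blast
qed

lemma vectors_uminus: "g \<in> vectors \<Longrightarrow> (\<lambda>a. - g a) \<in> vectors"
  by (simp add: vectors_def)

lemma vectors_act:
  assumes "g \<in> vectors"
  shows "act f g \<in> vectors"
  unfolding vectors_def
proof (intro CollectI allI ballI)
  fix a e assume "e \<in> keys (act f g a)"
  then obtain x y where "e = x + y" "x \<in> keys (restrict_vars (T a) f)" "y \<in> keys (g a)"
    using keys_mult unfolding act_def by blast
  then show "a < m \<and> keys e \<subseteq> T a"
    using assms by (auto simp: vectors_def keys_add_nat keys_restrict_vars)
qed

lemma act_simps: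
  "act (f + g) x = (\<lambda>a. act f x a + act g x a)" "act (f * g) x = act f (act g x)"
  "act f (\<lambda>a. x a + y a) = (\<lambda>a. act f x a + act f y a)"
  by (auto simp: act_def restrict_vars_add restrict_vars_mult distrib_left distrib_right mult.assoc)

lemma act_const: "act (const c) x a = const c * x a"
  by (simp add: act_def const_def restrict_vars_single)

lemma module_N: "Module.module class_ring N"
proof (rule module_criteria; (intro allI impI ballI)?; (elim conjE)?)
  show "cring (class_ring :: ('n, 'k) mpoly ring)" by (rule class_cring.cring_axioms)
  fix v assume "v \<in> carrier N"
  then obtain g where "g \<in> vectors" "v = {g}" by auto
  then show "\<exists>w\<in>carrier N. v \<oplus>\<^bsub>N\<^esub> w = \<zero>\<^bsub>N\<^esub>"
    using vectors_uminus[of g] by (intro bexI[of _ "{\<lambda>a. - g a}"]) auto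
next
  fix v assume "v \<in> carrier N"
  then show "\<one>\<^bsub>class_ring\<^esub> \<odot>\<^bsub>N\<^esub> v = v"
    using act_const[of 1] by (auto simp: const_hom fun_eq_iff)
qed (auto simp: vectors_add vectors_act act_simps add_ac)

lemma abelian_group_N: "abelian_group N"
  using module_N by (rule module.axioms)

lemma finsum_N:
  assumes "finite A" "\<And>i. i \<in> A \<Longrightarrow> g i \<in> vectors"
  shows "finsum N (\<lambda>i. {g i}) A = {\<lambda>a. \<Sum>i\<in>A. g i a}"
proof -
  interpret abelian_group N by (rule abelian_group_N)
  show ?thesis
    using assms by (induction A rule: finite_induct) (auto simp: Pi_iff)
qed

lemma graded_module_N: "graded_module N grading"
proof -
  interpret Module.module class_ring N by (rule module_N)
  show ?thesis
  proof (intro graded_module.intro module_N graded_module_axioms.intro)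
    fix i
    show "additive_subgroup (grading i) N"
      unfolding additive_subgroup_def
    proof (rule group.subgroupI)
      show "Group.group (add_monoid N)" by (rule M.a_group)
      show "grading i \<subseteq> carrier (add_monoid N)" by (auto simp: grading_def)
      show "grading i \<noteq> {}" by (auto simp: grading_def homogeneous_part_def intro!: exI[of _ "\<lambda>_. 0"])
      show "v \<otimes>\<^bsub>add_monoid N\<^esub> w \<in> grading i" if "v \<in> grading i" "w \<in> grading i" for v w
        using that by (auto simp: grading_def vectors_add homogeneous_add)
      fix v assume "v \<in> grading i"
      then obtain g where g: "g \<in> vectors" "v = {g}" "\<forall>a. g a \<in> homogeneous_part (i - int (s a))"
        by (auto simp: grading_def)
      have "inv\<^bsub>add_monoid N\<^esub> v = \<ominus>\<^bsub>N\<^esub> v" by (simp only: a_inv_def)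
      also have "\<dots> = {\<lambda>a. - g a}"
        using g vectors_uminus[OF g(1)] by (intro M.minus_equality) auto
      finally show "inv\<^bsub>add_monoid N\<^esub> v \<in> grading i"
        using g vectors_uminus[OF g(1)] by (auto simp: grading_def homogeneous_part_def)
    qed
  next
    fix f d v i assume f: "f \<in> (homogeneous_part d :: ('n, 'k) mpoly set)" and "v \<in> grading i"
    then obtain g where g: "g \<in> vectors" "v = {g}" "\<forall>a. g a \<in> homogeneous_part (i - int (s a))"
      by (auto simp: grading_def)
    have "restrict_vars T' f \<in> homogeneous_part d" for T'
      using f by (auto simp: homogeneous_part_def keys_restrict_vars)
    then have "act f g a \<in> homogeneous_part (d + (i - int (s a)))" for a
      unfolding act_def using g(3) homogeneous_mult by blast
    then show "f \<odot>\<^bsub>N\<^esub> v \<in> grading (d + i)"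
      using vectors_act[OF g(1)] by (auto simp: grading_def g(2) add_diff_eq)
  next
    fix v assume "v \<in> carrier N"
    then obtain g where g: "g \<in> vectors" "v = {g}" by auto
    \<comment> \<open>Coordinate \<open>a\<close> is shifted by \<open>s a\<close>, so degree
      \<open>i\<close> of the sum is degree \<open>i - s a\<close> there.\<close>
    define c where "c i a = homogeneous_component (i - int (s a)) (g a)" for i a
    define F where "F = (\<Union>a<m. (\<lambda>e. int (monom_degree e) + int (s a)) ` keys (g a))"
    have finF: "finite F" by (simp add: F_def)
    have cV: "c i \<in> vectors" for i
      using g(1) by (auto simp: vectors_def c_def keys_homogeneous_component)
    have c_grading: "{c i} \<in> grading i" for i
      using cV by (auto simp: grading_def c_def homogeneous_part_def keys_homogeneous_component)
    have c0: "c i = (\<lambda>_. 0)" if "i \<notin> F" for i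
    proof
      fix a
      have "keys (c i a) = {}"
        using that g(1) by (force simp: c_def keys_homogeneous_component F_def vectors_def)
      then show "c i a = 0" by simp
    qed
    have fin: "finite {i. {c i} \<noteq> \<zero>\<^bsub>N\<^esub>}"
      using c0 by (intro finite_subset[OF _ finF]) auto
    have sum: "g a = (\<Sum>i\<in>A. c i a)" if "finite A" "{i. {c i} \<noteq> \<zero>\<^bsub>N\<^esub>} \<subseteq> A" for A a
    proof (rule poly_mapping_eqI)
      fix e
      have "lookup (\<Sum>i\<in>A. c i a) e = (\<Sum>i\<in>A. if i = int (monom_degree e) + int (s a) then lookup (g a) e else 0)"
        unfolding lookup_sum by (intro sum.cong) (auto simp: c_def lookup_homogeneous_component)
      also have "\<dots> = lookup (g a) e"
      proof (cases "int (monom_degree e) + int (s a) \<in> A")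
        case False
        then have "c (int (monom_degree e) + int (s a)) = (\<lambda>_. 0)" using that(2) by auto
        then have "c (int (monom_degree e) + int (s a)) a = 0" by simp
        then have "lookup (g a) e = 0"
          using lookup_homogeneous_component[of "int (monom_degree e)" "g a" e] by (simp add: c_def)
        then show ?thesis by simp
      qed (simp add: that(1))
      finally show "lookup (g a) e = lookup (\<Sum>i\<in>A. c i a) e" by simp
    qed
    show "\<exists>!c. (\<forall>i. c i \<in> grading i) \<and> finite {i. c i \<noteq> \<zero>\<^bsub>N\<^esub>} \<and> v = finsum N c {i. c i \<noteq> \<zero>\<^bsub>N\<^esub>}"
    proof (rule ex1I[of _ "\<lambda>i. {c i}"])
      show "(\<forall>i. {c i} \<in> grading i) \<and> finite {i. {c i} \<noteq> \<zero>\<^bsub>N\<^esub>} \<and> v = finsum N (\<lambda>i. {c i}) {i. {c i} \<noteq> \<zero>\<^bsub>N\<^esub>}"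
        using c_grading fin sum[OF fin order_refl] cV by (simp add: finsum_N g(2) fun_eq_iff del: N_simps(3))
    next
      fix b assume b: "(\<forall>i. b i \<in> grading i) \<and> finite {i. b i \<noteq> \<zero>\<^bsub>N\<^esub>} \<and> v = finsum N b {i. b i \<noteq> \<zero>\<^bsub>N\<^esub>}"
      define b' where "b' i = the_elem (b i)" for i
      have b': "b i = {b' i}" "b' i \<in> vectors" "\<And>a. b' i a \<in> homogeneous_part (i - int (s a))" for i
        using b unfolding grading_def b'_def by (auto dest!: spec[of _ i])
      let ?A = "{i. b i \<noteq> \<zero>\<^bsub>N\<^esub>}"
      have g_sum: "g a = (\<Sum>i\<in>?A. b' i a)" for a
      proof -
        have "{g} = finsum N (\<lambda>i. {b' i}) ?A" using b g(2) by (simp only: b'(1)[symmetric])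
        also have "\<dots> = {\<lambda>a. \<Sum>i\<in>?A. b' i a}" using b b'(2) by (intro finsum_N) auto
        finally show ?thesis by (simp add: fun_eq_iff)
      qed
      \<comment> \<open>The exponent \<open>e\<close> in coordinate \<open>a\<close> belongs to a
        single degree, so every decomposition has the same coefficient there.\<close>
      have "b' i a = c i a" for i a
      proof (rule poly_mapping_eqI)
        fix e
        have other: "lookup (b' j a) e = 0" if "j \<noteq> int (monom_degree e) + int (s a)" for j
        proof -
          have "e \<notin> keys (b' j a)"
            using b'(3)[of j a] that by (auto simp: homogeneous_part_def)
          then show ?thesis by (simp add: in_keys_iff)
        qed
        have "lookup (g a) e = (\<Sum>j\<in>?A. if j = int (monom_degree e) + int (s a) then lookup (b' j a) e else 0)"
          unfolding g_sum lookup_sum by (intro sum.cong) (auto simp: other)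
        also have "\<dots> = lookup (b' (int (monom_degree e) + int (s a)) a) e"
        proof (cases "int (monom_degree e) + int (s a) \<in> ?A")
          case False
          then have "b' (int (monom_degree e) + int (s a)) a = 0" using b'(1) by simp
          then show ?thesis by simp
        qed (use b in simp)
        finally show "lookup (b' i a) e = lookup (c i a) e"
          using other[of i] by (auto simp: c_def lookup_homogeneous_component)
      qed
      then have "b' i = c i" for i by (simp add: fun_eq_iff)
      then show "b = (\<lambda>i. {c i})" using b'(1) by auto
    qed
  qed
qed

definition monomial_vector :: "nat \<Rightarrow> ('n \<Rightarrow>\<^sub>0 nat) \<Rightarrow> 'k \<Rightarrow> nat \<Rightarrow> ('n, 'k) mpoly" where
  "monomial_vector a e c = (\<lambda>b. if b = a then single e c else 0)"

lemma act_monomial_vector: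
  "keys e \<subseteq> T a \<Longrightarrow> act (single e c) (monomial_vector a e' c') = monomial_vector a (e + e') (c * c')"
  by (auto simp: act_def monomial_vector_def restrict_vars_single mult_single fun_eq_iff)

text \<open>Reduces statements about vectors to monomials in a single coordinate. Coefficients are
  left arbitrary so that \<open>Z\<close> need be closed under sums only.\<close>

lemma vector_in_span_of_monomials:
  assumes "g \<in> vectors" and zero: "(\<lambda>_. 0) \<in> Z" and add: "\<And>x y. x \<in> Z \<Longrightarrow> y \<in> Z \<Longrightarrow> (\<lambda>a. x a + y a) \<in> Z"
    and monomials: "\<And>a e c. e \<in> keys (g a) \<Longrightarrow> monomial_vector a e c \<in> Z"
  shows "g \<in> Z"
proof -
  have Z_sum: "(\<lambda>b. \<Sum>i\<in>A. x i b) \<in> Z" if "finite A" "\<And>i. i \<in> A \<Longrightarrow> x i \<in> Z" for A and x :: "'i \<Rightarrow> _"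
    using that by (induction A rule: finite_induct) (auto simp: zero add)
  define t where "t a = (\<lambda>b. \<Sum>e\<in>keys (g a). monomial_vector a e (lookup (g a) e) b)" for a
  have t: "t a b = (if b = a then g a else 0)" for a b
    by (rule poly_mapping_eqI) (auto simp: t_def monomial_vector_def lookup_sum lookup_single' in_keys_iff)
  have "t a \<in> Z" for a
    unfolding t_def
  proof -
    have "finite A \<Longrightarrow> A \<subseteq> keys (g a) \<Longrightarrow> (\<lambda>b. \<Sum>e\<in>A. monomial_vector a e (lookup (g a) e) b) \<in> Z" for A
      by (induction A rule: finite_induct) (auto simp: zero add monomials)
    then show "(\<lambda>b. \<Sum>e\<in>keys (g a). monomial_vector a e (lookup (g a) e) b) \<in> Z" by simp
  qed
  then have "(\<lambda>b. \<Sum>a<k. t a b) \<in> Z" for k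
    by (induction k) (auto simp: zero add)
  moreover have "(\<lambda>b. \<Sum>a<m. t a b) = g"
  proof
    fix b
    have "g b = 0" if "\<not> b < m"
    proof -
      have "e \<notin> keys (g b)" for e using that assms(1) by (auto simp: vectors_def)
      then show ?thesis using keys_eq_empty by blast
    qed
    then show "(\<Sum>a<m. t a b) = g b" by (auto simp: t sum.delta)
  qed
  ultimately show ?thesis by metis
qed

lemma finitely_generated_N: "finitely_generated N"
proof -
  interpret Module.module class_ring N by (rule module_N)
  let ?A = "(\<lambda>a. {monomial_vector a 0 1}) ` {..<m}"
  have A: "?A \<subseteq> carrier N"
    by (auto simp: vectors_def monomial_vector_def)
  define Z where "Z = {g. {g} \<in> span ?A}"
  have sub: "submodule class_ring (span ?A) N" by (rule span_is_submodule[OF A])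
  have span_closed: "{\<lambda>_. 0} \<in> span ?A" "X \<in> span ?A \<Longrightarrow> Y \<in> span ?A \<Longrightarrow> X \<oplus>\<^bsub>N\<^esub> Y \<in> span ?A"
    "X \<in> span ?A \<Longrightarrow> f \<odot>\<^bsub>N\<^esub> X \<in> span ?A" for X Y f
    using sub unfolding submodule_def by simp_all
  have "carrier N \<subseteq> span ?A"
  proof
    fix v assume "v \<in> carrier N"
    then obtain g where g: "g \<in> vectors" "v = {g}" by auto
    have "g \<in> Z"
    proof (rule vector_in_span_of_monomials[OF g(1)])
      show "(\<lambda>_. 0) \<in> Z" using span_closed(1) by (simp add: Z_def)
      show "(\<lambda>a. x a + y a) \<in> Z" if "x \<in> Z" "y \<in> Z" for x y
        using span_closed(2)[of "{x}" "{y}"] that by (simp add: Z_def)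
      fix a e c assume e: "e \<in> keys (g a)"
      then have "a < m" "keys e \<subseteq> T a" using g(1) by (auto simp: vectors_def)
      moreover have "{monomial_vector a 0 1} \<in> span ?A"
        using in_own_span[OF A] \<open>a < m\<close> by auto
      ultimately show "monomial_vector a e c \<in> Z"
        using span_closed(3)[of "{monomial_vector a 0 1}" "single e c"] act_monomial_vector[of e a c 0 1]
        by (simp add: Z_def)
    qed
    then show "v \<in> span ?A" by (simp add: Z_def g(2))
  qed
  then have "span ?A = carrier N" using span_is_subset2[OF A] by blast
  then show ?thesis
    unfolding finitely_generated_def using A by (intro exI[of _ ?A]) simp
qed

lemma dim_component_N:
  "int (hilbert_function N grading i) =
    (\<Sum>a<m. if i < int (s a) then 0 else fps_nth (geom ^ card (T a)) (nat (i - int (s a))))"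
proof -
  interpret graded_module N grading by (rule graded_module_N)
  define E where "E a = {e :: 'n \<Rightarrow>\<^sub>0 nat. keys e \<subseteq> T a \<and> int (monom_degree e) + int (s a) = i}" for a
  define \<phi> where "\<phi> X = (\<lambda>(a :: nat, e). lookup (the_elem X a :: ('n, 'k) mpoly) e)" for X
  have finE: "finite (E a)" for a
    unfolding E_def by (rule finite_subset[OF _ finite_monom_degree[of "nat i"]]) auto
  have "coordinates (component_space N grading i) (Sigma {..<m} E) \<phi>"
    unfolding coordinates_def component_space_simps
  proof (intro conjI ballI allI)
    show "bij_betw \<phi> (grading i) {v. \<forall>x. v x \<noteq> 0 \<longrightarrow> x \<in> Sigma {..<m} E}"
    proof (rule bij_betw_imageI)
      show "inj_on \<phi> (grading i)"
      proof (rule inj_onI)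
        fix X Y assume "X \<in> grading i" "Y \<in> grading i" and eq: "\<phi> X = \<phi> Y"
        then obtain f g where fg: "X = {f}" "Y = {g}" by (auto simp: grading_def)
        have "f a = g a" for a
          by (rule poly_mapping_eqI) (use fun_cong[OF eq, of "(a, _)"] in \<open>simp add: \<phi>_def fg\<close>)
        then show "X = Y" by (simp add: fg fun_eq_iff)
      qed
      show "\<phi> ` grading i = {v. \<forall>x. v x \<noteq> 0 \<longrightarrow> x \<in> Sigma {..<m} E}"
      proof (rule subset_antisym; rule subsetI)
        fix v assume "v \<in> \<phi> ` grading i"
        then obtain g where g: "v = \<phi> {g}" "g \<in> vectors" "\<forall>a. g a \<in> homogeneous_part (i - int (s a))"
          by (auto simp: grading_def)
        have "x \<in> Sigma {..<m} E" if "v x \<noteq> 0" for x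
        proof -
          obtain a e where x: "x = (a, e)" by (cases x)
          then have "e \<in> keys (g a)" using that by (simp add: g \<phi>_def in_keys_iff)
          then have "a < m" "keys e \<subseteq> T a" "int (monom_degree e) = i - int (s a)"
            using g unfolding vectors_def homogeneous_part_def by blast+
          then show ?thesis by (simp add: x E_def)
        qed
        then show "v \<in> {v. \<forall>x. v x \<noteq> 0 \<longrightarrow> x \<in> Sigma {..<m} E}" by blast
      next
        fix v :: "nat \<times> ('n \<Rightarrow>\<^sub>0 nat) \<Rightarrow> 'k" assume v: "v \<in> {v. \<forall>x. v x \<noteq> 0 \<longrightarrow> x \<in> Sigma {..<m} E}"
        define g where "g a = Abs_poly_mapping (\<lambda>e. v (a, e))" for a
        have "finite {e. v (a, e) \<noteq> 0}" for a
          using v by (intro finite_subset[OF _ finE[of a]]) auto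
        then have lookup: "lookup (g a) e = v (a, e)" for a e by (simp add: g_def)
        have keys: "a < m \<and> e \<in> E a" if "e \<in> keys (g a)" for a e
          using v that by (auto simp: in_keys_iff lookup)
        have "g \<in> vectors" using keys by (auto simp: vectors_def E_def)
        moreover have "g a \<in> homogeneous_part (i - int (s a))" for a
          using keys by (force simp: homogeneous_part_def E_def)
        moreover have "\<phi> {g} = v" by (auto simp: \<phi>_def lookup)
        ultimately show "v \<in> \<phi> ` grading i" unfolding grading_def by blast
      qed
    qed
  qed (auto simp: grading_def \<phi>_def lookup_add act_const lookup_const_mult)
  then have "hilbert_function N grading i = card (Sigma {..<m} E)"
    by (intro dim_coordinates vectorspace_component) (auto simp: finE)
  then have "int (hilbert_function N grading i) = (\<Sum>a<m. int (card (E a)))"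
    using finE by simp
  also have "\<dots> = (\<Sum>a<m. if i < int (s a) then 0 else fps_nth (geom ^ card (T a)) (nat (i - int (s a))))"
  proof (intro sum.cong refl)
    fix a
    show "int (card (E a)) = (if i < int (s a) then 0 else fps_nth (geom ^ card (T a)) (nat (i - int (s a))))"
    proof (cases "i < int (s a)")
      case True
      then have "E a = {}" by (auto simp: E_def)
      then show ?thesis using True by simp
    next
      case False
      then have "E a = {e. keys e \<subseteq> T a \<and> monom_degree e = nat (i - int (s a))}"
        by (auto simp: E_def)
      then show ?thesis using False by (simp only: card_monomials(1) if_False)
    qed
  qed
  finally show ?thesis .
qed

text \<open>When \<open>W\<close> is contained in every \<open>T a\<close>, this is the product of
  the ideal of the variables in \<open>W\<close> with the module, described by its
  monomials.\<close>

definition hitting :: "'n set \<Rightarrow> (nat \<Rightarrow> ('n, 'k) mpoly) set" where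
  "hitting W = {g \<in> vectors. \<forall>a. \<forall>e\<in>keys (g a). keys e \<inter> W \<noteq> {}}"

lemma keys_act_var:
  "e \<in> keys (act (var v) g a) \<Longrightarrow> v \<in> T a \<and> (\<exists>e'\<in>keys (g a). e = single v 1 + e')"
  using keys_mult[of "restrict_vars (T a) (var v)" "g a"]
  by (auto simp: act_def var_def restrict_vars_single split: if_splits)

lemma ideal_times_vars:
  assumes "\<And>a. a < m \<Longrightarrow> set vs \<subseteq> T a"
  shows "ideal_times (map var vs) N = (\<lambda>g. {g}) ` hitting (set vs)"
  using assms
proof (induction vs rule: rev_induct)
  case Nil
  interpret graded_module N grading by (rule graded_module_N)
  have "hitting {} = {\<lambda>_. 0}" by (auto simp: hitting_def fun_eq_iff)
  then show ?case by (simp add: ideal_times_Nil)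
next
  case (snoc v vs)
  interpret graded_module N grading by (rule graded_module_N)
  have IH: "ideal_times (map var vs) N = (\<lambda>g. {g}) ` hitting (set vs)" using snoc by simp
  have eq: "ideal_times (map var (vs @ [v])) N = (\<lambda>g. {g}) ` {\<lambda>a. u a + act (var v) x a | u x. u \<in> hitting (set vs) \<and> x \<in> vectors}"
    (is "?L = ?R")
  proof (rule subset_antisym; rule subsetI)
    fix y assume "y \<in> ?L"
    then obtain u x where "u \<in> hitting (set vs)" "x \<in> vectors" "y = {u} \<oplus>\<^bsub>N\<^esub> var v \<odot>\<^bsub>N\<^esub> {x}"
      by (auto simp: ideal_times_snoc IH)
    moreover from this(3) have "y = {\<lambda>a. u a + act (var v) x a}" by simp
    ultimately show "y \<in> ?R" by blast
  next
    fix y assume "y \<in> ?R"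
    then obtain u x where *: "u \<in> hitting (set vs)" "x \<in> vectors" "y = {\<lambda>a. u a + act (var v) x a}" by blast
    then have "y = {u} \<oplus>\<^bsub>N\<^esub> var v \<odot>\<^bsub>N\<^esub> {x}" by simp
    moreover have "{u} \<in> ideal_times (map var vs) N" "{x} \<in> carrier N" using * by (simp_all add: IH)
    ultimately show "y \<in> ?L" unfolding map_append list.map ideal_times_snoc by blast
  qed
  define Z where "Z = {\<lambda>a. u a + act (var v) x a | u x. u \<in> hitting (set vs) \<and> x \<in> vectors}"
  have hit_add: "(\<lambda>a. x a + y a) \<in> hitting W" if "x \<in> hitting W" "y \<in> hitting W" for x y W
    unfolding hitting_def
  proof (intro CollectI conjI allI ballI)
    show "(\<lambda>a. x a + y a) \<in> vectors" using that vectors_add unfolding hitting_def by blast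
    fix a e assume "e \<in> keys (x a + y a)"
    then have "e \<in> keys (x a) \<union> keys (y a)" by (rule subsetD[OF Poly_Mapping.keys_add])
    then show "keys e \<inter> W \<noteq> {}" using that unfolding hitting_def by blast
  qed
  have hit0: "(\<lambda>_. 0) \<in> hitting W" for W by (simp add: hitting_def)
  have "Z = hitting (set (vs @ [v]))"
  proof (rule subset_antisym; rule subsetI)
    fix g assume "g \<in> Z"
    then obtain u x where g: "g = (\<lambda>a. u a + act (var v) x a)" "u \<in> hitting (set vs)" "x \<in> vectors"
      by (auto simp: Z_def)
    have "u \<in> hitting (set (vs @ [v]))" using g(2) by (auto simp: hitting_def)
    moreover have "act (var v) x \<in> hitting (set (vs @ [v]))"
      unfolding hitting_def
    proof (intro CollectI conjI allI ballI vectors_act g)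
      fix a e assume "e \<in> keys (act (var v) x a)"
      then obtain e' where "e = single v 1 + e'" using keys_act_var by blast
      then have "v \<in> keys e" by (simp add: keys_add_nat)
      then show "keys e \<inter> set (vs @ [v]) \<noteq> {}" by auto
    qed
    ultimately show "g \<in> hitting (set (vs @ [v]))" unfolding g(1) by (rule hit_add)
  next
    fix g assume g: "g \<in> hitting (set (vs @ [v]))"
    show "g \<in> Z"
    proof (rule vector_in_span_of_monomials)
      show "g \<in> vectors" using g by (simp add: hitting_def)
      show "(\<lambda>_. 0) \<in> Z"
        unfolding Z_def using hit0 by (intro CollectI exI[of _ "\<lambda>_. 0"]) (auto simp: act_def)
      show "(\<lambda>a. x a + y a) \<in> Z" if xy: "x \<in> Z" "y \<in> Z" for x y
      proof -
        obtain u x' w y' where *: "x = (\<lambda>a. u a + act (var v) x' a)" "y = (\<lambda>a. w a + act (var v) y' a)"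
          "u \<in> hitting (set vs)" "w \<in> hitting (set vs)" "x' \<in> vectors" "y' \<in> vectors"
          using xy by (auto simp: Z_def)
        have "(\<lambda>a. x a + y a) = (\<lambda>a. (u a + w a) + act (var v) (\<lambda>a. x' a + y' a) a)"
          by (simp add: * act_simps add_ac)
        then show ?thesis
          unfolding Z_def using hit_add[OF *(3,4)] vectors_add[OF *(5,6)]
          by (intro CollectI exI[of _ "\<lambda>a. u a + w a"] exI[of _ "\<lambda>a. x' a + y' a"] conjI)
      qed
      fix a e c assume e: "e \<in> keys (g a)"
      then have a: "a < m" "keys e \<subseteq> T a" "keys e \<inter> set (vs @ [v]) \<noteq> {}"
        using g unfolding hitting_def vectors_def by blast+
      \<comment> \<open>A monomial involving a variable of \<open>vs\<close> belongs to the old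
        part; otherwise it contains \<open>v\<close>, which is split off.\<close>
      show "monomial_vector a e c \<in> Z"
      proof (cases "keys e \<inter> set vs = {}")
        case False
        then have "monomial_vector a e c \<in> hitting (set vs)"
          using a by (auto simp: hitting_def vectors_def monomial_vector_def split: if_splits)
        then show ?thesis
          unfolding Z_def by (intro CollectI exI[of _ "monomial_vector a e c"] exI[of _ "\<lambda>_. 0"]) (auto simp: act_def)
      next
        case True
        then have "v \<in> keys e" using a(3) by auto
        then have "lookup e v \<ge> 1" by (simp add: in_keys_iff)
        define e' where "e' = e - single v 1"
        have e': "e = single v 1 + e'"
          using \<open>lookup e v \<ge> 1\<close>
          by (intro poly_mapping_eqI) (auto simp: e'_def lookup_add lookup_minus lookup_single')
        have "keys e' \<subseteq> T a" "v \<in> T a" using a(2) by (auto simp: e' keys_add_nat)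
        then have "monomial_vector a e' c \<in> vectors"
          using a(1) by (auto simp: vectors_def monomial_vector_def split: if_splits)
        moreover have "monomial_vector a e c = act (var v) (monomial_vector a e' c)"
          using \<open>v \<in> T a\<close> act_monomial_vector[of "single v 1" a 1 e' c] by (simp add: var_def e')
        ultimately show ?thesis
          unfolding Z_def using hit0 by (intro CollectI exI[of _ "\<lambda>_. 0"] exI[of _ "monomial_vector a e' c"]) auto
      qed
    qed
  qed
  then show ?case unfolding eq Z_def by simp
qed

text \<open>A monomial times a new variable involves one of the earlier variables only if the
  monomial did. The constant 1 in the first summand involves none, so the last quotient is
  nonzero.\<close>

lemma regular_sequence_vars:
  assumes vs: "\<And>a. a < m \<Longrightarrow> set vs \<subseteq> T a" "distinct vs" and "0 < m"
  shows "regular_sequence N (map var vs)"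
  unfolding regular_sequence_def
proof (intro conjI allI impI ballI)
  fix i x assume i: "i < length (map var vs)" and "x \<in> carrier N"
  then obtain g where g: "g \<in> vectors" "x = {g}" by auto
  define v where "v = vs ! i"
  have ideal: "ideal_times (take i (map var vs)) N = (\<lambda>g. {g}) ` hitting (set (take i vs))"
    using vs(1) set_take_subset[of i vs] ideal_times_vars[of "take i vs"] by (auto simp: take_map)
  have v: "v \<notin> set (take i vs)" "v \<in> set vs"
    using i vs(2) by (auto simp: v_def in_set_conv_nth nth_eq_iff_index_eq)
  assume "map var vs ! i \<odot>\<^bsub>N\<^esub> x \<in> ideal_times (take i (map var vs)) N"
  then have hit: "act (var v) g \<in> hitting (set (take i vs))"
    using i g by (auto simp: ideal v_def)
  have "keys e \<inter> set (take i vs) \<noteq> {}" if e: "e \<in> keys (g a)" for a e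
  proof -
    have "a < m" using e g(1) by (auto simp: vectors_def)
    then have "act (var v) g a = single (single v 1) 1 * g a"
      using vs(1) v(2) by (auto simp: act_def var_def restrict_vars_single)
    then have "lookup (act (var v) g a) (single v 1 + e) = lookup (g a) e"
      by (simp add: lookup_single_mult)
    then have "single v 1 + e \<in> keys (act (var v) g a)"
      using e by (simp add: in_keys_iff)
    then have "keys (single v 1 + e) \<inter> set (take i vs) \<noteq> {}"
      using hit unfolding hitting_def by blast
    then show ?thesis using v(1) by (auto simp: keys_add_nat)
  qed
  then show "x \<in> ideal_times (take i (map var vs)) N"
    using g by (auto simp: ideal hitting_def)
next
  have "{monomial_vector 0 0 1} \<in> carrier N"
    using assms(3) by (auto simp: vectors_def monomial_vector_def)
  moreover have "{monomial_vector 0 0 1} \<notin> (\<lambda>g. {g}) ` hitting (set vs)"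
    by (auto simp: hitting_def monomial_vector_def dest!: spec[of _ "0::nat"])
  ultimately show "ideal_times (map var vs) N \<noteq> carrier N"
    using ideal_times_vars[OF vs(1)] by blast
qed

end

section \<open>Hilbert depth\<close>

text \<open>Used to see that a competing module is nonzero, so that the empty sequence is regular
  for it and its depth is the maximum of a nonempty set.\<close>

lemma hilbert_function_zero_module:
  fixes M :: "(('n::finite, 'k::field) mpoly, 'm) module"
  assumes "graded_module M G" "carrier M = {\<zero>\<^bsub>M\<^esub>}"
  shows "hilbert_function M G i = 0"
proof -
  interpret graded_module M G by fact
  have "G i = {\<zero>\<^bsub>M\<^esub>}" using assms(2) component_carrier[of _ i] component_zero[of i] by blast
  then have "coordinates (component_space M G i) ({} :: nat set) (\<lambda>_ _. 0)"
    by (auto simp: coordinates_def bij_betw_def fun_eq_iff)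
  from dim_coordinates[OF vectorspace_component this] show ?thesis by simp
qed

text \<open>\<open>Abs_fls\<close> is faithful only on functions that vanish far below; under this
  condition equal series have equal coefficients.\<close>

lemma hilbert_series_eqD:
  fixes M :: "(('n::finite, 'k::field) mpoly, 'm) module" and M' :: "(('n, 'k) mpoly, 'm') module"
  assumes "hilbert_series M G = hilbert_series M' G'"
    and "\<exists>b. \<forall>i<b. hilbert_function M G i = 0"
    and "\<exists>b. \<forall>i<b. hilbert_function M' G' i = 0"
  shows "hilbert_function M G i = hilbert_function M' G' i"
proof -
  obtain b b' where b: "\<forall>i<b. hilbert_function M G i = 0"
    and b': "\<forall>i<b'. hilbert_function M' G' i = 0"
    using assms(2,3) by blast
  have "fls_nth (hilbert_series M G) i = int (hilbert_function M G i)"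
    unfolding hilbert_series_def by (rule nth_Abs_fls_lower_bound[of b]) (use b in simp)
  moreover have "fls_nth (hilbert_series M' G') i = int (hilbert_function M' G' i)"
    unfolding hilbert_series_def by (rule nth_Abs_fls_lower_bound[of b']) (use b' in simp)
  ultimately show ?thesis using assms(1) by simp
qed

lemma regular_sequence_length_bound:
  fixes M :: "(('n::finite, 'k::field) mpoly, 'm) module"
  assumes M: "graded_module M G" "finitely_generated M"
    and fs: "set fs \<subseteq> irrelevant_ideal" "regular_sequence M fs"
    and neg: "\<And>i. i < 0 \<Longrightarrow> hilbert_function M G i = 0"
    and series: "\<And>k. int (hilbert_function M G (int k)) = fps_nth (alpha_series N \<alpha>) k"
    and \<alpha>: "\<And>j. j > N \<Longrightarrow> \<alpha> j = 0" and nz: "alpha_series N \<alpha> \<noteq> 0"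
  shows "length fs \<le> N \<and> (\<forall>k\<le>length fs. beta_sum \<alpha> (length fs) k \<ge> 0)"
proof -
  define h where "h i = int (hilbert_function M G i)" for i
  have "Abs_fps (\<lambda>k. h (int k)) = alpha_series N \<alpha>"
    by (rule fps_ext) (simp add: h_def series)
  then have "(difference ^^ length fs) h (int k) = fps_nth ((1 - fps_X) ^ length fs * alpha_series N \<alpha>) k" for k
    using difference_fps[of h "length fs" k] neg by (simp add: h_def)
  moreover have "0 \<le> (difference ^^ length fs) h i" for i
    using regular_sequence_difference_nonneg[OF M fs] by (simp add: h_def[abs_def])
  ultimately have nonneg: "0 \<le> fps_nth ((1 - fps_X) ^ length fs * alpha_series N \<alpha>) k" for k
    by metis
  have "length fs \<le> N" by (rule alpha_series_bound[OF nonneg nz])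
  moreover have "beta_sum \<alpha> (length fs) k \<ge> 0" if "k \<le> length fs" for k
    using nonneg[of k] fps_nth_alpha_series[OF that \<alpha>] by simp
  ultimately show ?thesis by blast
qed

text \<open>If all \<open>\<beta>\<^sub>k\<^sup>q\<close> are nonnegative, then
  \<open>\<Sum>\<^sub>j \<alpha>\<^sub>j t\<^sup>j / (1 - t)\<^sup>j = \<Sum>\<^bsub>k \<le> q\<^esub> \<beta>\<^sub>k\<^sup>q t\<^sup>k / (1 - t)\<^sup>q + \<Sum>\<^bsub>j > q\<^esub> \<alpha>\<^sub>j t\<^sup>j / (1 - t)\<^sup>j\<close>
  is the Hilbert series of a sum of shifted polynomial rings in at least \<open>q\<close> variables.\<close>
lemma realize_alpha_series:
  fixes \<alpha> :: "nat \<Rightarrow> nat"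
  assumes q: "q \<le> CARD('n::finite)" and \<beta>: "\<And>k. k \<le> q \<Longrightarrow> beta_sum \<alpha> q k \<ge> 0"
    and \<alpha>: "\<And>j. j > CARD('n) \<Longrightarrow> \<alpha> j = 0" and nz: "alpha_series CARD('n) \<alpha> \<noteq> 0"
  obtains N :: "(('n::finite, 'k::field) mpoly, (nat \<Rightarrow> ('n, 'k) mpoly) set) module" and H fs
  where "graded_module N H" "finitely_generated N"
    "\<And>i. i < 0 \<Longrightarrow> hilbert_function N H i = 0"
    "\<And>k. int (hilbert_function N H (int k)) = fps_nth (alpha_series CARD('n) \<alpha>) k"
    "set fs \<subseteq> irrelevant_ideal" "regular_sequence N fs" "length fs = q"
proof -
  obtain xs :: "'n list" where xs: "set xs = UNIV" "distinct xs"
    using finite_distinct_list[of "UNIV :: 'n set"] by auto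
  have len: "length xs = CARD('n)" using distinct_card[OF xs(2)] xs(1) by simp
  \<comment> \<open>Each pair gives the shift and the number of variables of one summand, with
    multiplicities read off the decomposition of the series.\<close>
  define L where "L = concat (map (\<lambda>k. replicate (nat (beta_sum \<alpha> q k)) (k, q)) [0..<Suc q])
    @ concat (map (\<lambda>j. replicate (\<alpha> j) (j, j)) [Suc q..<Suc CARD('n)])"
  define w where "w p = fps_X ^ fst p * geom ^ snd p" for p :: "nat \<times> nat"
  have L_snd: "q \<le> snd p \<and> snd p \<le> CARD('n)" if "p \<in> set L" for p
    using that q by (auto simp: L_def)
  have sum_replicate: "sum_list (map w (concat (map (\<lambda>k. replicate (f k) (g k)) ks))) = (\<Sum>k\<leftarrow>ks. of_nat (f k) * w (g k))" for f g and ks :: "nat list"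
    by (induction ks) (simp_all add: sum_list_replicate map_replicate)
  have "sum_list (map w L) = (\<Sum>k\<leftarrow>[0..<Suc q]. of_nat (nat (beta_sum \<alpha> q k)) * w (k, q)) + (\<Sum>j\<leftarrow>[Suc q..<Suc CARD('n)]. of_nat (\<alpha> j) * w (j, j))"
    unfolding L_def map_append sum_list_append sum_replicate ..
  also have "(\<Sum>k\<leftarrow>[0..<Suc q]. of_nat (nat (beta_sum \<alpha> q k)) * w (k, q)) = (\<Sum>k\<le>q. of_int (beta_sum \<alpha> q k) * (fps_X ^ k * geom ^ q))"
    unfolding interv_sum_list_conv_sum_set_nat set_upt using \<beta>
    by (intro sum.cong) (auto simp: w_def of_nat_nat)
  also have "(\<Sum>j\<leftarrow>[Suc q..<Suc CARD('n)]. of_nat (\<alpha> j) * w (j, j)) = (\<Sum>j\<in>{q<..CARD('n)}. of_nat (\<alpha> j) * (fps_X ^ j * geom ^ j))"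
    unfolding interv_sum_list_conv_sum_set_nat set_upt
    by (intro sum.cong) (auto simp: w_def)
  finally have L_sum: "sum_list (map w L) = alpha_series CARD('n) \<alpha>"
    using alpha_series_decomposition[OF q \<alpha>] by simp
  \<comment> \<open>The variable sets are initial segments of one enumeration, so the first
    \<open>q\<close> variables occur in every summand and form a common regular sequence.\<close>
  define T where "T a = set (take (snd (L ! a)) xs)" for a
  define s where "s a = fst (L ! a)" for a
  interpret polynomial_sum "length L" T s "TYPE('k)" .
  have card_T: "card (T a) = snd (L ! a)" if "a < length L" for a
    using L_snd[of "L ! a"] that len distinct_card[of "take (snd (L ! a)) xs"] xs(2) by (simp add: T_def)
  have "L \<noteq> []" using L_sum nz by auto
  define fs where "fs = (map var (take q xs) :: ('n, 'k) mpoly list)"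
  have "set (take q xs) \<subseteq> T a" if "a < length L" for a
    using L_snd[of "L ! a"] that unfolding T_def by (intro set_take_subset_set_take) auto
  then have "regular_sequence N fs"
    unfolding fs_def using \<open>L \<noteq> []\<close> xs(2) by (intro regular_sequence_vars) auto
  moreover have "set fs \<subseteq> irrelevant_ideal"
    using ring.genideal_self[OF class_ring.ring_axioms, of "range var"] by (auto simp: fs_def irrelevant_ideal_def)
  moreover have "length fs = q" using len q by (simp add: fs_def)
  moreover have "int (hilbert_function N grading (int k)) = fps_nth (alpha_series CARD('n) \<alpha>) k" for k
  proof -
    have "int (hilbert_function N grading (int k)) = (\<Sum>a<length L. fps_nth (w (L ! a)) k)"
      unfolding dim_component_N
      by (intro sum.cong) (auto simp: w_def s_def card_T fps_X_power_mult_nth nat_diff_distrib')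
    also have "\<dots> = fps_nth (sum_list (map w L)) k"
      by (simp add: sum_list_sum_nth fps_sum_nth atLeast0LessThan)
    finally show ?thesis by (simp add: L_sum)
  qed
  moreover have "hilbert_function N grading i = 0" if "i < 0" for i
    using dim_component_N[of i] that by simp
  ultimately show ?thesis
    using that graded_module_N finitely_generated_N by blast
qed

theorem theorem2p4:
  fixes I J :: "('n::finite, 'k::field) mpoly set"
  assumes "squarefree_monomial_ideal I"
    and "squarefree_monomial_ideal J"
    and "I \<subset> J"
  shows "hdepth (ideal_quotient J I) (ideal_quotient_grading J I) =
    Max {q \<in> {0..CARD('n)}. \<forall>k\<in>{0..q}. beta J I q k \<ge> 0}"
proof -
  define \<alpha> where "\<alpha> = alpha J I"
  define B where "B = {q \<in> {0..CARD('n)}. \<forall>k\<in>{0..q}. beta J I q k \<ge> 0}"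
  have beta: "beta J I q k = beta_sum \<alpha> q k" for q k
    by (simp add: beta_def beta_sum_def \<alpha>_def)
  let ?h = "hilbert_function (ideal_quotient J I) (ideal_quotient_grading J I)"
  note h = hilbert_function_ideal_quotient[OF assms, folded \<alpha>_def]
  have nz: "alpha_series CARD('n) \<alpha> \<noteq> 0"
  proof
    assume 0: "alpha_series CARD('n) \<alpha> = 0"
    have "?h i = 0" for i
      using h(1)[of i] h(2)[of "nat i"] by (cases "i < 0") (simp_all add: 0)
    then show False using h(4) by simp
  qed
  \<comment> \<open>For \<open>q = 0\<close> the only condition is that \<open>\<alpha> 0\<close> is
    nonnegative, so the maximum is taken over a nonempty set.\<close>
  have finB: "finite B" and "0 \<in> B" by (simp_all add: B_def beta beta_sum_def)
  have bounded: "length fs \<le> Max B"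
    if "graded_module M G" "finitely_generated M" "\<And>i. hilbert_function M G i = ?h i"
      "set fs \<subseteq> irrelevant_ideal" "regular_sequence M fs"
    for M :: "(('n, 'k) mpoly, (nat \<Rightarrow> ('n, 'k) mpoly) set) module" and G fs
  proof -
    have "length fs \<le> CARD('n) \<and> (\<forall>k\<le>length fs. beta_sum \<alpha> (length fs) k \<ge> 0)"
      by (rule regular_sequence_length_bound[OF that(1,2,4,5)]) (simp_all add: that(3) h nz)
    then have "length fs \<in> B" by (simp add: B_def beta)
    then show ?thesis by (rule Max_ge[OF finB])
  qed
  have h_bounded: "\<exists>b. \<forall>i<b. ?h i = 0" using h(1) by blast
  have dims: "hilbert_function M G i = ?h i"
    if "graded_module M G" "finitely_generated M" "hilbert_series M G = hilbert_series (ideal_quotient J I) (ideal_quotient_grading J I)"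
    for M :: "(('n, 'k) mpoly, (nat \<Rightarrow> ('n, 'k) mpoly) set) module" and G i
    using hilbert_series_eqD[OF that(3) graded_module.component_finite_dimensional(2)[OF that(1,2)] h_bounded] .
  have Q: "Max B \<in> B" using Max_in[OF finB] \<open>0 \<in> B\<close> by blast
  define D where "D = {depth M | (M :: (('n, 'k) mpoly, (nat \<Rightarrow> ('n, 'k) mpoly) set) module) G.
    graded_module M G \<and> finitely_generated M \<and> hilbert_series M G = hilbert_series (ideal_quotient J I) (ideal_quotient_grading J I)}"
  \<comment> \<open>\<open>Max\<close> is meaningful only on finite nonempty sets: the bound on
    lengths gives finiteness, the empty sequence nonemptiness.\<close>
  have depth_le: "finite {length fs | fs. set fs \<subseteq> irrelevant_ideal \<and> regular_sequence M fs} \<and> depth M \<le> Max B"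
    if M: "graded_module M G" "finitely_generated M" "hilbert_series M G = hilbert_series (ideal_quotient J I) (ideal_quotient_grading J I)"
    for M :: "(('n, 'k) mpoly, (nat \<Rightarrow> ('n, 'k) mpoly) set) module" and G
  proof -
    interpret graded_module M G by (rule M)
    let ?L = "{length fs | fs. set fs \<subseteq> irrelevant_ideal \<and> regular_sequence M fs}"
    have le: "l \<le> Max B" if "l \<in> ?L" for l
      using that bounded[OF M(1,2) dims[OF M]] by blast
    then have "finite ?L" by (intro finite_subset[of ?L "{..Max B}"]) auto
    moreover have "carrier M \<noteq> {\<zero>\<^bsub>M\<^esub>}"
      using hilbert_function_zero_module[OF M(1)] dims[OF M] h(4) by metis
    then have "regular_sequence M []"
      by (simp add: regular_sequence_def ideal_times_Nil)
    then have "?L \<noteq> {}" by force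
    ultimately show ?thesis unfolding depth_def using le by auto
  qed
  have "Max B \<in> D"
  proof -
    have "Max B \<le> CARD('n)" "\<And>k. k \<le> Max B \<Longrightarrow> beta_sum \<alpha> (Max B) k \<ge> 0"
      using Q by (auto simp: B_def beta)
    then obtain N :: "(('n, 'k) mpoly, (nat \<Rightarrow> ('n, 'k) mpoly) set) module" and H fs
      where N: "graded_module N H" "finitely_generated N" "\<And>i. i < 0 \<Longrightarrow> hilbert_function N H i = 0"
        "\<And>k. int (hilbert_function N H (int k)) = fps_nth (alpha_series CARD('n) \<alpha>) k"
        "set fs \<subseteq> irrelevant_ideal" "regular_sequence N fs" "length fs = Max B"
      using realize_alpha_series[of "Max B" \<alpha>] h(3) nz by metis
    have "hilbert_function N H i = ?h i" for i
      using N(3)[of i] N(4)[of "nat i"] h(1)[of i] h(2)[of "nat i"] by (cases "i < 0") simp_all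
    then have series: "hilbert_series N H = hilbert_series (ideal_quotient J I) (ideal_quotient_grading J I)"
      unfolding hilbert_series_def by simp
    have "length fs \<in> {length fs | fs. set fs \<subseteq> irrelevant_ideal \<and> regular_sequence N fs}"
      using N by blast
    then have "Max B \<le> depth N"
      unfolding depth_def using depth_le[OF N(1,2) series] N(7) by (metis (no_types, lifting) Max_ge)
    then have "depth N = Max B" using depth_le[OF N(1,2) series] by simp
    then show ?thesis 
      unfolding D_def using N(1,2) series by (intro CollectI exI[of _ N] exI[of _ H]) simp
  qed
  moreover have "d \<le> Max B" if "d \<in> D" for d
    using that depth_le unfolding D_def by blast
  ultimately have "Max D = Max B"
    by (intro Max_eqI finite_subset[of D "{..Max B}"]) auto
  then show ?thesis
    by (simp add: hdepth_def D_def B_def)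
qed

end
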